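(* Let $p\ge 0$ and $c\ge 1$ be fixed integers, let $x$ be a fixed real number, and consider homogeneous pooled data $\{(Z_{(j)},X_{(j1)},\dots,X_{(jc)})\}_{j=1}^J$ with common pool size $c$, $N=cJ$, where $m(s)=E(Y|X=s)$, $\sigma^2(s)=\mathrm{Var}(Y|X=s)$ and $f_X$ is the density of $X$. Assume: $m$ is $(p+3)$-th order continuously differentiable; $\sigma^2$ is second order continuously differentiable; $f_X$ is second order continuously differentiable and $f_X(x)>0$; the kernel $K$ is an even function; and $\mu_\ell=\int t^\ell K(t)\,dt$, $\nu_\ell=\int t^\ell K^2(t)\,dt$ are well-defined for $\ell=0,1,\dots,2p$. Assume further that $x$ is an interior point of a compact and nondegenerate interval $\mathcal I$, that $f_X$ is bounded away from zero on an interval $\mathcal J$ with $\mathcal I\subset\mathcal J$, and that $K(|t|)=0$ for $|t|>1$, with $K'(t)$ bounded. Let $\hat m_1(x)$ and $\hat m_2(x)$ be the $p$-th order average-weighted and product-weighted local polynomial estimators of $m(x)$ with bandwidth $h$ computed from these data, let $\beta_\ell=m^{(\ell)}(x)/\ell!$, and let $\mathbb X$ denote the collection of all covariate data. Then, as $J\to\infty$, $h\to0$ and $Jh^4\to\infty$, $$\begin{aligned}\hat m_1(x)-m(x)=\ &\boldsymbol e_1^\top h^{p+1}\Big\{\beta_{p+1}\tilde{\boldsymbol\mu}_0^{-1}\boldsymbol\mu_{p+1}^*+h f_X^{-1}(x)\Big[\{\beta_{p+2}f_X(x)+\beta_{p+1}f_X'(x)\}\tilde{\boldsymbol\mu}_0^{-1}\boldsymbol\mu_{p+2}^*\\&-\beta_{p+1}f_X'(x)\tilde{\boldsymbol\mu}_0^{-1}\tilde{\boldsymbol\mu}_1\tilde{\boldsymbol\mu}_0^{-1}\boldsymbol\mu_{p+1}^*\Big]+O(h^2)\Big\}+O_P\Big(\frac1{\sqrt{Nh}}\Big),\end{aligned}$$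 and $$\mathrm{Var}\{\hat m_1(x)|\mathbb X\}=\frac{\sigma^2(x)}{Nhf_X(x)}\,\boldsymbol e_1^\top\tilde{\boldsymbol\mu}_0^{-1}\tilde{\boldsymbol\nu}_0\tilde{\boldsymbol\mu}_0^{-1}\boldsymbol e_1\{1+o_P(1)\}.$$ If, in addition, $\mu_{\dagger,\ell}=\int t^\ell K^\dagger(t)\,dt$ and $\nu_{\dagger,\ell}=\int t^\ell \{K^{\dagger}(t)\}^2\,dt$ are well-defined for $\ell=0,1,\dots,2p$, where $K^\dagger(t)=K^c(t)=\{K(t)\}^c$, then $$\begin{aligned}\hat m_2(x)-m(x)=\ &\boldsymbol e_1^\top h^{p+1}\Big\{\beta_{p+1}\tilde{\boldsymbol\mu}_{\dagger,0}^{-1}\boldsymbol\mu_{\dagger,p+1}^*+h f_X^{-1}(x)\Big[\{\beta_{p+2}f_X(x)+\beta_{p+1}f_X'(x)\}\tilde{\boldsymbol\mu}_{\dagger,0}^{-1}\boldsymbol\mu_{\dagger,p+2}^*\\&-\beta_{p+1}f_X'(x)\tilde{\boldsymbol\mu}_{\dagger,0}^{-1}\tilde{\boldsymbol\mu}_{\dagger,1}\tilde{\boldsymbol\mu}_{\dagger,0}^{-1}\boldsymbol\mu_{\dagger,p+1}^*\Big]+O(h^2)\Big\}+O_P\Big(\frac1{\sqrt{Nh}}\Big),\end{aligned}$$ and $$\mathrm{Var}\{\hat m_2(x)|\mathbb X\}=\frac{\sigma^2(x)}{Nhf_X(x)}\,\boldsymbol e_1^\top\tilde{\boldsymbol\mu}_{\dagger,0}^{-1}\tilde{\boldsymbol\nu}_{\dagger,0}\tilde{\boldsymbol\mu}_{\dagger,0}^{-1}\boldsymbol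 e_1\{1+o_P(1)\}.$$
   Context: **Data (homogeneous pooling).** $N=cJ$ individuals have i.i.d. response–covariate pairs distributed as a pair $(Y,X)$ of real random variables, $X$ having density $f_X$; $c$ is fixed. The covariates are sorted as $X_{(11)}\le\dots\le X_{(1c)}\le X_{(21)}\le\dots\le X_{(2c)}\le\dots\le X_{(J1)}\le\dots\le X_{(Jc)}$, and pool $j$ consists of the individuals with covariates $X_{(j1)},\dots,X_{(jc)}$. $Y_{(jk)}$ denotes the (unobserved) response of the individual whose covariate is $X_{(jk)}$ (responses are not themselves sorted). Observed are all covariates and the pooled responses $Z_{(j)}=c^{-1}\sum_{k=1}^cY_{(jk)}$, $j=1,\dots,J$. **Kernel.** $K$ is a symmetric kernel ($\int K(t)\,dt=1$), $h>0$ is the bandwidth, $K_h(t)=K(t/h)/h$. All integrals are over $\mathbb R$. **Estimators.** For $\boldsymbol b=(b_0,\dots,b_p)^\top$ let $$Q_1(\boldsymbol b)=\sum_{j=1}^J\Big\{Z_{(j)}-\sum_{\ell=0}^p b_\ell\, c^{-1}\sum_{k=1}^c(X_{(jk)}-x)^\ell\Big\}^2\Big\{c^{-1}\sum_{k=1}^cK_h(X_{(jk)}-x)\Big\},$$ $$Q_2(\boldsymbol b)=\sum_{j=1}^J\Big\{Z_{(j)}-\sum_{\ell=0}^p b_\ell\, c^{-1}\sum_{k=1}^c(X_{(jk)}-x)^\ell\Big\}^2\Big\{\prod_{k=1}^cK_h(X_{(jk)}-x)\Big\}.$$ For $i=1,2$, $\hat m_i(x)$ is the first entry ($b_0$) of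 the minimizer of $Q_i$, i.e. $\hat m_i(x)=\boldsymbol e_1^\top(\mathbf D^\top\mathbf K_i\mathbf D)^{-1}\mathbf D^\top\mathbf K_i(Z_{(1)},\dots,Z_{(J)})^\top$, where $\mathbf D$ is the $J\times(p+1)$ matrix with $(j,\ell+1)$ entry $c^{-1}\sum_k(X_{(jk)}-x)^\ell$ and $\mathbf K_i$ is the diagonal matrix of the weights in $Q_i$. $\hat m_1$ is the average-weighted and $\hat m_2$ the product-weighted estimator. **Notation.** $\boldsymbol e_1=(1,0,\dots,0)^\top\in\mathbb R^{p+1}$. For nonnegative integers $\ell$: $\mu_\ell=\int t^\ell K(t)\,dt$, $\nu_\ell=\int t^\ell K^2(t)\,dt$; $\boldsymbol\mu_\ell^*=(\mu_\ell,\mu_{\ell+1},\dots,\mu_{\ell+p})^\top$; $\tilde{\boldsymbol\mu}_\ell=[\mu_{\ell_1+\ell_2+\ell}]_{\ell_1,\ell_2=0,1,\dots,p}$ and $\tilde{\boldsymbol\nu}_0=[\nu_{\ell_1+\ell_2}]_{\ell_1,\ell_2=0,1,\dots,p}$ are $(p+1)\times(p+1)$ matrices. $\boldsymbol\mu_{\dagger,\ell}^*$, $\tilde{\boldsymbol\mu}_{\dagger,\ell}$, $\tilde{\boldsymbol\nu}_{\dagger,0}$ are the counterparts of $\boldsymbol\mu_\ell^*$, $\tilde{\boldsymbol\mu}_\ell$, $\tilde{\boldsymbol\nu}_0$ with $K(t)$ replaced by $K^\dagger(t)=K^c(t)$. An $O(h^2)$ added to a vector is a vector with entries of that order; $O_P,o_P$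 denote stochastic orders.
   Formalization: When σ²(x)=0 the variance formulas with factor {1+o_P(1)} fail (e.g. σ²(s)=(s−x)²); there the variance is instead stated to be o_P(1)/(N h f_X(x)). Invertibility of the moment matrices μ̃_0 and, for the second estimator, μ̃_{†,0} is assumed explicitly. *)

theory Defs
  imports "HOL-Probability.Probability" "Jordan_Normal_Form.Gauss_Jordan_Elimination"
begin

unbundle no vec_syntax
hide_const (open) Finite_Cartesian_Product.vec Finite_Cartesian_Product.mat


section \<open>Homogeneous pooling\<close>

text \<open>Individuals, pools and pool members are numbered from 0. The sample consists of the
  individuals \<open>i < c * J\<close> with covariates \<open>xs i\<close> and responses \<open>ys i\<close>. Sorting the identities
  rather than the covariates lets each response travel with its own covariate:
  \<open>pool_member xs c J j k\<close> is the individual whose covariate is the \<open>k\<close>-th of the \<open>j\<close>-th pool.\<close>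

definition pool_member :: "(nat \<Rightarrow> real) \<Rightarrow> nat \<Rightarrow> nat \<Rightarrow> nat \<Rightarrow> nat \<Rightarrow> nat" where
  "pool_member xs c J j k = sort_key xs [0..<c * J] ! (j * c + k)"

definition pool_cov :: "(nat \<Rightarrow> real) \<Rightarrow> nat \<Rightarrow> nat \<Rightarrow> nat \<Rightarrow> nat \<Rightarrow> real" where
  "pool_cov xs c J j k = xs (pool_member xs c J j k)"

definition pool_response :: "(nat \<Rightarrow> real) \<Rightarrow> (nat \<Rightarrow> real) \<Rightarrow> nat \<Rightarrow> nat \<Rightarrow> nat \<Rightarrow> real" where
  "pool_response xs ys c J j = (\<Sum>k<c. ys (pool_member xs c J j k)) / real c"


section \<open>The estimators\<close>

definition mat_inv :: "real mat \<Rightarrow> real mat" where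
  "mat_inv A = (case mat_inverse A of Some B \<Rightarrow> B | None \<Rightarrow> 0\<^sub>m (dim_row A) (dim_col A))"

definition Kh :: "(real \<Rightarrow> real) \<Rightarrow> real \<Rightarrow> real \<Rightarrow> real" where
  "Kh K h t = K (t / h) / h"

definition design :: "nat \<Rightarrow> real \<Rightarrow> (nat \<Rightarrow> real) \<Rightarrow> nat \<Rightarrow> nat \<Rightarrow> real mat" where
  "design p x xs c J =
     Matrix.mat J (p + 1) (\<lambda>(j, l). (\<Sum>k<c. (pool_cov xs c J j k - x) ^ l) / real c)"

definition avg_weight ::
  "(real \<Rightarrow> real) \<Rightarrow> real \<Rightarrow> real \<Rightarrow> (nat \<Rightarrow> real) \<Rightarrow> nat \<Rightarrow> nat \<Rightarrow> nat \<Rightarrow> real" where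
  "avg_weight K h x xs c J j = (\<Sum>k<c. Kh K h (pool_cov xs c J j k - x)) / real c"

definition prod_weight ::
  "(real \<Rightarrow> real) \<Rightarrow> real \<Rightarrow> real \<Rightarrow> (nat \<Rightarrow> real) \<Rightarrow> nat \<Rightarrow> nat \<Rightarrow> nat \<Rightarrow> real" where
  "prod_weight K h x xs c J j = (\<Prod>k<c. Kh K h (pool_cov xs c J j k - x))"

text \<open>The first entry of the weighted least squares solution. If the Gram matrix is singular,
  where the solution is not defined, \<open>mat_inv\<close> makes the value 0.\<close>

definition wls_intercept ::
  "nat \<Rightarrow> real \<Rightarrow> (nat \<Rightarrow> real) \<Rightarrow> (nat \<Rightarrow> real) \<Rightarrow> nat \<Rightarrow> nat \<Rightarrow> (nat \<Rightarrow> real) \<Rightarrow> real" where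
  "wls_intercept p x xs ys c J w =
     (let D = design p x xs c J; W = mat_diag J w;
          Z = Matrix.vec J (pool_response xs ys c J)
      in unit_vec (p + 1) 0 \<bullet> (mat_inv (D\<^sup>T * W * D) *\<^sub>v (D\<^sup>T *\<^sub>v (W *\<^sub>v Z))))"

definition mhat_avg ::
  "(real \<Rightarrow> real) \<Rightarrow> nat \<Rightarrow> real \<Rightarrow> real \<Rightarrow> (nat \<Rightarrow> real) \<Rightarrow> (nat \<Rightarrow> real) \<Rightarrow> nat \<Rightarrow> nat \<Rightarrow> real" where
  "mhat_avg K p x h xs ys c J = wls_intercept p x xs ys c J (avg_weight K h x xs c J)"

definition mhat_prod ::
  "(real \<Rightarrow> real) \<Rightarrow> nat \<Rightarrow> real \<Rightarrow> real \<Rightarrow> (nat \<Rightarrow> real) \<Rightarrow> (nat \<Rightarrow> real) \<Rightarrow> nat \<Rightarrow> nat \<Rightarrow> real" where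
  "mhat_prod K p x h xs ys c J = wls_intercept p x xs ys c J (prod_weight K h x xs c J)"


section \<open>Kernel moments\<close>

definition mu :: "(real \<Rightarrow> real) \<Rightarrow> nat \<Rightarrow> real" where
  "mu K l = (\<integral>t. t ^ l * K t \<partial>lborel)"

definition nu :: "(real \<Rightarrow> real) \<Rightarrow> nat \<Rightarrow> real" where
  "nu K l = (\<integral>t. t ^ l * (K t)\<^sup>2 \<partial>lborel)"

definition mu_vec :: "(real \<Rightarrow> real) \<Rightarrow> nat \<Rightarrow> nat \<Rightarrow> real Matrix.vec" where
  "mu_vec K p l = Matrix.vec (p + 1) (\<lambda>i. mu K (l + i))"

definition mu_mat :: "(real \<Rightarrow> real) \<Rightarrow> nat \<Rightarrow> nat \<Rightarrow> real mat" where
  "mu_mat K p l = Matrix.mat (p + 1) (p + 1) (\<lambda>(i, j). mu K (i + j + l))"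

definition nu_mat :: "(real \<Rightarrow> real) \<Rightarrow> nat \<Rightarrow> real mat" where
  "nu_mat K p = Matrix.mat (p + 1) (p + 1) (\<lambda>(i, j). nu K (i + j))"

definition dagger :: "nat \<Rightarrow> (real \<Rightarrow> real) \<Rightarrow> real \<Rightarrow> real" where
  "dagger c K t = K t ^ c"

text \<open>The two leading terms inside the braces of the expansion of the estimator;
  \<open>f\<close> is the density of the covariate and \<open>m\<close> the regression function.\<close>

definition beta :: "(real \<Rightarrow> real) \<Rightarrow> real \<Rightarrow> nat \<Rightarrow> real" where
  "beta m x l = (deriv ^^ l) m x / fact l"

definition bias_vec ::
  "(real \<Rightarrow> real) \<Rightarrow> nat \<Rightarrow> (real \<Rightarrow> real) \<Rightarrow> (real \<Rightarrow> real) \<Rightarrow> real \<Rightarrow> real \<Rightarrow> real Matrix.vec" where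
  "bias_vec K p m f x h =
     (let S = mat_inv (mu_mat K p 0) in
        beta m x (p + 1) \<cdot>\<^sub>v (S *\<^sub>v mu_vec K p (p + 1))
        + (h / f x) \<cdot>\<^sub>v
          ((beta m x (p + 2) * f x + beta m x (p + 1) * deriv f x)
              \<cdot>\<^sub>v (S *\<^sub>v mu_vec K p (p + 2))
           - (beta m x (p + 1) * deriv f x)
              \<cdot>\<^sub>v (S *\<^sub>v (mu_mat K p 1 *\<^sub>v (S *\<^sub>v mu_vec K p (p + 1))))))"

definition var_const :: "(real \<Rightarrow> real) \<Rightarrow> nat \<Rightarrow> real" where
  "var_const K p =
     (let S = mat_inv (mu_mat K p 0); e = unit_vec (p + 1) 0
      in e \<bullet> (S *\<^sub>v (nu_mat K p *\<^sub>v (S *\<^sub>v e))))"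


section \<open>Probability and analysis\<close>

definition continuously_differentiable_order :: "nat \<Rightarrow> (real \<Rightarrow> real) \<Rightarrow> bool" where
  "continuously_differentiable_order k g \<longleftrightarrow>
     (\<forall>j<k. \<forall>s. (deriv ^^ j) g differentiable (at s)) \<and> continuous_on UNIV ((deriv ^^ k) g)"

definition cov_sigma :: "'a measure \<Rightarrow> (nat \<Rightarrow> 'a \<Rightarrow> real) \<Rightarrow> nat \<Rightarrow> 'a measure" where
  "cov_sigma M X N =
     vimage_algebra (space M) (\<lambda>\<omega>. \<lambda>i\<in>{..<N}. X i \<omega>) (\<Pi>\<^sub>M i\<in>{..<N}. borel)"

text \<open>\<open>V\<close> is a (finite) version of \<open>Var(W | F)\<close>. The outer conditional expectation is the
  extended nonnegative one, so that \<open>W\<close> need not be square integrable.\<close>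

definition has_cond_var ::
  "'a measure \<Rightarrow> 'a measure \<Rightarrow> ('a \<Rightarrow> real) \<Rightarrow> ('a \<Rightarrow> real) \<Rightarrow> bool" where
  "has_cond_var M F W V \<longleftrightarrow>
     (AE \<omega> in M. 0 \<le> V \<omega> \<and>
        nn_cond_exp M F (\<lambda>\<omega>'. ennreal ((W \<omega>' - real_cond_exp M F W \<omega>')\<^sup>2)) \<omega> = ennreal (V \<omega>))"

definition big_O_P :: "'a measure \<Rightarrow> (nat \<Rightarrow> 'a \<Rightarrow> real) \<Rightarrow> (nat \<Rightarrow> real) \<Rightarrow> bool" where
  "big_O_P M R a \<longleftrightarrow> (\<forall>n. R n \<in> borel_measurable M) \<and>
     (\<forall>\<epsilon>>0. \<exists>C. \<forall>\<^sub>F n in sequentially. measure M {\<omega> \<in> space M. \<bar>R n \<omega>\<bar> > C * a n} < \<epsilon>)"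

definition small_o_P :: "'a measure \<Rightarrow> (nat \<Rightarrow> 'a \<Rightarrow> real) \<Rightarrow> (nat \<Rightarrow> real) \<Rightarrow> bool" where
  "small_o_P M R a \<longleftrightarrow> (\<forall>n. R n \<in> borel_measurable M) \<and>
     (\<forall>\<delta>>0. (\<lambda>n. measure M {\<omega> \<in> space M. \<bar>R n \<omega>\<bar> > \<delta> * a n}) \<longlonglongrightarrow> 0)"

text \<open>\<open>T J - m x = e\<^sub>1\<^sup>T h\<^sup>p\<^sup>+\<^sup>1 {bias_vec + O(h\<^sup>2)} + O\<^sub>P(1 / \<surd>(N h))\<close> with \<open>N = c * J\<close>,
  the \<open>O(h\<^sup>2)\<close> being the nonrandom vector \<open>r J\<close>. The kernel \<open>G\<close> is \<open>K\<close> or its \<open>c\<close>-th power.\<close>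

definition has_expansion ::
  "'a measure \<Rightarrow> (nat \<Rightarrow> 'a \<Rightarrow> real) \<Rightarrow> (real \<Rightarrow> real) \<Rightarrow> nat \<Rightarrow> nat \<Rightarrow> (real \<Rightarrow> real) \<Rightarrow>
    (real \<Rightarrow> real) \<Rightarrow> real \<Rightarrow> (nat \<Rightarrow> real) \<Rightarrow> bool" where
  "has_expansion M T G p c m f x h \<longleftrightarrow>
     (\<exists>r R. (\<forall>J. r J \<in> carrier_vec (p + 1)) \<and>
        (\<forall>l\<le>p. (\<lambda>J. r J $ l) \<in> O(\<lambda>J. (h J)\<^sup>2)) \<and>
        big_O_P M R (\<lambda>J. 1 / sqrt (real (c * J) * h J)) \<and>
        (\<forall>J\<ge>1. \<forall>\<omega>\<in>space M. T J \<omega> - m x =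
           unit_vec (p + 1) 0 \<bullet> (h J ^ (p + 1) \<cdot>\<^sub>v (bias_vec G p m f x (h J) + r J)) + R J \<omega>))"

text \<open>\<open>Var(T J | XX) = \<sigma>\<^sup>2(x) / (N h f(x)) * var_const * {1 + o\<^sub>P(1)}\<close>. A vanishing \<open>\<sigma>\<^sup>2(x)\<close> does
  not force the left-hand side to vanish, since \<open>\<sigma>\<^sup>2\<close> may be positive near \<open>x\<close>; the \<open>o\<^sub>P(1)\<close> is
  then relative to \<open>1 / (N h f(x))\<close>.\<close>

definition has_cond_var_asymp ::
  "'a measure \<Rightarrow> (nat \<Rightarrow> 'a \<Rightarrow> real) \<Rightarrow> (nat \<Rightarrow> 'a \<Rightarrow> real) \<Rightarrow> (real \<Rightarrow> real) \<Rightarrow> nat \<Rightarrow> nat \<Rightarrow>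
    (real \<Rightarrow> real) \<Rightarrow> (real \<Rightarrow> real) \<Rightarrow> real \<Rightarrow> (nat \<Rightarrow> real) \<Rightarrow> bool" where
  "has_cond_var_asymp M X T G p c \<sigma>2 f x h \<longleftrightarrow>
     (\<exists>R. small_o_P M R (\<lambda>_. 1) \<and>
        (\<forall>J\<ge>1. has_cond_var M (cov_sigma M X (c * J)) (T J) (\<lambda>\<omega>.
           if \<sigma>2 x = 0 then 1 / (real (c * J) * h J * f x) * R J \<omega>
           else \<sigma>2 x / (real (c * J) * h J * f x) * var_const G p * (1 + R J \<omega>))))"

end

theory Submission
  imports Defs "Jordan_Normal_Form.Determinant"
begin

text \<open>The sorted pools are consecutive disjoint blocks, so inside the kernel window their spreads telescope.
  Hence every weighted pool average equals, up to a relative error of order \<open>1 / (J h)\<close>, the average over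
  the individuals obtained by restricting the weight of a pool to the diagonal: the two estimators
  behave like the ordinary local polynomial estimator with kernel \<open>K\<close> and \<open>K\<^sup>c\<close>, respectively. The averages
  over individuals are within \<open>O\<^sub>P(1 / sqrt (N h))\<close> of their means by Chebyshev's inequality, and the
  means are expanded by Taylor's formula.

  If \<open>y A = e\<^sub>1\<close> for the standardized Gram matrix \<open>A\<close>, then the error of the estimator is exactly
  \<open>y \<bullet> noise + h\<^sup>p\<^sup>+\<^sup>1 (y \<bullet> bias)\<close> and its conditional variance is a quadratic form in \<open>y\<close>, so both
  claims are perturbation statements for this linear system around \<open>f(x)\<close> times the matrix of kernel
  moments. Given the covariates the residuals are uncorrelated; this is proved on the product law of the
  sample after truncation, because neither the responses nor the estimator need be square integrable.\<close>


section \<open>Linear systems near an invertible one\<close>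

text \<open>The O(h^2) term of the claim is nonrandom, while the stochastic error has order
  1/sqrt(Nh); in general neither absorbs the other. Each random matrix and vector is therefore
  compared with its mean at the current bandwidth (\<open>Gram0\<close>, \<open>Bias0\<close>,
  \<open>Vmat0\<close>), and only these means are expanded in h. Inverses are never expanded: a
  candidate is substituted into a linear system and its residual estimated, which suffices because
  near an invertible matrix z is controlled by zA. Only the first row of the inverse Gram matrix
  enters, so row systems are enough. Constants must be uniform in bandwidth and sample; hence the
  fixed window [-2, 2] in the coordinates (X - x)/h, on which the weights are Lipschitz and the
  other functions bounded. The pooling error 1/(Jh) is, up to the factor c, the square of
  1/sqrt(Nh), so it is absorbed by the stochastic error. The relative form of the variance claim
  requires that the limiting constant not vanish; where the variance function is 0 at x, the error
  is absolute instead.\<close>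

lemma mat_inv_nonsing:
  assumes A: "A \<in> carrier_mat n n" and d: "Determinant.det A \<noteq> 0"
  shows "mat_inv A \<in> carrier_mat n n" "A * mat_inv A = 1\<^sub>m n" "mat_inv A * A = 1\<^sub>m n"
proof -
  have "mat_inverse A \<noteq> None"
    using det_non_zero_imp_unit[OF A d, where b="()"] mat_inverse(1)[OF A, where b="()"] by auto
  then obtain B where B: "mat_inverse A = Some B" by blast
  show "mat_inv A \<in> carrier_mat n n" "A * mat_inv A = 1\<^sub>m n" "mat_inv A * A = 1\<^sub>m n"
    using mat_inverse(2)[OF A B] B by (simp_all add: mat_inv_def)
qed

text \<open>An inverse B found by elimination would force det A * det B = 1, so on singular matrices
  \<open>mat_inv\<close> always returns its default.\<close>

lemma mat_inv_sing:
  assumes A: "A \<in> carrier_mat n n" and d: "Determinant.det A = 0"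
  shows "mat_inv A = 0\<^sub>m n n"
proof (cases "mat_inverse A")
  case None
  then show ?thesis using A by (simp add: mat_inv_def)
next
  case (Some B)
  note * = mat_inverse(2)[OF A this]
  have "Determinant.det A * Determinant.det B = Determinant.det (1\<^sub>m n)"
    using det_mult[OF A, of B] * by simp
  then show ?thesis using d by simp
qed

text \<open>Cramer's rule with the default value of \<open>mat_inv\<close> built in. Each entry
  becomes a quotient of polynomials in the entries of A, the form from which measurability can be
  read off.\<close>

lemma mat_inv_eq_adj:
  assumes A: "A \<in> carrier_mat n n" and ij: "i < n" "j < n"
  shows "mat_inv A $$ (i, j) = (if Determinant.det A = 0 then 0 else adj_mat A $$ (i, j) / Determinant.det A)"
proof (cases "Determinant.det A = 0")
  case True
  then show ?thesis using mat_inv_sing[OF A] ij by simp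
next
  case False
  note I = mat_inv_nonsing[OF A False] and adj = adj_mat[OF A]
  have "adj_mat A = (mat_inv A * A) * adj_mat A" using I adj by simp
  also have "\<dots> = mat_inv A * (A * adj_mat A)" using A adj(1) I(1) by (intro assoc_mult_mat) auto
  also have "\<dots> = Determinant.det A \<cdot>\<^sub>m mat_inv A"
    using I(1) adj by (metis mult_smult_distrib one_carrier_mat right_mult_one_mat)
  finally have "adj_mat A $$ (i, j) = Determinant.det A * mat_inv A $$ (i, j)" using I(1) ij by simp
  then show ?thesis using False by simp
qed

lemma invertible_imp_det_nonzero:
  fixes A :: "real mat"
  assumes A: "A \<in> carrier_mat n n" and "invertible_mat A"
  shows "Determinant.det A \<noteq> 0"
proof -
  obtain B where B: "inverts_mat A B" "inverts_mat B A"
    using assms(2) unfolding invertible_mat_def by blast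
  have AB: "A * B = 1\<^sub>m n" using B(1) A by (simp add: inverts_mat_def)
  \<comment> \<open>\<open>invertible_mat\<close> leaves the shape of B open; its dimensions are
    read off the two identities.\<close>
  have "dim_col B = n" using arg_cong[OF AB, of dim_col] by simp
  moreover have "dim_row B = n"
    using B(2) A unfolding inverts_mat_def by (metis carrier_matD(2) index_mult_mat(3) index_one_mat(3))
  ultimately have "B \<in> carrier_mat n n" by auto
  from det_mult[OF A this] AB show ?thesis by auto
qed

text \<open>As M S is the identity, z = (z M) S with z M = z A - z (A - M). At an entry of largest
  modulus the perturbation contributes at most half of that modulus, which is absorbed on the left.
  With w = 0 the bound gives a trivial kernel, with w = 1 it bounds solutions, and with small w it
  compares two solutions.\<close>

lemma near_invertible_row_bound:
  fixes A M S :: "nat \<Rightarrow> nat \<Rightarrow> real" and z :: "nat \<Rightarrow> real"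
  assumes inv: "\<And>i k. i < n \<Longrightarrow> k < n \<Longrightarrow> (\<Sum>j<n. M i j * S j k) = (if i = k then 1 else 0)"
    and S: "\<And>j k. j < n \<Longrightarrow> k < n \<Longrightarrow> \<bar>S j k\<bar> \<le> \<beta>"
    and AM: "\<And>i j. i < n \<Longrightarrow> j < n \<Longrightarrow> \<bar>A i j - M i j\<bar> \<le> \<delta>"
    and \<delta>: "real n * real n * \<beta> * \<delta> \<le> 1 / 2"
    and w: "\<And>j. j < n \<Longrightarrow> \<bar>\<Sum>i<n. z i * A i j\<bar> \<le> w"
    and k: "k < n"
  shows "\<bar>z k\<bar> \<le> 2 * real n * \<beta> * w"
proof -
  define Z where "Z = Max ((\<lambda>i. \<bar>z i\<bar>) ` {..<n})"
  have Zi: "\<bar>z i\<bar> \<le> Z" if "i < n" for i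
    unfolding Z_def using that by (intro Max_ge) auto
  have "Z \<in> (\<lambda>i. \<bar>z i\<bar>) ` {..<n}" unfolding Z_def using k by (intro Max_in) auto
  then obtain k0 where k0: "k0 < n" "Z = \<bar>z k0\<bar>" by auto
  have \<beta>0: "0 \<le> \<beta>" using S[OF k k] by linarith
  have "z k0 = (\<Sum>i<n. z i * (if i = k0 then 1 else 0))"
    using k0 by (simp add: mult_delta_right)
  also have "\<dots> = (\<Sum>i<n. z i * (\<Sum>j<n. M i j * S j k0))" using inv k0 by (intro sum.cong) auto
  also have "\<dots> = (\<Sum>j<n. (\<Sum>i<n. z i * M i j) * S j k0)"
    unfolding sum_distrib_left sum_distrib_right by (subst sum.swap) (simp add: mult_ac)
  also have "\<dots> = (\<Sum>j<n. ((\<Sum>i<n. z i * A i j) - (\<Sum>i<n. z i * (A i j - M i j))) * S j k0)"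
    by (intro sum.cong refl) (simp add: right_diff_distrib sum_subtractf)
  finally have "Z \<le> (\<Sum>j<n. \<bar>((\<Sum>i<n. z i * A i j) - (\<Sum>i<n. z i * (A i j - M i j))) * S j k0\<bar>)"
    using k0 by (simp only: sum_abs)
  also have "\<dots> \<le> (\<Sum>j<n. (w + real n * (Z * \<delta>)) * \<beta>)"
  proof (rule sum_mono)
    fix j assume j: "j \<in> {..<n}"
    have "\<bar>\<Sum>i<n. z i * (A i j - M i j)\<bar> \<le> (\<Sum>i<n. \<bar>z i * (A i j - M i j)\<bar>)" by (rule sum_abs)
    also have "\<dots> \<le> (\<Sum>i<n. Z * \<delta>)"
      using Zi AM j by (intro sum_mono) (auto simp: abs_mult intro!: mult_mono order_trans[OF abs_ge_zero Zi])
    finally have "\<bar>\<Sum>i<n. z i * (A i j - M i j)\<bar> \<le> real n * (Z * \<delta>)" by simp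
    moreover have "\<bar>\<Sum>i<n. z i * A i j\<bar> \<le> w" using w j by simp
    ultimately have "\<bar>(\<Sum>i<n. z i * A i j) - (\<Sum>i<n. z i * (A i j - M i j))\<bar> \<le> w + real n * (Z * \<delta>)"
      by linarith
    then show "\<bar>((\<Sum>i<n. z i * A i j) - (\<Sum>i<n. z i * (A i j - M i j))) * S j k0\<bar>
        \<le> (w + real n * (Z * \<delta>)) * \<beta>"
      unfolding abs_mult using S[of j k0] j k0 by (intro mult_mono) auto
  qed
  also have "\<dots> = real n * \<beta> * w + (real n * real n * \<beta> * \<delta>) * Z" by (simp add: algebra_simps)
  also have "\<dots> \<le> real n * \<beta> * w + 1 / 2 * Z"
    using \<delta> k0 by (intro add_left_mono mult_right_mono) auto
  finally have "Z \<le> 2 * real n * \<beta> * w" by simp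
  then show ?thesis using Zi[OF k] by linarith
qed

text \<open>Singularity is characterized by vectors acting from the right, hence the detour through
  the transpose. The solution is the row e times the inverse.\<close>

lemma row_kernel_trivial_imp_solution:
  fixes A :: "nat \<Rightarrow> nat \<Rightarrow> real"
  assumes ker: "\<And>z i. (\<And>j. j < n \<Longrightarrow> (\<Sum>i<n. z i * A i j) = 0) \<Longrightarrow> i < n \<Longrightarrow> z i = 0"
  shows "Determinant.det (Matrix.mat n n (\<lambda>(i, j). A i j)) \<noteq> 0"
    and "\<exists>y. \<forall>j<n. (\<Sum>i<n. y i * A i j) = e j"
proof -
  define T where "T = Matrix.mat n n (\<lambda>(i, j). A i j)"
  have T: "T \<in> carrier_mat n n" by (simp add: T_def)
  show d: "Determinant.det T \<noteq> 0"
  proof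
    assume "Determinant.det T = 0"
    then have "Determinant.det T\<^sup>T = 0" using T by (simp add: det_transpose)
    then obtain v where v: "v \<in> carrier_vec n" "v \<noteq> 0\<^sub>v n" "T\<^sup>T *\<^sub>v v = 0\<^sub>v n"
      using det_0_iff_vec_prod_zero_field[of "T\<^sup>T" n] T by auto
    have "(\<Sum>i<n. v $ i * A i j) = 0" if "j < n" for j
    proof -
      have "(T\<^sup>T *\<^sub>v v) $ j = 0" using v that by simp
      then show ?thesis using that v(1)
        by (simp add: T_def scalar_prod_def atLeast0LessThan mult.commute)
    qed
    then have "v $ i = 0" if "i < n" for i using ker that by blast
    then show False using v by (metis eq_vecI carrier_vecD index_zero_vec)
  qed
  note I = mat_inv_nonsing[OF T d]
  define y where "y i = (\<Sum>k<n. e k * mat_inv T $$ (k, i))" for i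
  have "(\<Sum>i<n. y i * A i j) = e j" if j: "j < n" for j
  proof -
    have "(\<Sum>i<n. y i * A i j) = (\<Sum>k<n. e k * (\<Sum>i<n. mat_inv T $$ (k, i) * A i j))"
      unfolding y_def sum_distrib_right sum_distrib_left by (subst sum.swap) (simp add: mult_ac)
    also have "\<dots> = (\<Sum>k<n. e k * (mat_inv T * T) $$ (k, j))"
    proof (intro sum.cong refl arg_cong2[where f="(*)"])
      fix k assume "k \<in> {..<n}"
      then show "(\<Sum>i<n. mat_inv T $$ (k, i) * A i j) = (mat_inv T * T) $$ (k, j)"
        using I(1) T j by (simp add: scalar_prod_def atLeast0LessThan T_def)
    qed
    also have "\<dots> = (\<Sum>k<n. e k * (if k = j then 1 else 0))" using I j by (intro sum.cong) auto
    also have "\<dots> = e j" using j by (simp add: mult_delta_right)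
    finally show ?thesis .
  qed
  then show "\<exists>y. \<forall>j<n. (\<Sum>i<n. y i * A i j) = e j" by blast
qed


section \<open>Measurability of the sorting permutation\<close>

lemma insort_key_cong:
  assumes "f a = g a" "\<And>y. y \<in> set ys \<Longrightarrow> f y = g y"
  shows "insort_key f a ys = insort_key g a ys"
  using assms by (induction ys) auto

lemma sort_key_cong:
  assumes "\<And>y. y \<in> set ys \<Longrightarrow> f y = g y"
  shows "sort_key f ys = sort_key g ys"
  using assms by (induction ys) (auto intro: insort_key_cong)

text \<open>Only covariates below \<open>c * J\<close> enter the sort. This permits replacing the
  covariate sequence by its restriction to the sample, the argument in which coefficients must be
  measurable.\<close>

lemma pool_member_cong:
  assumes "\<And>i. i < c * J \<Longrightarrow> xs i = ys i"
  shows "pool_member xs c J = pool_member ys c J"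
  using sort_key_cong[of "[0..<c * J]" xs ys] assms by (intro ext) (auto simp: pool_member_def)

text \<open>With the list fixed, insertion is a nested case distinction on comparisons of two
  covariates.\<close>

lemma measurable_insort_key_fixed:
  fixes X :: "nat \<Rightarrow> 'a \<Rightarrow> real"
  assumes "\<And>i. i \<in> insert a (set ys) \<Longrightarrow> X i \<in> borel_measurable N"
  shows "(\<lambda>\<omega>. insort_key (\<lambda>i. X i \<omega>) a ys) \<in> measurable N (count_space UNIV)"
  using assms
proof (induction ys)
  case (Cons y ys)
  have [measurable]: "X a \<in> borel_measurable N" "X y \<in> borel_measurable N"
    using Cons.prems by auto
  have [measurable]: "(\<lambda>\<omega>. y # insort_key (\<lambda>i. X i \<omega>) a ys) \<in> measurable N (count_space UNIV)"
    using measurable_compose[OF Cons.IH, of "\<lambda>l. y # l" "count_space UNIV"] Cons.prems by auto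
  show ?case by simp
qed simp

text \<open>The sorted tail is random, but it takes values in the countable set of lists over the
  given indices. For each value the next insertion is measurable by
  \<open>measurable_insort_key_fixed\<close>.\<close>

lemma measurable_sort_key:
  fixes X :: "nat \<Rightarrow> 'a \<Rightarrow> real"
  assumes "\<And>i. i \<in> set ys \<Longrightarrow> X i \<in> borel_measurable N"
  shows "(\<lambda>\<omega>. sort_key (\<lambda>i. X i \<omega>) ys) \<in> measurable N (count_space UNIV)"
  using assms
proof (induction ys)
  case (Cons y ys)
  have IH: "(\<lambda>\<omega>. sort_key (\<lambda>i. X i \<omega>) ys) \<in> measurable N (count_space (lists (set ys)))"
    by (rule measurable_count_space_extend[OF subset_UNIV]) (use Cons in auto)
  have "(\<lambda>\<omega>. insort_key (\<lambda>i. X i \<omega>) y (sort_key (\<lambda>i. X i \<omega>) ys)) \<in> measurable N (count_space UNIV)"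
  proof (rule measurable_compose_countable'[OF _ IH])
    fix l assume "l \<in> lists (set ys)"
    then show "(\<lambda>\<omega>. insort_key (\<lambda>i. X i \<omega>) y l) \<in> measurable N (count_space UNIV)"
      using Cons.prems by (intro measurable_insort_key_fixed) auto
  qed (auto intro: countable_lists)
  then show ?case by simp
qed simp

lemma
  assumes "j < J" "k < c"
  shows pool_index_less: "j * c + k < c * J"
    and pool_member_less: "pool_member xs c J j k < c * J"
proof -
  have "j * c + k < j * c + c" using assms by simp
  also have "\<dots> = Suc j * c" by simp
  also have "\<dots> \<le> J * c" using assms by (intro mult_le_mono1) auto
  finally show *: "j * c + k < c * J" by (simp add: mult.commute)
  have "sort_key xs [0..<c * J] ! (j * c + k) \<in> set (sort_key xs [0..<c * J])"
    using * by (intro nth_mem) simp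
  then show "pool_member xs c J j k < c * J" by (simp add: pool_member_def)
qed

lemma measurable_pool_member:
  fixes X :: "nat \<Rightarrow> 'a \<Rightarrow> real"
  assumes "\<And>i. i < c * J \<Longrightarrow> X i \<in> borel_measurable N"
  shows "(\<lambda>\<omega>. pool_member (\<lambda>i. X i \<omega>) c J j k) \<in> measurable N (count_space UNIV)"
proof -
  have "(\<lambda>\<omega>. sort_key (\<lambda>i. X i \<omega>) [0..<c * J]) \<in> measurable N (count_space UNIV)"
    using assms by (intro measurable_sort_key) auto
  from measurable_compose[OF this, of "\<lambda>l. l ! (j * c + k)" "count_space UNIV"]
  show ?thesis by (simp add: pool_member_def)
qed

text \<open>The selected index is itself random; since it ranges over a finite set, the composition
  is measurable piece by piece.\<close>

lemma measurable_pool_select: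
  fixes X Y :: "nat \<Rightarrow> 'a \<Rightarrow> real"
  assumes X: "\<And>i. i < c * J \<Longrightarrow> X i \<in> borel_measurable N"
    and Y: "\<And>i. i < c * J \<Longrightarrow> Y i \<in> borel_measurable N"
    and jk: "j < J" "k < c"
  shows "(\<lambda>\<omega>. Y (pool_member (\<lambda>i. X i \<omega>) c J j k) \<omega>) \<in> borel_measurable N"
proof -
  have "(\<lambda>\<omega>. pool_member (\<lambda>i. X i \<omega>) c J j k) \<in> measurable N (count_space {..<c * J})"
    by (rule measurable_count_space_extend[OF subset_UNIV])
      (use measurable_pool_member[of c J X N, OF X] pool_member_less[OF jk] in auto)
  from measurable_compose_countable'[OF _ this, of Y borel] Y show ?thesis by auto
qed

lemma measurable_det:
  assumes "\<And>\<omega>. A \<omega> \<in> carrier_mat n n"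
    and "\<And>i j. i < n \<Longrightarrow> j < n \<Longrightarrow> (\<lambda>\<omega>. A \<omega> $$ (i, j) :: real) \<in> borel_measurable N"
  shows "(\<lambda>\<omega>. Determinant.det (A \<omega>)) \<in> borel_measurable N"
proof -
  have "(\<lambda>\<omega>. \<Sum>p | p permutes {0..<n}. signof p * (\<Prod>i = 0..<n. A \<omega> $$ (i, p i))) \<in> borel_measurable N"
  proof (intro borel_measurable_sum borel_measurable_times borel_measurable_prod)
    fix p i assume "p \<in> {p. p permutes {0..<n}}" "i \<in> {0..<n}"
    then show "(\<lambda>\<omega>. A \<omega> $$ (i, p i)) \<in> borel_measurable N"
      using permutes_in_image[of p "{0..<n}" i] by (intro assms) auto
  qed simp
  then show ?thesis using det_def'[OF assms(1)] by simp
qed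

text \<open>By \<open>mat_inv_eq_adj\<close> it is enough to treat determinants: those of the matrix
  and of its minors, and the event that the former vanishes.\<close>

lemma measurable_mat_inv:
  assumes A: "\<And>\<omega>. A \<omega> \<in> carrier_mat n n"
    and meas: "\<And>i j. i < n \<Longrightarrow> j < n \<Longrightarrow> (\<lambda>\<omega>. A \<omega> $$ (i, j) :: real) \<in> borel_measurable N"
    and ij: "i < n" "j < n"
  shows "(\<lambda>\<omega>. mat_inv (A \<omega>) $$ (i, j)) \<in> borel_measurable N"
proof -
  have [measurable]: "(\<lambda>\<omega>. Determinant.det (A \<omega>)) \<in> borel_measurable N"
    using A meas by (rule measurable_det)
  have "(\<lambda>\<omega>. Determinant.det (mat_delete (A \<omega>) j i)) \<in> borel_measurable N"
  proof (rule measurable_det)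
    show "mat_delete (A \<omega>) j i \<in> carrier_mat (n - 1) (n - 1)" for \<omega>
      using mat_delete_carrier[OF A, of \<omega> j i] by simp
    fix k l assume kl: "k < n - 1" "l < n - 1"
    have eq: "mat_delete (A \<omega>) j i $$ (k, l) =
        A \<omega> $$ (if k < j then k else Suc k, if l < i then l else Suc l)" for \<omega>
      using A[of \<omega>] kl by (simp add: mat_delete_def)
    show "(\<lambda>\<omega>. mat_delete (A \<omega>) j i $$ (k, l)) \<in> borel_measurable N"
      unfolding eq using kl by (intro meas) auto
  qed
  then have [measurable]: "(\<lambda>\<omega>. adj_mat (A \<omega>) $$ (i, j)) \<in> borel_measurable N"
    using A ij by (simp add: adj_mat_def cofactor_def carrier_matD[OF A])
  show ?thesis
    unfolding mat_inv_eq_adj[OF A ij] by measurable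
qed


section \<open>Sums over pools\<close>

text \<open>Sorting permutes the indices and the sorted positions split into J blocks of length c,
  so a summation pool by pool visits each individual once.\<close>

lemma sum_pool_members:
  fixes g :: "nat \<Rightarrow> real"
  shows "(\<Sum>j<J. \<Sum>k<c. g (pool_member xs c J j k)) = (\<Sum>i<c * J. g i)"
proof -
  define L where "L = sort_key xs [0..<c * J]"
  have len: "length L = c * J" and dist: "distinct L" and set: "set L = {..<c * J}"
    by (auto simp: L_def)
  have "(\<Sum>j<J. \<Sum>k<c. g (pool_member xs c J j k)) = (\<Sum>j<J. sum (\<lambda>i. g (L ! i)) {j * c..<j * c + c})"
    unfolding pool_member_def L_def[symmetric]
    by (rule sum.cong[OF refl], subst sum.atLeastLessThan_shift_0) (simp add: atLeast0LessThan)
  also have "\<dots> = (\<Sum>i<J * c. g (L ! i))" by (rule sum.nat_group)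
  also have "\<dots> = (\<Sum>i<length L. g (L ! i))" by (simp add: len mult.commute)
  also have "\<dots> = (\<Sum>i\<in>set L. g i)"
    using dist bij_betw_nth[of L "{..<length L}" "set L"] by (intro sum.reindex_bij_betw) auto
  finally show ?thesis by (simp add: set)
qed


section \<open>Pool statistics versus sums over individuals\<close>

text \<open>The window \<open>[-2, 2]\<close> leaves room for the pools that overlap the support \<open>[-1, 1]\<close> of the kernel.\<close>

definition near_diag :: "real \<Rightarrow> nat \<Rightarrow> ((nat \<Rightarrow> real) \<Rightarrow> real) \<Rightarrow> (real \<Rightarrow> real) \<Rightarrow> bool" where
  "near_diag L c \<Psi> \<phi> \<longleftrightarrow>
     (\<forall>u s. (\<forall>k<c. \<bar>u k\<bar> \<le> 2) \<longrightarrow> (\<forall>k<c. \<forall>k'<c. \<bar>u k - u k'\<bar> \<le> s) \<longrightarrow>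
        \<bar>\<Psi> u\<bar> \<le> L \<and> (\<forall>k<c. \<bar>\<Psi> u - \<phi> (u k)\<bar> \<le> L * s))"

lemma near_diagD:
  assumes "near_diag L c \<Psi> \<phi>" "\<And>k. k < c \<Longrightarrow> \<bar>u k\<bar> \<le> 2"
    and "\<And>k k'. k < c \<Longrightarrow> k' < c \<Longrightarrow> \<bar>u k - u k'\<bar> \<le> s"
  shows "\<bar>\<Psi> u\<bar> \<le> L" and "k < c \<Longrightarrow> \<bar>\<Psi> u - \<phi> (u k)\<bar> \<le> L * s"
  using assms unfolding near_diag_def by blast+

text \<open>A constant vector has spread 0, so the closeness bound becomes an equality:
  \<open>near_diag\<close> forces \<phi> to be the restriction of \<Psi> to the diagonal of the
  window.\<close>

lemma near_diag_const:
  assumes "near_diag L c \<Psi> \<phi>" "1 \<le> c" "\<bar>t\<bar> \<le> 2"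
  shows "\<Psi> (\<lambda>_. t) = \<phi> t"
  using near_diagD(2)[OF assms(1), of "\<lambda>_. t" 0 0] assms by simp

lemma near_diag_bound:
  assumes "near_diag L c \<Psi> \<phi>" "1 \<le> c" "\<bar>t\<bar> \<le> 2"
  shows "\<bar>\<phi> t\<bar> \<le> L"
  using near_diagD(1)[OF assms(1), of "\<lambda>_. t" 0] near_diag_const[OF assms] assms by simp

lemma near_diag_nonneg:
  assumes "near_diag L c \<Psi> \<phi>" "1 \<le> c"
  shows "0 \<le> L"
  using near_diag_bound[OF assms, of 0] by simp

text \<open>The product rule for differences; the factor 2 arises because each of the two summands
  contributes \<open>L * L'\<close>.\<close>

lemma near_diag_mult:
  assumes 1: "near_diag L c \<Psi> \<phi>" and 2: "near_diag L' c \<Psi>' \<phi>'" and c: "1 \<le> c"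
  shows "near_diag (2 * L * L') c (\<lambda>u. \<Psi> u * \<Psi>' u) (\<lambda>t. \<phi> t * \<phi>' t)"
  unfolding near_diag_def
proof (intro allI impI conjI)
  fix u :: "nat \<Rightarrow> real" and s k assume u: "\<forall>k<c. \<bar>u k\<bar> \<le> 2" and s: "\<forall>k<c. \<forall>k'<c. \<bar>u k - u k'\<bar> \<le> s"
  have L: "0 \<le> L" "0 \<le> L'" using near_diag_nonneg[OF 1 c] near_diag_nonneg[OF 2 c] by auto
  have b: "\<bar>\<Psi> u\<bar> \<le> L" "\<bar>\<Psi>' u\<bar> \<le> L'"
    using near_diagD(1)[OF 1, of u s] near_diagD(1)[OF 2, of u s] u s by auto
  have "\<bar>\<Psi> u * \<Psi>' u\<bar> \<le> L * L'" unfolding abs_mult using b L by (intro mult_mono) auto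
  also have "\<dots> \<le> 2 * L * L'" using L by simp
  finally show "\<bar>\<Psi> u * \<Psi>' u\<bar> \<le> 2 * L * L'" .
  assume k: "k < c"
  have "\<bar>\<Psi> u * \<Psi>' u - \<phi> (u k) * \<phi>' (u k)\<bar> = \<bar>\<Psi> u * (\<Psi>' u - \<phi>' (u k)) + (\<Psi> u - \<phi> (u k)) * \<phi>' (u k)\<bar>"
    by (simp add: algebra_simps)
  also have "\<dots> \<le> \<bar>\<Psi> u\<bar> * \<bar>\<Psi>' u - \<phi>' (u k)\<bar> + \<bar>\<Psi> u - \<phi> (u k)\<bar> * \<bar>\<phi>' (u k)\<bar>"
    by (metis abs_mult abs_triangle_ineq)
  also have "\<dots> \<le> L * (L' * s) + (L * s) * L'"
    using near_diagD(2)[OF 1, of u s k] near_diagD(2)[OF 2, of u s k] near_diag_bound[OF 2 c, of "u k"] u s k b L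
    by (intro add_mono mult_mono) (auto intro: order_trans[OF abs_ge_zero])
  finally show "\<bar>\<Psi> u * \<Psi>' u - \<phi> (u k) * \<phi>' (u k)\<bar> \<le> 2 * L * L' * s" by (simp add: algebra_simps)
qed

lemma near_diag_component:
  assumes "n < c" and "\<And>t. \<bar>t\<bar> \<le> 2 \<Longrightarrow> \<bar>g t\<bar> \<le> L"
    and "\<And>s t. \<bar>s\<bar> \<le> 2 \<Longrightarrow> \<bar>t\<bar> \<le> 2 \<Longrightarrow> \<bar>g s - g t\<bar> \<le> L * \<bar>s - t\<bar>"
  shows "near_diag L c (\<lambda>u. g (u n)) g"
  unfolding near_diag_def
proof (intro allI impI conjI)
  fix u :: "nat \<Rightarrow> real" and s k assume u: "\<forall>k<c. \<bar>u k\<bar> \<le> 2" and s: "\<forall>k<c. \<forall>k'<c. \<bar>u k - u k'\<bar> \<le> s"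
  show "\<bar>g (u n)\<bar> \<le> L" using assms u by simp
  assume k: "k < c"
  have "0 \<le> L" using assms(2)[of 0] by linarith
  then have "L * \<bar>u n - u k\<bar> \<le> L * s" using s assms(1) k by (intro mult_left_mono) auto
  then show "\<bar>g (u n) - g (u k)\<bar> \<le> L * s" using assms(3)[of "u n" "u k"] u assms(1) k by force
qed

lemma near_diag_avg:
  assumes c: "1 \<le> c" and b: "\<And>t. \<bar>t\<bar> \<le> 2 \<Longrightarrow> \<bar>g t\<bar> \<le> L"
    and l: "\<And>s t. \<bar>s\<bar> \<le> 2 \<Longrightarrow> \<bar>t\<bar> \<le> 2 \<Longrightarrow> \<bar>g s - g t\<bar> \<le> L * \<bar>s - t\<bar>"
  shows "near_diag L c (\<lambda>u. (\<Sum>k<c. g (u k)) / real c) g"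
  unfolding near_diag_def
proof (intro allI impI conjI)
  fix u :: "nat \<Rightarrow> real" and s k assume u: "\<forall>k<c. \<bar>u k\<bar> \<le> 2" and s: "\<forall>k<c. \<forall>k'<c. \<bar>u k - u k'\<bar> \<le> s"
  have "\<bar>\<Sum>k<c. g (u k)\<bar> \<le> (\<Sum>k<c. L)"
    using u b by (intro order_trans[OF sum_abs] sum_mono) auto
  then show "\<bar>(\<Sum>k<c. g (u k)) / real c\<bar> \<le> L" using c by (simp add: field_simps)
  assume k: "k < c"
  have *: "\<bar>g (u i) - g (u k)\<bar> \<le> L * s" if "i < c" for i
    using near_diagD(2)[OF near_diag_component[OF that b l], of u s k] u s k by simp
  have "(\<Sum>k<c. g (u k)) / real c - g (u k) = (\<Sum>i<c. g (u i) - g (u k)) / real c"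
    using c by (simp add: sum_subtractf field_simps)
  moreover have "\<bar>\<Sum>i<c. g (u i) - g (u k)\<bar> \<le> (\<Sum>i<c. L * s)"
    using * by (intro order_trans[OF sum_abs] sum_mono) auto
  ultimately show "\<bar>(\<Sum>k<c. g (u k)) / real c - g (u k)\<bar> \<le> L * s" using c by (simp add: field_simps)
qed

text \<open>The induction runs over the number n of factors while the length c of the vector stays
  fixed, so the spread condition is the same throughout and each step multiplies by one
  component.\<close>

lemma near_diag_prod:
  assumes c: "1 \<le> c" and b: "\<And>t. \<bar>t\<bar> \<le> 2 \<Longrightarrow> \<bar>g t\<bar> \<le> L"
    and l: "\<And>s t. \<bar>s\<bar> \<le> 2 \<Longrightarrow> \<bar>t\<bar> \<le> 2 \<Longrightarrow> \<bar>g s - g t\<bar> \<le> L * \<bar>s - t\<bar>"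
    and "n \<le> c"
  shows "\<exists>L'. near_diag L' c (\<lambda>u. \<Prod>k<n. g (u k)) (\<lambda>t. g t ^ n)"
  using assms(4)
proof (induction n)
  case 0
  have "near_diag 1 c (\<lambda>u. 1) (\<lambda>t. 1)" unfolding near_diag_def by force
  then show ?case by auto
next
  case (Suc n)
  then obtain L' where "near_diag L' c (\<lambda>u. \<Prod>k<n. g (u k)) (\<lambda>t. g t ^ n)" by auto
  from near_diag_mult[OF this near_diag_component[OF _ b l, of n c] c] Suc.prems
  show ?case by (auto simp: mult.commute)
qed

lemma power_Lipschitz:
  "\<exists>C\<ge>0. \<forall>s t :: real. \<bar>s\<bar> \<le> 2 \<longrightarrow> \<bar>t\<bar> \<le> 2 \<longrightarrow> \<bar>s ^ l - t ^ l\<bar> \<le> C * \<bar>s - t\<bar>"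
proof (induction l)
  case (Suc l)
  then obtain C where C: "C \<ge> 0" "\<And>s t :: real. \<bar>s\<bar> \<le> 2 \<Longrightarrow> \<bar>t\<bar> \<le> 2 \<Longrightarrow> \<bar>s ^ l - t ^ l\<bar> \<le> C * \<bar>s - t\<bar>"
    by blast
  have "\<bar>s ^ Suc l - t ^ Suc l\<bar> \<le> (2 * C + 2 ^ l) * \<bar>s - t\<bar>" if "\<bar>s\<bar> \<le> 2" "\<bar>t\<bar> \<le> 2" for s t :: real
  proof -
    have "\<bar>s ^ Suc l - t ^ Suc l\<bar> = \<bar>s * (s ^ l - t ^ l) + t ^ l * (s - t)\<bar>" by (simp add: algebra_simps)
    also have "\<dots> \<le> \<bar>s\<bar> * \<bar>s ^ l - t ^ l\<bar> + \<bar>t\<bar> ^ l * \<bar>s - t\<bar>"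
      by (metis abs_mult abs_triangle_ineq power_abs)
    also have "\<dots> \<le> 2 * (C * \<bar>s - t\<bar>) + 2 ^ l * \<bar>s - t\<bar>"
      using that C by (intro add_mono mult_mono power_mono) auto
    finally show ?thesis by (simp add: algebra_simps)
  qed
  then show ?case using C(1) by (intro exI[of _ "2 * C + 2 ^ l"]) auto
qed (auto intro: exI[of _ 0])

lemma near_diag_power:
  assumes "1 \<le> c"
  shows "\<exists>L. near_diag L c (\<lambda>u. (\<Sum>k<c. u k ^ l) / real c) (\<lambda>t. t ^ l)"
proof -
  obtain C where C: "C \<ge> 0" "\<And>s t :: real. \<bar>s\<bar> \<le> 2 \<Longrightarrow> \<bar>t\<bar> \<le> 2 \<Longrightarrow> \<bar>s ^ l - t ^ l\<bar> \<le> C * \<bar>s - t\<bar>"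
    using power_Lipschitz[of l] by blast
  have "near_diag (max C (2 ^ l)) c (\<lambda>u. (\<Sum>k<c. u k ^ l) / real c) (\<lambda>t. t ^ l)"
  proof (rule near_diag_avg[OF assms])
    show "\<bar>t ^ l\<bar> \<le> max C (2 ^ l)" if "\<bar>t\<bar> \<le> 2" for t :: real
      using power_mono[OF that, of l] by (simp add: power_abs)
    show "\<bar>s ^ l - t ^ l\<bar> \<le> max C (2 ^ l) * \<bar>s - t\<bar>" if "\<bar>s\<bar> \<le> 2" "\<bar>t\<bar> \<le> 2" for s t :: real
      using C(2)[OF that] mult_right_mono[of C "max C (2 ^ l)" "\<bar>s - t\<bar>"] by simp
  qed
  then show ?thesis by blast
qed

section \<open>Localization of the pools and telescoping of their spreads\<close>

definition pool_std :: "(nat \<Rightarrow> real) \<Rightarrow> nat \<Rightarrow> nat \<Rightarrow> real \<Rightarrow> real \<Rightarrow> nat \<Rightarrow> nat \<Rightarrow> real" where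
  "pool_std xs c J x h j k = (pool_cov xs c J j k - x) / h"

text \<open>Enough covariates on either side of the kernel window keep every pool that meets the
  window within twice its width.\<close>

definition pools_local :: "(nat \<Rightarrow> real) \<Rightarrow> nat \<Rightarrow> nat \<Rightarrow> real \<Rightarrow> real \<Rightarrow> bool" where
  "pools_local xs c J x h \<longleftrightarrow>
     c \<le> card {i. i < c * J \<and> (xs i - x) / h \<in> {1<..<2}} \<and>
     c \<le> card {i. i < c * J \<and> (xs i - x) / h \<in> {-2<..<-1}}"

text \<open>\<open>pools_local\<close> counts individuals, whereas its consequence concerns
  positions in the sorted order; the sorting permutation identifies the two counts.\<close>

lemma card_sort_positions:
  "card {i. i < N \<and> P (xs i)} = card {n. n < N \<and> P (xs (sort_key xs [0..<N] ! n))}"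
proof -
  define L where "L = sort_key xs [0..<N]"
  have L: "length L = N" "distinct L" "set L = {..<N}" by (auto simp: L_def)
  have "inj_on ((!) L) {n. n < N \<and> P (xs (L ! n))}"
    using L by (auto simp: inj_on_def nth_eq_iff_index_eq)
  moreover have "(!) L ` {n. n < N \<and> P (xs (L ! n))} = {i. i < N \<and> P (xs i)}"
  proof (intro equalityI subsetI)
    fix i assume "i \<in> {i. i < N \<and> P (xs i)}"
    moreover from this obtain n where "n < length L" "L ! n = i"
      using L by (metis (no_types, lifting) in_set_conv_nth lessThan_iff mem_Collect_eq)
    ultimately show "i \<in> (!) L ` {n. n < N \<and> P (xs (L ! n))}"
      using L by auto
  next
    fix i assume "i \<in> (!) L ` {n. n < N \<and> P (xs (L ! n))}"
    then show "i \<in> {i. i < N \<and> P (xs i)}" using L nth_mem[of _ L] by auto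
  qed
  ultimately show ?thesis unfolding L_def[symmetric] by (metis card_image)
qed

text \<open>If one member of a pool were in [-1, 1] and another beyond 2, then all covariates
  standardized into (1, 2), at least c of them, would lie strictly between these two members in the
  sorted order. A block of c positions has fewer than c places strictly between two of its own. The
  left side is symmetric.\<close>

lemma pools_localD:
  assumes loc: "pools_local xs c J x h" and h: "0 < h" and j: "j < J" and k: "k < c" "k' < c"
    and u: "\<bar>pool_std xs c J x h j k\<bar> \<le> 1"
  shows "\<bar>pool_std xs c J x h j k'\<bar> \<le> 2"
proof -
  define v where "v n = (xs (sort_key xs [0..<c * J] ! n) - x) / h" for n
  have mono: "v n \<le> v n'" if "n \<le> n'" "n' < c * J" for n n'
    using sorted_nth_mono[of "map xs (sort_key xs [0..<c * J])" n n'] that h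
    by (simp add: v_def divide_right_mono)
  have std: "pool_std xs c J x h j i = v (j * c + i)" for i
    by (simp add: pool_std_def pool_cov_def pool_member_def v_def)
  have cards: "c \<le> card {n. n < c * J \<and> v n \<in> {1<..<2}}" "c \<le> card {n. n < c * J \<and> v n \<in> {-2<..<-1}}"
    using loc card_sort_positions[of "c * J" "\<lambda>t. (t - x) / h \<in> {1<..<2}" xs]
      card_sort_positions[of "c * J" "\<lambda>t. (t - x) / h \<in> {-2<..<-1}" xs]
    by (auto simp: pools_local_def v_def)
  note idx = pool_index_less[OF j k(1)] pool_index_less[OF j k(2)]
  show ?thesis
  proof (rule ccontr)
    assume "\<not> ?thesis"
    then consider "2 < v (j * c + k')" | "v (j * c + k') < - 2" unfolding std by linarith
    then show False
    proof cases
      case 1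
      have "{n. n < c * J \<and> v n \<in> {1<..<2}} \<subseteq> {j * c + k<..<j * c + k'}"
      proof
        fix n assume n: "n \<in> {n. n < c * J \<and> v n \<in> {1<..<2}}"
        have "\<not> n \<le> j * c + k" using mono[of n "j * c + k"] idx u n unfolding std by force
        moreover have "\<not> j * c + k' \<le> n" using mono[of "j * c + k'" n] n 1 by force
        ultimately show "n \<in> {j * c + k<..<j * c + k'}" by simp
      qed
      from card_mono[OF _ this] cards(1) k show False by simp
    next
      case 2
      have "{n. n < c * J \<and> v n \<in> {-2<..<-1}} \<subseteq> {j * c + k'<..<j * c + k}"
      proof
        fix n assume n: "n \<in> {n. n < c * J \<and> v n \<in> {-2<..<-1}}"
        have "\<not> j * c + k \<le> n" using mono[of "j * c + k" n] u n unfolding std by force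
        moreover have "\<not> n \<le> j * c + k'" using mono[of n "j * c + k'"] idx n 2 by force
        ultimately show "n \<in> {j * c + k'<..<j * c + k}" by simp
      qed
      from card_mono[OF _ this] cards(2) k show False by simp
    qed
  qed
qed

text \<open>The pools are disjoint consecutive blocks of the sorted sample, so the spreads of the pools
  inside the window \<open>[-2, 2]\<close> add up to at most 4.\<close>

lemma pool_stat_close:
  assumes near: "near_diag L c \<Psi> \<phi>" and c: "1 \<le> c" and h: "0 < h"
    and van: "\<And>u. (\<And>k. k < c \<Longrightarrow> 1 < \<bar>u k\<bar>) \<Longrightarrow> \<Psi> u = 0" "\<And>t. 1 < \<bar>t\<bar> \<Longrightarrow> \<phi> t = 0"
    and \<psi>: "\<And>t. \<bar>t\<bar> \<le> 2 \<Longrightarrow> \<bar>\<psi> t\<bar> \<le> B"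
    and loc: "pools_local xs c J x h"
  shows "\<bar>(\<Sum>j<J. \<Psi> (pool_std xs c J x h j) * ((\<Sum>k<c. \<psi> (pool_std xs c J x h j k)) / real c))
           - (\<Sum>i<c * J. \<phi> ((xs i - x) / h) * \<psi> ((xs i - x) / h)) / real c\<bar> \<le> 4 * L * B"
proof -
  define u where "u = pool_std xs c J x h"
  define v where "v n = (xs (sort_key xs [0..<c * J] ! n) - x) / h" for n
  have mono: "v n \<le> v n'" if "n \<le> n'" "n' < c * J" for n n'
    using sorted_nth_mono[of "map xs (sort_key xs [0..<c * J])" n n'] that h
    by (simp add: v_def divide_right_mono)
  have uv: "u j i = v (j * c + i)" for j i
    by (simp add: u_def pool_std_def pool_cov_def pool_member_def v_def)
  \<comment> \<open>Order statistics clamped to the window and continued by 2 past the last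
    position: a monotone sequence of total variation at most 4 that is also defined at
    \<open>J * c\<close>, where the telescoping sum ends.\<close>
  define w where "w n = (if n < c * J then max (-2) (min 2 (v n)) else 2)" for n
  have w_mono: "w n \<le> w n'" if "n \<le> n'" for n n'
    using mono[OF that] that by (auto simp: w_def)
  have L0: "0 \<le> L" and B0: "0 \<le> B" using near_diag_nonneg[OF near c] \<psi>[of 0] by auto
  have "(\<Sum>i<c * J. \<phi> ((xs i - x) / h) * \<psi> ((xs i - x) / h)) / real c
      = (\<Sum>j<J. (\<Sum>k<c. \<phi> (u j k) * \<psi> (u j k)) / real c)"
    unfolding sum_divide_distrib[symmetric]
    by (subst sum_pool_members[symmetric, where xs=xs]) (simp add: u_def pool_std_def pool_cov_def)
  then have "\<bar>(\<Sum>j<J. \<Psi> (u j) * ((\<Sum>k<c. \<psi> (u j k)) / real c))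
           - (\<Sum>i<c * J. \<phi> ((xs i - x) / h) * \<psi> ((xs i - x) / h)) / real c\<bar>
      = \<bar>\<Sum>j<J. (\<Sum>k<c. (\<Psi> (u j) - \<phi> (u j k)) * \<psi> (u j k)) / real c\<bar>"
    by (simp add: sum_subtractf[symmetric] sum_distrib_left diff_divide_distrib[symmetric] left_diff_distrib)
  also have "\<dots> \<le> (\<Sum>j<J. L * B * (w (j * c + (c - 1)) - w (j * c)))"
  proof (intro order_trans[OF sum_abs] sum_mono)
    fix j assume "j \<in> {..<J}"
    then have j: "j < J" by simp
    have idx: "j * c + i < c * J" if "i < c" for i using pool_index_less[OF j that] .
    have w0: "0 \<le> w (j * c + (c - 1)) - w (j * c)" using w_mono[of "j * c" "j * c + (c - 1)"] by simp
    show "\<bar>(\<Sum>k<c. (\<Psi> (u j) - \<phi> (u j k)) * \<psi> (u j k)) / real c\<bar>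
        \<le> L * B * (w (j * c + (c - 1)) - w (j * c))"
    \<comment> \<open>A pool without a member in [-1, 1] contributes nothing to either sum. Any
      other pool lies entirely in [-2, 2], where the clamping in \<open>w\<close> is
      inactive.\<close>
    proof (cases "\<exists>k<c. \<bar>u j k\<bar> \<le> 1")
      case False
      then have "\<Psi> (u j) = 0" "\<And>k. k < c \<Longrightarrow> \<phi> (u j k) = 0" using van by force+
      then show ?thesis using w0 L0 B0 by simp
    next
      case True
      then have u2: "\<bar>u j k\<bar> \<le> 2" if "k < c" for k
        using pools_localD[OF loc h j _ that] unfolding u_def by blast
      have wv: "w (j * c + i) = u j i" if "i < c" for i
        using u2[OF that] idx[OF that] by (auto simp: w_def uv)
      have spread: "\<bar>u j k - u j k'\<bar> \<le> w (j * c + (c - 1)) - w (j * c)" if "k < c" "k' < c" for k k'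
      proof -
        have *: "v (j * c) \<le> v (j * c + i) \<and> v (j * c + i) \<le> v (j * c + (c - 1))" if "i < c" for i
          using mono[of "j * c + i" "j * c + (c - 1)"] mono[of "j * c" "j * c + i"]
            idx[OF that] idx[of "c - 1"] that c by linarith
        show ?thesis
          using *[OF that(1)] *[OF that(2)] wv[of "c - 1"] wv[of 0] c unfolding uv by auto
      qed
      have "\<bar>\<Sum>k<c. (\<Psi> (u j) - \<phi> (u j k)) * \<psi> (u j k)\<bar>
          \<le> (\<Sum>k<c. (L * (w (j * c + (c - 1)) - w (j * c))) * B)"
        using near_diagD(2)[OF near, of "u j" "w (j * c + (c - 1)) - w (j * c)"] u2 spread \<psi> L0 w0
        by (intro order_trans[OF sum_abs] sum_mono) (auto simp: abs_mult intro!: mult_mono)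
      then show ?thesis using c by (simp add: field_simps)
    qed
  qed
  \<comment> \<open>By monotonicity the spread of a pool is at most the gap between its first member
    and the first member of the next pool; these gaps telescope.\<close>
  also have "\<dots> \<le> (\<Sum>j<J. L * B * (w (Suc j * c) - w (j * c)))"
    using L0 B0 by (intro sum_mono mult_left_mono diff_right_mono w_mono) auto
  also have "\<dots> = L * B * (w (J * c) - w (0 * c))"
    unfolding sum_distrib_left[symmetric] by (subst sum_lessThan_telescope) simp
  also have "\<dots> \<le> L * B * 4"
    using L0 B0 by (intro mult_left_mono) (auto simp: w_def)
  finally show ?thesis by (simp add: u_def mult_ac)
qed


section \<open>Conditional moments of linear combinations of the responses\<close>

text \<open>Each integral is the total mass of the measure with that density, hence the supremum of
  the masses of the increasing sets. This undoes a truncation for integrals that may be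
  infinite.\<close>

lemma nn_integral_eq_on_incseq:
  fixes F G :: "'b \<Rightarrow> ennreal"
  assumes [measurable]: "F \<in> borel_measurable N" "G \<in> borel_measurable N" "\<And>n. A n \<in> sets N"
    and inc: "incseq A" and un: "(\<Union>n::nat. A n) = space N"
    and eq: "\<And>n. (\<integral>\<^sup>+z. F z * indicator (A n) z \<partial>N) = (\<integral>\<^sup>+z. G z * indicator (A n) z \<partial>N)"
  shows "(\<integral>\<^sup>+z. F z \<partial>N) = (\<integral>\<^sup>+z. G z \<partial>N)"
proof -
  have *: "(\<integral>\<^sup>+z. H z \<partial>N) = (SUP n. (\<integral>\<^sup>+z. H z * indicator (A n) z \<partial>N))"
    if [measurable]: "H \<in> borel_measurable N" for H
  proof -
    have "(SUP n. emeasure (density N H) (A n)) = emeasure (density N H) (\<Union>n. A n)"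
      by (intro SUP_emeasure_incseq inc) auto
    also have "\<dots> = (\<integral>\<^sup>+z. H z * indicator (space N) z \<partial>N)"
      unfolding un by (subst emeasure_density) auto
    also have "\<dots> = (\<integral>\<^sup>+z. H z \<partial>N)" by (intro nn_integral_cong) simp
    finally show ?thesis by (simp add: emeasure_density)
  qed
  show ?thesis by (simp add: * eq)
qed

locale pooled_sample = prob_space M for M :: "'a measure" +
  fixes X Y :: "nat \<Rightarrow> 'a \<Rightarrow> real" and m \<sigma>2 f :: "real \<Rightarrow> real"
  assumes indep: "indep_vars (\<lambda>_. borel) (\<lambda>i \<omega>. (Y i \<omega>, X i \<omega>)) UNIV"
    and ident: "\<And>i. distr M borel (\<lambda>\<omega>. (Y i \<omega>, X i \<omega>)) = distr M borel (\<lambda>\<omega>. (Y 0 \<omega>, X 0 \<omega>))"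
    and f_density: "distributed M lborel (X 0) (\<lambda>s. ennreal (f s))" "\<And>s. 0 \<le> f s"
    and Y_integrable0: "integrable M (Y 0)"
    and regression: "AE \<omega> in M. real_cond_exp M (vimage_algebra (space M) (X 0) borel) (Y 0) \<omega> = m (X 0 \<omega>)"
    and cond_var: "has_cond_var M (vimage_algebra (space M) (X 0) borel) (Y 0) (\<lambda>\<omega>. \<sigma>2 (X 0 \<omega>))"
    and m_cont: "continuous_on UNIV m" and \<sigma>2_cont: "continuous_on UNIV \<sigma>2"
begin

lemma m_meas [measurable]: "m \<in> borel_measurable borel"
  and \<sigma>2_meas [measurable]: "\<sigma>2 \<in> borel_measurable borel"
  using m_cont \<sigma>2_cont by (auto intro: borel_measurable_continuous_onI)

lemma pair_meas [measurable]: "(\<lambda>\<omega>. (Y i \<omega>, X i \<omega>)) \<in> measurable M borel"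
  using indep by (auto simp: indep_vars_def)

lemma fst_borel [measurable]: "(fst :: real \<times> real \<Rightarrow> real) \<in> borel_measurable borel"
  and snd_borel [measurable]: "(snd :: real \<times> real \<Rightarrow> real) \<in> borel_measurable borel"
  by (auto intro!: borel_measurable_continuous_onI continuous_intros)

lemma XY_meas [measurable]: "X i \<in> borel_measurable M" "Y i \<in> borel_measurable M"
  using measurable_compose[OF pair_meas[of i] snd_borel] measurable_compose[OF pair_meas[of i] fst_borel] by simp_all

section \<open>Residual moments under the law of one pair\<close>

definition law :: "(real \<times> real) measure" where
  "law = distr M borel (\<lambda>\<omega>. (Y 0 \<omega>, X 0 \<omega>))"

lemma sets_law [measurable_cong, simp]: "sets law = sets borel"
  by (simp add: law_def)

lemma space_law [simp]: "space law = UNIV"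
  by (simp add: law_def)

lemma prob_space_law: "prob_space law"
  unfolding law_def by (intro prob_space_distr) simp

abbreviation F0 :: "'a measure" where "F0 \<equiv> vimage_algebra (space M) (X 0) borel"

lemma F0_subalgebra: "subalgebra M F0"
  unfolding subalgebra_def by (auto simp: sets_vimage_algebra2 intro!: measurable_sets[OF XY_meas(1)])

lemma sigma_finite_F0: "sigma_finite_subalgebra M F0"
  using F0_subalgebra
  by (intro finite_measure_subalgebra_is_sigma_finite finite_measure_subalgebra.intro
      finite_measure_subalgebra_axioms.intro) (unfold_locales, auto)

lemma X0_F0 [measurable]: "X 0 \<in> borel_measurable F0"
  by (intro measurable_vimage_algebra1) auto

lemma mX0_integrable: "integrable M (\<lambda>\<omega>. m (X 0 \<omega>))"
proof -
  interpret sigma_finite_subalgebra M F0 by (rule sigma_finite_F0)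
  show ?thesis
    using integrable_cong_AE[THEN iffD1, OF _ _ regression] real_cond_exp_int(1)[OF Y_integrable0] by simp
qed

text \<open>Conditioning on X replaces the residual by its conditional mean 0. If the product is not
  integrable, the Bochner integral is 0 by convention, so the identity holds for every measurable
  \<psi>.\<close>

lemma law_residual_mean:
  assumes [measurable]: "\<psi> \<in> borel_measurable borel"
  shows "(\<integral>z. \<psi> (snd z) * (fst z - m (snd z)) \<partial>law) = (0::real)"
proof -
  interpret sigma_finite_subalgebra M F0 by (rule sigma_finite_F0)
  let ?e = "\<lambda>\<omega>. Y 0 \<omega> - m (X 0 \<omega>)"
  have "(\<integral>z. \<psi> (snd z) * (fst z - m (snd z)) \<partial>law) = (\<integral>\<omega>. \<psi> (X 0 \<omega>) * ?e \<omega> \<partial>M)"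
    unfolding law_def by (subst integral_distr) auto
  also have "\<dots> = 0"
  proof (cases "integrable M (\<lambda>\<omega>. \<psi> (X 0 \<omega>) * ?e \<omega>)")
    case True
    have "(\<integral>\<omega>. \<psi> (X 0 \<omega>) * ?e \<omega> \<partial>M) = (\<integral>\<omega>. \<psi> (X 0 \<omega>) * real_cond_exp M F0 ?e \<omega> \<partial>M)"
      by (intro real_cond_exp_intg(2)[symmetric] True) auto
    also have "\<dots> = (\<integral>\<omega>. 0 \<partial>M)"
    proof (intro integral_cong_AE)
      have "AE \<omega> in M. real_cond_exp M F0 ?e \<omega> = real_cond_exp M F0 (Y 0) \<omega> - real_cond_exp M F0 (\<lambda>\<omega>. m (X 0 \<omega>)) \<omega>"
        by (intro real_cond_exp_diff Y_integrable0 mX0_integrable)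
      moreover have "AE \<omega> in M. real_cond_exp M F0 (\<lambda>\<omega>. m (X 0 \<omega>)) \<omega> = m (X 0 \<omega>)"
        by (intro real_cond_exp_F_meas mX0_integrable) measurable
      ultimately show "AE \<omega> in M. \<psi> (X 0 \<omega>) * real_cond_exp M F0 ?e \<omega> = 0"
        using regression by eventually_elim simp
    qed auto
    finally show ?thesis by simp
  qed (simp add: not_integrable_integral_eq)
  finally show ?thesis .
qed

lemma cond_var_residual:
  "AE \<omega> in M. nn_cond_exp M F0 (\<lambda>\<omega>. ennreal ((Y 0 \<omega> - m (X 0 \<omega>))\<^sup>2)) \<omega> = ennreal (\<sigma>2 (X 0 \<omega>))"
proof -
  interpret sigma_finite_subalgebra M F0 by (rule sigma_finite_F0)
  have "AE \<omega> in M. nn_cond_exp M F0 (\<lambda>\<omega>. ennreal ((Y 0 \<omega> - real_cond_exp M F0 (Y 0) \<omega>)\<^sup>2)) \<omega>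
      = nn_cond_exp M F0 (\<lambda>\<omega>. ennreal ((Y 0 \<omega> - m (X 0 \<omega>))\<^sup>2)) \<omega>"
    using regression by (intro nn_cond_exp_cong) auto
  moreover have "AE \<omega> in M. nn_cond_exp M F0 (\<lambda>\<omega>. ennreal ((Y 0 \<omega> - real_cond_exp M F0 (Y 0) \<omega>)\<^sup>2)) \<omega> = ennreal (\<sigma>2 (X 0 \<omega>))"
    using cond_var by (simp add: has_cond_var_def)
  ultimately show ?thesis by eventually_elim simp
qed

text \<open>Extended nonnegative weights make the averaging property of the conditional expectation
  available even where both sides are infinite.\<close>

lemma law_residual_variance:
  fixes \<psi> :: "real \<Rightarrow> ennreal"
  assumes [measurable]: "\<psi> \<in> borel_measurable borel"
  shows "(\<integral>\<^sup>+z. \<psi> (snd z) * ennreal ((fst z - m (snd z))\<^sup>2) \<partial>law) = (\<integral>\<^sup>+z. \<psi> (snd z) * ennreal (\<sigma>2 (snd z)) \<partial>law)"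
proof -
  interpret sigma_finite_subalgebra M F0 by (rule sigma_finite_F0)
  let ?e = "\<lambda>\<omega>. ennreal ((Y 0 \<omega> - m (X 0 \<omega>))\<^sup>2)"
  have "(\<integral>\<^sup>+z. \<psi> (snd z) * ennreal ((fst z - m (snd z))\<^sup>2) \<partial>law) = (\<integral>\<^sup>+\<omega>. \<psi> (X 0 \<omega>) * ?e \<omega> \<partial>M)"
    unfolding law_def by (subst nn_integral_distr) auto
  also have "\<dots> = (\<integral>\<^sup>+\<omega>. \<psi> (X 0 \<omega>) * nn_cond_exp M F0 ?e \<omega> \<partial>M)"
    by (intro nn_cond_exp_intg[symmetric]) auto
  also have "\<dots> = (\<integral>\<^sup>+\<omega>. \<psi> (X 0 \<omega>) * ennreal (\<sigma>2 (X 0 \<omega>)) \<partial>M)"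
    using cond_var_residual by (intro nn_integral_cong_AE) auto
  also have "\<dots> = (\<integral>\<^sup>+z. \<psi> (snd z) * ennreal (\<sigma>2 (snd z)) \<partial>law)"
    unfolding law_def by (subst nn_integral_distr) auto
  finally show ?thesis .
qed

section \<open>Moments of residuals under the product law of the sample\<close>

sublocale laws: product_sigma_finite "\<lambda>_::nat. law"
  by (intro product_sigma_finite.intro prob_space_imp_sigma_finite prob_space_law)

abbreviation covs :: "nat \<Rightarrow> (nat \<Rightarrow> real \<times> real) \<Rightarrow> nat \<Rightarrow> real" where
  "covs N z \<equiv> (\<lambda>i\<in>{..<N}. snd (z i))"

definition residual :: "real \<times> real \<Rightarrow> real" where
  "residual z = fst z - m (snd z)"

lemma residual_meas [measurable]: "residual \<in> borel_measurable borel"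
  unfolding residual_def by measurable

text \<open>Filling the response with the dummy value 0 turns a functional that ignores response i
  into a function of covariate i alone, to which the identities for one pair apply.\<close>

lemma component_upd_meas:
  assumes "i < N" "x \<in> space (PiM ({..<N} - {i}) (\<lambda>_. law))"
  shows "(\<lambda>s. x(i := (0, s))) \<in> measurable borel (PiM {..<N} (\<lambda>_. law))"
proof -
  have "(\<lambda>v. x(i := v)) \<in> measurable law (PiM (insert i ({..<N} - {i})) (\<lambda>_. law))"
    using assms(2) by (rule measurable_component_update) simp
  moreover have "(\<lambda>s. (0, s)) \<in> measurable borel law"
    by (auto intro!: borel_measurable_continuous_onI continuous_intros simp: measurable_cong_sets[OF refl sets_law])
  ultimately show ?thesis using assms(1) measurable_compose by (force simp: insert_absorb)
qed

text \<open>Fubini with coordinate i integrated first. \<Psi> may involve covariate i and everything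
  about the other individuals, but not response i; for the others fixed it is thus a weight in
  \<open>law_residual_mean\<close>.\<close>

lemma product_residual_mean:
  fixes \<Psi> :: "(nat \<Rightarrow> real \<times> real) \<Rightarrow> real"
  assumes [measurable]: "\<Psi> \<in> borel_measurable (PiM {..<N} (\<lambda>_. law))" and i: "i < N"
    and free: "\<And>z y s. \<Psi> (z(i := (y, s))) = \<Psi> (z(i := (0, s)))"
  shows "(\<integral>z. \<Psi> z * residual (z i) \<partial>PiM {..<N} (\<lambda>_. law)) = 0"
proof (cases "integrable (PiM {..<N} (\<lambda>_. law)) (\<lambda>z. \<Psi> z * residual (z i))")
  case True
  define I where "I = {..<N} - {i}"
  have I: "finite I" "i \<notin> I" "{..<N} = insert i I" using i by (auto simp: I_def)
  have "(\<integral>z. \<Psi> z * residual (z i) \<partial>PiM {..<N} (\<lambda>_. law))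
      = (\<integral>x. (\<integral>y. \<Psi> (x(i := y)) * residual ((x(i := y)) i) \<partial>law) \<partial>PiM I (\<lambda>_. law))"
    using True I unfolding I(3) by (intro laws.product_integral_insert) auto
  also have "\<dots> = (\<integral>x. 0 \<partial>PiM I (\<lambda>_. law))"
  proof (intro Bochner_Integration.integral_cong refl)
    fix x assume x: "x \<in> space (PiM I (\<lambda>_. law))"
    have [measurable]: "(\<lambda>s. \<Psi> (x(i := (0, s)))) \<in> borel_measurable borel"
      using component_upd_meas[OF i, of x] x unfolding I_def by (intro measurable_compose[OF _ assms(1)]) auto
    have "\<Psi> (x(i := y)) = \<Psi> (x(i := (0, snd y)))" for y
      using free[of x "fst y" "snd y"] by simp
    then show "(\<integral>y. \<Psi> (x(i := y)) * residual ((x(i := y)) i) \<partial>law) = 0"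
      using law_residual_mean[of "\<lambda>s. \<Psi> (x(i := (0, s)))"] by (simp add: residual_def)
  qed
  finally show ?thesis by simp
qed (simp add: not_integrable_integral_eq)

text \<open>The same slicing for extended nonnegative integrands. The iterated form is derived for a
  general factor g and then applied to both sides.\<close>

lemma product_residual_variance:
  fixes \<Psi> :: "(nat \<Rightarrow> real \<times> real) \<Rightarrow> ennreal"
  assumes [measurable]: "\<Psi> \<in> borel_measurable (PiM {..<N} (\<lambda>_. law))" and i: "i < N"
    and free: "\<And>z y s. \<Psi> (z(i := (y, s))) = \<Psi> (z(i := (0, s)))"
  shows "(\<integral>\<^sup>+z. \<Psi> z * ennreal ((residual (z i))\<^sup>2) \<partial>PiM {..<N} (\<lambda>_. law))
       = (\<integral>\<^sup>+z. \<Psi> z * ennreal (\<sigma>2 (snd (z i))) \<partial>PiM {..<N} (\<lambda>_. law))"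
proof -
  define I where "I = {..<N} - {i}"
  have I: "finite I" "i \<notin> I" "{..<N} = insert i I" using i by (auto simp: I_def)
  have [measurable]: "(\<lambda>z. z i) \<in> measurable (PiM {..<N} (\<lambda>_. law)) borel"
    using measurable_component_singleton[of i "{..<N}" "\<lambda>_. law"] i by (simp cong: measurable_cong_sets)
  have *: "(\<integral>\<^sup>+z. \<Psi> z * g (z i) \<partial>PiM {..<N} (\<lambda>_. law))
      = (\<integral>\<^sup>+x. (\<integral>\<^sup>+y. \<Psi> (x(i := (0, snd y))) * g y \<partial>law) \<partial>PiM I (\<lambda>_. law))"
    if [measurable]: "g \<in> borel_measurable borel" for g
  proof -
    have "(\<integral>\<^sup>+z. \<Psi> z * g (z i) \<partial>PiM (insert i I) (\<lambda>_. law))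
        = (\<integral>\<^sup>+x. (\<integral>\<^sup>+y. \<Psi> (x(i := y)) * g ((x(i := y)) i) \<partial>law) \<partial>PiM I (\<lambda>_. law))"
      using I by (intro laws.product_nn_integral_insert) (auto simp flip: I(3))
    also have "\<dots> = (\<integral>\<^sup>+x. (\<integral>\<^sup>+y. \<Psi> (x(i := (0, snd y))) * g y \<partial>law) \<partial>PiM I (\<lambda>_. law))"
    proof (intro nn_integral_cong, goal_cases)
      case (1 x y)
      show ?case using free[of x "fst y" "snd y"] by simp
    qed
    finally show ?thesis by (simp add: I(3))
  qed
  have "(\<integral>\<^sup>+x. (\<integral>\<^sup>+y. \<Psi> (x(i := (0, snd y))) * ennreal ((residual y)\<^sup>2) \<partial>law) \<partial>PiM I (\<lambda>_. law))
     = (\<integral>\<^sup>+x. (\<integral>\<^sup>+y. \<Psi> (x(i := (0, snd y))) * ennreal (\<sigma>2 (snd y)) \<partial>law) \<partial>PiM I (\<lambda>_. law))"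
  proof (rule nn_integral_cong)
    fix x assume x: "x \<in> space (PiM I (\<lambda>_. law))"
    have [measurable]: "(\<lambda>s. \<Psi> (x(i := (0, s)))) \<in> borel_measurable borel"
      using component_upd_meas[OF i, of x] x unfolding I_def by (intro measurable_compose[OF _ assms(1)]) auto
    show "(\<integral>\<^sup>+y. \<Psi> (x(i := (0, snd y))) * ennreal ((residual y)\<^sup>2) \<partial>law)
        = (\<integral>\<^sup>+y. \<Psi> (x(i := (0, snd y))) * ennreal (\<sigma>2 (snd y)) \<partial>law)"
      using law_residual_variance[of "\<lambda>s. \<Psi> (x(i := (0, s)))"] by (simp add: residual_def)
  qed
  then show ?thesis
    by (subst (1 2) *) measurable
qed

lemma covs_meas [measurable]: "covs N \<in> measurable (PiM {..<N} (\<lambda>_. law)) (PiM {..<N} (\<lambda>_. borel))"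
proof (intro measurable_restrict)
  fix i assume "i \<in> {..<N}"
  then have "(\<lambda>z. z i) \<in> measurable (PiM {..<N} (\<lambda>_. law)) law" by (rule measurable_component_singleton)
  then show "(\<lambda>z. snd (z i)) \<in> borel_measurable (PiM {..<N} (\<lambda>_. law))"
    by (rule measurable_compose) (simp add: measurable_cong_sets[OF sets_law refl])
qed

lemma \<sigma>2_bounded: "\<exists>C. \<forall>s. \<bar>s\<bar> \<le> B \<longrightarrow> \<bar>\<sigma>2 s\<bar> \<le> C"
proof -
  have "compact (\<sigma>2 ` {-B..B})"
    using \<sigma>2_cont by (intro compact_continuous_image) (auto intro: continuous_on_subset)
  then obtain C where "\<forall>s\<in>{-B..B}. norm (\<sigma>2 s) \<le> C"
    using compact_imp_bounded bounded_iff by (metis (no_types, lifting) imageI)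
  then show ?thesis by (intro exI[of _ C]) (simp add: abs_le_iff)
qed

text \<open>The coefficients vanish unless all covariates lie in [-B, B], where
  \<open>\<sigma>2\<close> is bounded. This makes each weighted residual square integrable, so the
  square may be expanded, and the mixed terms vanish because the residuals are uncorrelated given
  the covariates.\<close>

lemma product_second_moment_bounded:
  fixes \<gamma> :: "nat \<Rightarrow> (nat \<Rightarrow> real) \<Rightarrow> real"
  assumes [measurable]: "\<And>i. i < N \<Longrightarrow> \<gamma> i \<in> borel_measurable (PiM {..<N} (\<lambda>_. borel))"
    and bdd: "\<And>i xs. i < N \<Longrightarrow> \<bar>\<gamma> i xs\<bar> \<le> B"
    and loc: "\<And>i k xs. i < N \<Longrightarrow> k < N \<Longrightarrow> B < \<bar>xs k\<bar> \<Longrightarrow> \<gamma> i xs = 0"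
  shows "(\<integral>\<^sup>+z. ennreal ((\<Sum>i<N. \<gamma> i (covs N z) * residual (z i))\<^sup>2) \<partial>PiM {..<N} (\<lambda>_. law))
       = (\<integral>\<^sup>+z. (\<Sum>i<N. ennreal ((\<gamma> i (covs N z))\<^sup>2) * ennreal (\<sigma>2 (snd (z i)))) \<partial>PiM {..<N} (\<lambda>_. law))"
proof -
  let ?P = "PiM {..<N} (\<lambda>_. law)"
  define \<delta> where "\<delta> i z = \<gamma> i (covs N z) * residual (z i)" for i z
  have comp: "(\<lambda>z. z i) \<in> measurable ?P borel" if "i < N" for i
    using measurable_component_singleton[of i "{..<N}" "\<lambda>_. law"] that by (simp cong: measurable_cong_sets)
  have \<gamma>_meas [measurable]: "(\<lambda>z. \<gamma> i (covs N z)) \<in> borel_measurable ?P" if "i < N" for i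
    using that by measurable
  have r_meas [measurable]: "(\<lambda>z. residual (z i)) \<in> borel_measurable ?P" if "i < N" for i
    using comp[OF that] by measurable
  have \<delta>_meas [measurable]: "\<delta> i \<in> borel_measurable ?P" if "i < N" for i
    using that unfolding \<delta>_def by measurable
  have covs_upd: "covs N (z(i := (y, s))) = covs N (z(i := (0, s)))" for z i y s
    by (auto simp: fun_eq_iff restrict_def)
  have var: "(\<integral>\<^sup>+z. ennreal ((\<delta> i z)\<^sup>2) \<partial>?P) = (\<integral>\<^sup>+z. ennreal ((\<gamma> i (covs N z))\<^sup>2) * ennreal (\<sigma>2 (snd (z i))) \<partial>?P)"
    if i: "i < N" for i
  proof -
    have "ennreal ((\<gamma> i (covs N (z(i := (y, s)))))\<^sup>2) = ennreal ((\<gamma> i (covs N (z(i := (0, s)))))\<^sup>2)" for z y s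
      unfolding covs_upd[of z i y s] ..
    from product_residual_variance[of "\<lambda>z. ennreal ((\<gamma> i (covs N z))\<^sup>2)", OF _ i this] i
    show ?thesis by (simp add: \<delta>_def power_mult_distrib ennreal_mult)
  qed
  obtain C where C: "\<And>s. \<bar>s\<bar> \<le> B \<Longrightarrow> \<bar>\<sigma>2 s\<bar> \<le> C" using \<sigma>2_bounded[of B] by blast
  have P1: "prob_space ?P" by (intro prob_space_PiM prob_space_law)
  have sq: "integrable ?P (\<lambda>z. (\<delta> i z)\<^sup>2)" if i: "i < N" for i
  proof -
    have "(\<integral>\<^sup>+z. ennreal ((\<delta> i z)\<^sup>2) \<partial>?P) \<le> (\<integral>\<^sup>+z. ennreal (B\<^sup>2 * \<bar>C\<bar>) \<partial>?P)"
      unfolding var[OF i]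
    proof (rule nn_integral_mono)
      fix z
      show "ennreal ((\<gamma> i (covs N z))\<^sup>2) * ennreal (\<sigma>2 (snd (z i))) \<le> ennreal (B\<^sup>2 * \<bar>C\<bar>)"
      \<comment> \<open>Either the coefficient vanishes or the covariate lies in the compact
        interval on which \<open>\<sigma>2\<close> is bounded by C.\<close>
      proof (cases "B < \<bar>snd (z i)\<bar>")
        case True
        then show ?thesis using loc[OF i i, of "covs N z"] i by simp
      next
        case False
        then have "ennreal (\<sigma>2 (snd (z i))) \<le> ennreal \<bar>C\<bar>" using C[of "snd (z i)"] by (intro ennreal_leI) auto
        moreover have "(\<gamma> i (covs N z))\<^sup>2 \<le> B\<^sup>2" using bdd[OF i, of "covs N z"] by (metis abs_ge_zero power2_abs power_mono)
        ultimately show ?thesis by (auto simp: ennreal_mult intro!: mult_mono ennreal_leI)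
      qed
    qed
    also have "\<dots> < \<infinity>" using prob_space.emeasure_space_1[OF P1] by simp
    finally show ?thesis using i by (intro integrableI_bounded) auto
  qed
  have prod: "integrable ?P (\<lambda>z. \<delta> i z * \<delta> k z)" if "i < N" "k < N" for i k
  proof (rule Bochner_Integration.integrable_bound[OF Bochner_Integration.integrable_add[OF sq[OF that(1)] sq[OF that(2)]]])
    have "\<bar>a * b\<bar> \<le> a\<^sup>2 + b\<^sup>2" for a b :: real
    proof -
      have "2 * \<bar>a * b\<bar> \<le> a\<^sup>2 + b\<^sup>2"
        using sum_squares_bound[of "\<bar>a\<bar>" "\<bar>b\<bar>"] by (simp add: abs_mult)
      then show ?thesis by linarith
    qed
    then show "AE z in ?P. norm (\<delta> i z * \<delta> k z) \<le> norm ((\<delta> i z)\<^sup>2 + (\<delta> k z)\<^sup>2)" by simp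
  qed (use that in measurable)
  have cross: "(\<integral>z. \<delta> i z * \<delta> k z \<partial>?P) = 0" if ik: "i < N" "k < N" "i \<noteq> k" for i k
  proof -
    have "(\<integral>z. (\<gamma> i (covs N z) * \<gamma> k (covs N z) * residual (z k)) * residual (z i) \<partial>?P) = 0"
    \<comment> \<open>Coefficients depend on covariates only and \<open>residual (z k)\<close>
      belongs to another individual, so the factor in front of \<open>residual (z i)\<close> does
      not see response i.\<close>
    proof (rule product_residual_mean)
      fix z y s
      show "\<gamma> i (covs N (z(i := (y, s)))) * \<gamma> k (covs N (z(i := (y, s)))) * residual ((z(i := (y, s))) k)
          = \<gamma> i (covs N (z(i := (0, s)))) * \<gamma> k (covs N (z(i := (0, s)))) * residual ((z(i := (0, s))) k)"
        unfolding covs_upd[of z i y s] using ik(3) by (simp only: fun_upd_other not_False_eq_True)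
    qed (use ik in auto)
    then show ?thesis by (simp add: \<delta>_def mult_ac)
  qed
  have expand: "(\<Sum>i<N. \<delta> i z)\<^sup>2 = (\<Sum>i<N. \<Sum>k<N. \<delta> i z * \<delta> k z)" for z
    by (simp add: power2_eq_square sum_product)
  have "(\<integral>\<^sup>+z. ennreal ((\<Sum>i<N. \<delta> i z)\<^sup>2) \<partial>?P) = ennreal (\<integral>z. (\<Sum>i<N. \<delta> i z)\<^sup>2 \<partial>?P)"
  proof (rule nn_integral_eq_integral)
    show "integrable ?P (\<lambda>z. (\<Sum>i<N. \<delta> i z)\<^sup>2)"
      unfolding expand using prod by (intro Bochner_Integration.integrable_sum) auto
  qed simp
  also have "(\<integral>z. (\<Sum>i<N. \<delta> i z)\<^sup>2 \<partial>?P) = (\<Sum>i<N. \<Sum>k<N. (\<integral>z. \<delta> i z * \<delta> k z \<partial>?P))"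
    unfolding expand using prod
    by (subst Bochner_Integration.integral_sum; (intro Bochner_Integration.integrable_sum sum.cong refl)?; simp)
  also have "\<dots> = (\<Sum>i<N. \<Sum>k<N. if k = i then (\<integral>z. (\<delta> i z)\<^sup>2 \<partial>?P) else 0)"
    using cross by (intro sum.cong refl) (auto simp: power2_eq_square)
  also have "\<dots> = (\<Sum>i<N. (\<integral>z. (\<delta> i z)\<^sup>2 \<partial>?P))" by simp
  also have "ennreal \<dots> = (\<Sum>i<N. (\<integral>\<^sup>+z. ennreal ((\<delta> i z)\<^sup>2) \<partial>?P))"
  proof -
    have "ennreal (\<Sum>i<N. (\<integral>z. (\<delta> i z)\<^sup>2 \<partial>?P)) = (\<Sum>i<N. ennreal (\<integral>z. (\<delta> i z)\<^sup>2 \<partial>?P))"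
      by (rule sum_ennreal[symmetric]) simp
    also have "\<dots> = (\<Sum>i<N. (\<integral>\<^sup>+z. ennreal ((\<delta> i z)\<^sup>2) \<partial>?P))"
      using nn_integral_eq_integral[OF sq] by (intro sum.cong) auto
    finally show ?thesis .
  qed
  also have "\<dots> = (\<Sum>i<N. (\<integral>\<^sup>+z. ennreal ((\<gamma> i (covs N z))\<^sup>2) * ennreal (\<sigma>2 (snd (z i))) \<partial>?P))"
    using var by simp
  also have "\<dots> = (\<integral>\<^sup>+z. (\<Sum>i<N. ennreal ((\<gamma> i (covs N z))\<^sup>2) * ennreal (\<sigma>2 (snd (z i)))) \<partial>?P)"
  proof (intro nn_integral_sum[symmetric])
    fix i assume "i \<in> {..<N}"
    then have [measurable]: "(\<lambda>z. z i) \<in> measurable ?P borel" "(\<lambda>z. \<gamma> i (covs N z)) \<in> borel_measurable ?P"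
      using comp \<gamma>_meas by auto
    show "(\<lambda>z. ennreal ((\<gamma> i (covs N z))\<^sup>2) * ennreal (\<sigma>2 (snd (z i)))) \<in> borel_measurable ?P"
      by measurable
  qed
  finally show ?thesis by (simp add: \<delta>_def)
qed

text \<open>Truncation at level n: all coefficients and all covariates are at most n in modulus.
  This event is a condition on the covariates, so its indicator can be moved into the coefficients
  without disturbing the structure, and the events exhaust the space as n grows.\<close>

lemma product_second_moment:
  fixes \<gamma> :: "nat \<Rightarrow> (nat \<Rightarrow> real) \<Rightarrow> real"
  assumes \<gamma> [measurable]: "\<And>i. i < N \<Longrightarrow> \<gamma> i \<in> borel_measurable (PiM {..<N} (\<lambda>_. borel))"
  shows "(\<integral>\<^sup>+z. ennreal ((\<Sum>i<N. \<gamma> i (covs N z) * residual (z i))\<^sup>2) \<partial>PiM {..<N} (\<lambda>_. law))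
       = (\<integral>\<^sup>+z. (\<Sum>i<N. ennreal ((\<gamma> i (covs N z))\<^sup>2) * ennreal (\<sigma>2 (snd (z i)))) \<partial>PiM {..<N} (\<lambda>_. law))"
proof -
  let ?P = "PiM {..<N} (\<lambda>_. law)"
  define Q where "Q n xs \<longleftrightarrow> (\<forall>i<N. \<bar>\<gamma> i xs\<bar> \<le> real n \<and> \<bar>xs i\<bar> \<le> real n)" for n xs
  have comp: "(\<lambda>z. z i) \<in> measurable ?P borel" if "i < N" for i
    using measurable_component_singleton[of i "{..<N}" "\<lambda>_. law"] that by (simp cong: measurable_cong_sets)
  have \<gamma>_meas: "(\<lambda>z. \<gamma> i (covs N z)) \<in> borel_measurable ?P" if "i < N" for i
    using that by measurable
  have Q_set: "{xs \<in> space (PiM {..<N} (\<lambda>_. borel)). Q n xs} \<in> sets (PiM {..<N} (\<lambda>_. borel))" for n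
  proof -
    have "{xs \<in> space (PiM {..<N} (\<lambda>_. borel)). \<bar>\<gamma> i xs\<bar> \<le> real n \<and> \<bar>xs i\<bar> \<le> real n}
        \<in> sets (PiM {..<N} (\<lambda>_. borel))" if "i \<in> {..<N}" for i
    proof -
      have [measurable]: "\<gamma> i \<in> borel_measurable (PiM {..<N} (\<lambda>_. borel))"
          "(\<lambda>xs. xs i) \<in> borel_measurable (PiM {..<N} (\<lambda>_. borel))"
        using that \<gamma> by (auto intro: measurable_component_singleton)
      show ?thesis by measurable
    qed
    then have "{xs \<in> space (PiM {..<N} (\<lambda>_. borel)). \<forall>i\<in>{..<N}. \<bar>\<gamma> i xs\<bar> \<le> real n \<and> \<bar>xs i\<bar> \<le> real n}
        \<in> sets (PiM {..<N} (\<lambda>_. borel))"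
      by (intro sets.sets_Collect_finite_All) auto
    then show ?thesis by (simp add: Q_def Ball_def)
  qed
  define A where "A n = {z \<in> space ?P. Q n (covs N z)}" for n
  have A_sets: "A n \<in> sets ?P" for n
    using measurable_sets[OF covs_meas Q_set[of n]]
    by (rule back_subst) (auto simp: A_def space_PiM PiE_def)
  show ?thesis
  proof (rule nn_integral_eq_on_incseq[where A=A])
    show "(\<lambda>z. ennreal ((\<Sum>i<N. \<gamma> i (covs N z) * residual (z i))\<^sup>2)) \<in> borel_measurable ?P"
      using comp \<gamma>_meas
      by (intro measurable_compose[OF _ measurable_ennreal] borel_measurable_power borel_measurable_sum
          borel_measurable_times measurable_compose[OF comp residual_meas]) auto
    show "(\<lambda>z. (\<Sum>i<N. ennreal ((\<gamma> i (covs N z))\<^sup>2) * ennreal (\<sigma>2 (snd (z i))))) \<in> borel_measurable ?P"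
      using comp \<gamma>_meas
      by (intro borel_measurable_sum borel_measurable_times measurable_compose[OF _ measurable_ennreal]
          borel_measurable_power measurable_compose[OF measurable_compose[OF comp snd_borel] \<sigma>2_meas]) auto
    show "incseq A"
      by (intro monoI) (force simp: A_def Q_def)
    show "(\<Union>n. A n) = space ?P"
    proof (intro equalityI subsetI)
      fix z assume z: "z \<in> space ?P"
      obtain n where n: "(\<Sum>i<N. \<bar>\<gamma> i (covs N z)\<bar> + \<bar>covs N z i\<bar>) \<le> real n"
        using real_arch_simple by blast
      have "\<bar>\<gamma> i (covs N z)\<bar> + \<bar>covs N z i\<bar> \<le> real n" if "i < N" for i
        using that by (intro order_trans[OF member_le_sum n]) auto
      then have "Q n (covs N z)" unfolding Q_def by (smt (verit))
      then show "z \<in> (\<Union>n. A n)" using z by (auto simp: A_def)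
    qed (auto simp: A_def)
    fix n
    define \<gamma>' where "\<gamma>' i xs = (if Q n xs then \<gamma> i xs else 0)" for i xs
    have "(\<integral>\<^sup>+z. ennreal ((\<Sum>i<N. \<gamma>' i (covs N z) * residual (z i))\<^sup>2) \<partial>?P)
       = (\<integral>\<^sup>+z. (\<Sum>i<N. ennreal ((\<gamma>' i (covs N z))\<^sup>2) * ennreal (\<sigma>2 (snd (z i)))) \<partial>?P)"
    proof (rule product_second_moment_bounded)
      show "\<gamma>' i \<in> borel_measurable (PiM {..<N} (\<lambda>_. borel))" if "i < N" for i
        unfolding \<gamma>'_def using \<gamma>[OF that] Q_set by (intro measurable_If) auto
      show "\<bar>\<gamma>' i xs\<bar> \<le> real n" if "i < N" for i xs
        using that by (auto simp: \<gamma>'_def Q_def)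
      show "\<gamma>' i xs = 0" if "i < N" "k < N" "real n < \<bar>xs k\<bar>" for i k xs
        using that by (auto simp: \<gamma>'_def Q_def)
    qed
    moreover have "(\<integral>\<^sup>+z. ennreal ((\<Sum>i<N. \<gamma>' i (covs N z) * residual (z i))\<^sup>2) \<partial>?P)
       = (\<integral>\<^sup>+z. ennreal ((\<Sum>i<N. \<gamma> i (covs N z) * residual (z i))\<^sup>2) * indicator (A n) z \<partial>?P)"
    proof (rule nn_integral_cong)
      fix z assume "z \<in> space ?P"
      then show "ennreal ((\<Sum>i<N. \<gamma>' i (covs N z) * residual (z i))\<^sup>2)
          = ennreal ((\<Sum>i<N. \<gamma> i (covs N z) * residual (z i))\<^sup>2) * indicator (A n) z"
        by (cases "Q n (covs N z)") (simp_all add: \<gamma>'_def A_def)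
    qed
    moreover have "(\<integral>\<^sup>+z. (\<Sum>i<N. ennreal ((\<gamma>' i (covs N z))\<^sup>2) * ennreal (\<sigma>2 (snd (z i)))) \<partial>?P)
       = (\<integral>\<^sup>+z. (\<Sum>i<N. ennreal ((\<gamma> i (covs N z))\<^sup>2) * ennreal (\<sigma>2 (snd (z i)))) * indicator (A n) z \<partial>?P)"
    proof (rule nn_integral_cong)
      fix z assume "z \<in> space ?P"
      then show "(\<Sum>i<N. ennreal ((\<gamma>' i (covs N z))\<^sup>2) * ennreal (\<sigma>2 (snd (z i))))
          = (\<Sum>i<N. ennreal ((\<gamma> i (covs N z))\<^sup>2) * ennreal (\<sigma>2 (snd (z i)))) * indicator (A n) z"
        by (cases "Q n (covs N z)") (simp_all add: \<gamma>'_def A_def)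
    qed
    ultimately show "(\<integral>\<^sup>+z. ennreal ((\<Sum>i<N. \<gamma> i (covs N z) * residual (z i))\<^sup>2) * indicator (A n) z \<partial>?P)
        = (\<integral>\<^sup>+z. (\<Sum>i<N. ennreal ((\<gamma> i (covs N z))\<^sup>2) * ennreal (\<sigma>2 (snd (z i)))) * indicator (A n) z \<partial>?P)"
      by simp
  qed (rule A_sets)
qed

section \<open>Transfer of the moment identities to the sample\<close>

definition covariates :: "nat \<Rightarrow> 'a \<Rightarrow> nat \<Rightarrow> real" where
  "covariates N \<omega> = (\<lambda>i\<in>{..<N}. X i \<omega>)"

definition pairs :: "nat \<Rightarrow> 'a \<Rightarrow> nat \<Rightarrow> real \<times> real" where
  "pairs N \<omega> = (\<lambda>i\<in>{..<N}. (Y i \<omega>, X i \<omega>))"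

lemma covs_pairs: "covs N (pairs N \<omega>) = covariates N \<omega>"
  by (auto simp: fun_eq_iff pairs_def covariates_def)

lemma pairs_meas [measurable]: "pairs N \<in> measurable M (PiM {..<N} (\<lambda>_. law))"
  unfolding pairs_def by (intro measurable_restrict) (simp add: measurable_cong_sets[OF refl sets_law])

lemma covariates_meas [measurable]: "covariates N \<in> measurable M (PiM {..<N} (\<lambda>_. borel))"
  unfolding covariates_def by (intro measurable_restrict) simp

text \<open>Independence and identical distribution in product form. The product sigma-algebras over
  \<open>law\<close> and over \<open>borel\<close> agree because those of the components do; N \<ge>
  1 gives the nonempty index set that the characterization of independence asks for.\<close>

lemma distr_pairs:
  assumes "1 \<le> N"
  shows "distr M (PiM {..<N} (\<lambda>_. law)) (pairs N) = PiM {..<N} (\<lambda>_. law)"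
proof -
  have law_i: "distr M borel (\<lambda>\<omega>. (Y i \<omega>, X i \<omega>)) = law" for i
    unfolding law_def by (rule ident)
  have "indep_vars (\<lambda>_. borel) (\<lambda>i \<omega>. (Y i \<omega>, X i \<omega>)) {..<N}"
    using indep by (rule indep_vars_subset) simp
  moreover have "{..<N} \<noteq> {}" using assms by (auto simp: lessThan_empty_iff)
  ultimately have "distr M (PiM {..<N} (\<lambda>_. borel)) (pairs N) = PiM {..<N} (\<lambda>i. distr M borel (\<lambda>\<omega>. (Y i \<omega>, X i \<omega>)))"
    unfolding pairs_def by (subst (asm) indep_vars_iff_distr_eq_PiM) auto
  also have "\<dots> = PiM {..<N} (\<lambda>_. law)" by (simp only: law_i)
  finally have 1: "distr M (PiM {..<N} (\<lambda>_. borel)) (pairs N) = PiM {..<N} (\<lambda>_. law)" .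
  have "distr M (PiM {..<N} (\<lambda>_. law)) (pairs N) = distr M (PiM {..<N} (\<lambda>_. borel)) (pairs N)"
    by (intro distr_cong refl sets_PiM_cong) simp
  with 1 show ?thesis by simp
qed

lemma second_moment:
  fixes \<gamma> :: "nat \<Rightarrow> (nat \<Rightarrow> real) \<Rightarrow> real"
  assumes N: "1 \<le> N" and \<gamma>: "\<And>i. i < N \<Longrightarrow> \<gamma> i \<in> borel_measurable (PiM {..<N} (\<lambda>_. borel))"
  shows "(\<integral>\<^sup>+\<omega>. ennreal ((\<Sum>i<N. \<gamma> i (covariates N \<omega>) * (Y i \<omega> - m (X i \<omega>)))\<^sup>2) \<partial>M)
       = (\<integral>\<^sup>+\<omega>. (\<Sum>i<N. ennreal ((\<gamma> i (covariates N \<omega>))\<^sup>2) * ennreal (\<sigma>2 (X i \<omega>))) \<partial>M)"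
proof -
  let ?P = "PiM {..<N} (\<lambda>_. law)"
  have comp: "(\<lambda>z. z i) \<in> measurable ?P borel" if "i < N" for i
    using measurable_component_singleton[of i "{..<N}" "\<lambda>_. law"] that by (simp cong: measurable_cong_sets)
  have \<gamma>_meas: "(\<lambda>z. \<gamma> i (covs N z)) \<in> borel_measurable ?P" if "i < N" for i
    using \<gamma>[OF that] by measurable
  have 1: "(\<integral>\<^sup>+z. g z \<partial>?P) = (\<integral>\<^sup>+\<omega>. g (pairs N \<omega>) \<partial>M)" if "g \<in> borel_measurable ?P" for g
    by (subst distr_pairs[OF N, symmetric]) (intro nn_integral_distr pairs_meas, use that in simp)
  have "(\<integral>\<^sup>+z. ennreal ((\<Sum>i<N. \<gamma> i (covs N z) * residual (z i))\<^sup>2) \<partial>?P)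
      = (\<integral>\<^sup>+\<omega>. ennreal ((\<Sum>i<N. \<gamma> i (covariates N \<omega>) * (Y i \<omega> - m (X i \<omega>)))\<^sup>2) \<partial>M)"
  proof (subst 1)
    show "(\<lambda>z. ennreal ((\<Sum>i<N. \<gamma> i (covs N z) * residual (z i))\<^sup>2)) \<in> borel_measurable ?P"
      using comp \<gamma>_meas
      by (intro measurable_compose[OF _ measurable_ennreal] borel_measurable_power borel_measurable_sum
          borel_measurable_times measurable_compose[OF comp residual_meas]) auto
    show "(\<integral>\<^sup>+\<omega>. ennreal ((\<Sum>i<N. \<gamma> i (covs N (pairs N \<omega>)) * residual (pairs N \<omega> i))\<^sup>2) \<partial>M)
        = (\<integral>\<^sup>+\<omega>. ennreal ((\<Sum>i<N. \<gamma> i (covariates N \<omega>) * (Y i \<omega> - m (X i \<omega>)))\<^sup>2) \<partial>M)"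
      unfolding covs_pairs by (simp add: pairs_def residual_def)
  qed
  moreover have "(\<integral>\<^sup>+z. (\<Sum>i<N. ennreal ((\<gamma> i (covs N z))\<^sup>2) * ennreal (\<sigma>2 (snd (z i)))) \<partial>?P)
      = (\<integral>\<^sup>+\<omega>. (\<Sum>i<N. ennreal ((\<gamma> i (covariates N \<omega>))\<^sup>2) * ennreal (\<sigma>2 (X i \<omega>))) \<partial>M)"
  proof (subst 1)
    show "(\<lambda>z. (\<Sum>i<N. ennreal ((\<gamma> i (covs N z))\<^sup>2) * ennreal (\<sigma>2 (snd (z i))))) \<in> borel_measurable ?P"
      using comp \<gamma>_meas
      by (intro borel_measurable_sum borel_measurable_times measurable_compose[OF _ measurable_ennreal]
          borel_measurable_power measurable_compose[OF measurable_compose[OF comp snd_borel] \<sigma>2_meas]) auto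
    show "(\<integral>\<^sup>+\<omega>. (\<Sum>i<N. ennreal ((\<gamma> i (covs N (pairs N \<omega>)))\<^sup>2) * ennreal (\<sigma>2 (snd (pairs N \<omega> i)))) \<partial>M)
        = (\<integral>\<^sup>+\<omega>. (\<Sum>i<N. ennreal ((\<gamma> i (covariates N \<omega>))\<^sup>2) * ennreal (\<sigma>2 (X i \<omega>))) \<partial>M)"
      unfolding covs_pairs by (simp add: pairs_def)
  qed
  ultimately show ?thesis using product_second_moment[OF \<gamma>] by simp
qed

lemma mean_residual:
  assumes N: "1 \<le> N" and i: "i < N" and \<gamma>: "\<gamma> \<in> borel_measurable (PiM {..<N} (\<lambda>_. borel))"
  shows "(\<integral>\<omega>. \<gamma> (covariates N \<omega>) * (Y i \<omega> - m (X i \<omega>)) \<partial>M) = 0"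
proof -
  let ?P = "PiM {..<N} (\<lambda>_. law)"
  have comp: "(\<lambda>z. z i) \<in> measurable ?P borel"
    using measurable_component_singleton[of i "{..<N}" "\<lambda>_. law"] i by (simp cong: measurable_cong_sets)
  have \<gamma>_meas: "(\<lambda>z. \<gamma> (covs N z)) \<in> borel_measurable ?P"
    using \<gamma> by measurable
  have meas: "(\<lambda>z. \<gamma> (covs N z) * residual (z i)) \<in> borel_measurable ?P"
    by (intro borel_measurable_times \<gamma>_meas measurable_compose[OF comp residual_meas])
  have "(\<integral>\<omega>. \<gamma> (covariates N \<omega>) * (Y i \<omega> - m (X i \<omega>)) \<partial>M)
      = (\<integral>\<omega>. \<gamma> (covs N (pairs N \<omega>)) * residual (pairs N \<omega> i) \<partial>M)"
    unfolding covs_pairs using i by (simp add: pairs_def residual_def)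
  also have "\<dots> = (\<integral>z. \<gamma> (covs N z) * residual (z i) \<partial>distr M ?P (pairs N))"
    by (rule integral_distr[symmetric]) (use meas in auto)
  also have "\<dots> = 0"
    unfolding distr_pairs[OF N]
  proof (rule product_residual_mean[OF \<gamma>_meas i])
    fix z y s
    have "covs N (z(i := (y, s))) = covs N (z(i := (0, s)))"
      by (auto simp: fun_eq_iff restrict_def)
    then show "\<gamma> (covs N (z(i := (y, s)))) = \<gamma> (covs N (z(i := (0, s))))" by metis
  qed
  finally show ?thesis .
qed

section \<open>Conditional moments given all covariates\<close>

lemma cov_sigma_eq: "cov_sigma M X N = vimage_algebra (space M) (covariates N) (PiM {..<N} (\<lambda>_. borel))"
  by (simp add: cov_sigma_def covariates_def[abs_def])

lemma covariates_range: "covariates N \<in> space M \<rightarrow> space (PiM {..<N} (\<lambda>_. borel :: real measure))"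
  by (auto simp: covariates_def space_PiM)

lemma covariates_cov_sigma: "covariates N \<in> measurable (cov_sigma M X N) (PiM {..<N} (\<lambda>_. borel))"
  unfolding cov_sigma_eq by (intro measurable_vimage_algebra1 covariates_range)

lemma X_cov_sigma:
  assumes "i < N"
  shows "X i \<in> borel_measurable (cov_sigma M X N)"
proof -
  have "(\<lambda>xs. xs i) \<in> borel_measurable (PiM {..<N} (\<lambda>_. borel :: real measure))"
    using assms by (intro measurable_component_singleton) simp
  from measurable_compose[OF covariates_cov_sigma this] show ?thesis
    using assms by (simp add: covariates_def)
qed

lemma cov_sigma_sets:
  assumes "A \<in> sets (cov_sigma M X N)"
  obtains A' where "A' \<in> sets (PiM {..<N} (\<lambda>_. borel))" "A = covariates N -` A' \<inter> space M"
  using assms unfolding cov_sigma_eq sets_vimage_algebra2[OF covariates_range] by auto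

lemma cov_sigma_subalgebra: "subalgebra M (cov_sigma M X N)"
  unfolding subalgebra_def
proof (intro conjI subsetI)
  show "space (cov_sigma M X N) = space M" by (simp add: cov_sigma_eq)
  fix A assume "A \<in> sets (cov_sigma M X N)"
  then show "A \<in> sets M" by (elim cov_sigma_sets) (simp add: measurable_sets[OF covariates_meas])
qed

lemma sigma_finite_cov_sigma: "sigma_finite_subalgebra M (cov_sigma M X N)"
  using cov_sigma_subalgebra
  by (intro finite_measure_subalgebra_is_sigma_finite finite_measure_subalgebra.intro
      finite_measure_subalgebra_axioms.intro) (unfold_locales, auto)

lemma law_i: "distr M borel (\<lambda>\<omega>. (Y i \<omega>, X i \<omega>)) = law"
  unfolding law_def by (rule ident)

lemma Y_integrable: "integrable M (Y i)"
proof -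
  have "integrable (distr M borel (\<lambda>\<omega>. (Y 0 \<omega>, X 0 \<omega>))) fst"
    by (subst integrable_distr_eq) (use Y_integrable0 in auto)
  then have "integrable (distr M borel (\<lambda>\<omega>. (Y i \<omega>, X i \<omega>))) fst" by (simp only: law_i)
  then show ?thesis by (subst (asm) integrable_distr_eq) auto
qed

lemma mX_integrable: "integrable M (\<lambda>\<omega>. m (X i \<omega>))"
proof -
  have "integrable (distr M borel (\<lambda>\<omega>. (Y 0 \<omega>, X 0 \<omega>))) (\<lambda>z. m (snd z))"
    by (subst integrable_distr_eq) (use mX0_integrable in auto)
  then have "integrable (distr M borel (\<lambda>\<omega>. (Y i \<omega>, X i \<omega>))) (\<lambda>z. m (snd z))" by (simp only: law_i)
  then show ?thesis by (subst (asm) integrable_distr_eq) auto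
qed

lemma distr_X: "distr M borel (X i) = distr M borel (X 0)"
proof -
  have "distr M borel (X i) = distr law borel snd" for i
    unfolding law_i[of i, symmetric] by (subst distr_distr) (auto simp: comp_def)
  then show ?thesis by simp
qed

lemma \<sigma>2_nonneg_AE: "AE \<omega> in M. 0 \<le> \<sigma>2 (X i \<omega>)"
proof -
  have "AE \<omega> in M. 0 \<le> \<sigma>2 (X 0 \<omega>)" using cond_var by (auto simp: has_cond_var_def)
  then have "AE s in distr M borel (X 0). 0 \<le> \<sigma>2 s" by (subst AE_distr_iff) auto
  then have "AE s in distr M borel (X i). 0 \<le> \<sigma>2 s" by (subst distr_X)
  then show ?thesis by (subst (asm) AE_distr_iff) auto
qed

text \<open>The indicator of a covariate event is an admissible coefficient in
  \<open>mean_residual\<close>; equality of the integrals over all such events characterizes the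
  conditional expectation.\<close>

lemma cond_exp_Y:
  assumes N: "1 \<le> N" and i: "i < N"
  shows "AE \<omega> in M. real_cond_exp M (cov_sigma M X N) (Y i) \<omega> = m (X i \<omega>)"
proof -
  interpret sigma_finite_subalgebra M "cov_sigma M X N" by (rule sigma_finite_cov_sigma)
  show ?thesis
  proof (rule real_cond_exp_charact)
    fix A assume "A \<in> sets (cov_sigma M X N)"
    then obtain A' where A': "A' \<in> sets (PiM {..<N} (\<lambda>_. borel))" "A = covariates N -` A' \<inter> space M"
      by (rule cov_sigma_sets)
    have A: "A \<in> sets M" using A' measurable_sets[OF covariates_meas] by auto
    have "(\<integral>\<omega>. indicator A' (covariates N \<omega>) * (Y i \<omega> - m (X i \<omega>)) \<partial>M) = 0"
      using A'(1) by (intro mean_residual[OF N i]) simp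
    also have "(\<integral>\<omega>. indicator A' (covariates N \<omega>) * (Y i \<omega> - m (X i \<omega>)) \<partial>M)
        = (\<integral>\<omega>. indicator A \<omega> *\<^sub>R Y i \<omega> - indicator A \<omega> *\<^sub>R m (X i \<omega>) \<partial>M)"
      by (intro Bochner_Integration.integral_cong refl) (auto simp: A'(2) indicator_def)
    also have "\<dots> = (\<integral>\<omega>. indicator A \<omega> *\<^sub>R Y i \<omega> \<partial>M) - (\<integral>\<omega>. indicator A \<omega> *\<^sub>R m (X i \<omega>) \<partial>M)"
      by (intro Bochner_Integration.integral_diff integrable_mult_indicator A Y_integrable mX_integrable)
    finally show "(\<integral>\<omega>\<in>A. Y i \<omega> \<partial>M) = (\<integral>\<omega>\<in>A. m (X i \<omega>) \<partial>M)"
      by (simp add: set_lebesgue_integral_def)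
  qed (use Y_integrable mX_integrable X_cov_sigma[OF i] in auto)
qed

text \<open>The linear combination need not be integrable, since the weights of the estimator are unbounded
  near singular Gram matrices; its conditional expectation is identified on the \<open>F\<close>-measurable events
  on which the coefficients are bounded.\<close>

lemma cond_exp_linear:
  fixes g :: "nat \<Rightarrow> 'a \<Rightarrow> real"
  assumes N: "1 \<le> N" and g: "\<And>i. i < N \<Longrightarrow> g i \<in> borel_measurable (cov_sigma M X N)"
  shows "AE \<omega> in M. real_cond_exp M (cov_sigma M X N) (\<lambda>\<omega>. \<Sum>i<N. g i \<omega> * Y i \<omega>) \<omega> = (\<Sum>i<N. g i \<omega> * m (X i \<omega>))"
proof -
  let ?F = "cov_sigma M X N"
  interpret sigma_finite_subalgebra M ?F by (rule sigma_finite_cov_sigma)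
  have spF: "space ?F = space M" using subalg by (simp add: subalgebra_def)
  define T where "T \<omega> = (\<Sum>i<N. g i \<omega> * Y i \<omega>)" for \<omega>
  have gM: "g i \<in> borel_measurable M" if "i < N" for i
    using measurable_from_subalg[OF subalg g[OF that]] .
  have T_meas [measurable]: "T \<in> borel_measurable M"
    unfolding T_def using gM by (intro borel_measurable_sum borel_measurable_times) auto
  \<comment> \<open>Covariate events on which the coefficients are bounded by n; there the linear
    combination is dominated by multiples of the integrable responses.\<close>
  define B where "B n = {\<omega> \<in> space ?F. \<forall>i\<in>{..<N}. \<bar>g i \<omega>\<bar> \<le> real n}" for n
  have B_sets [measurable]: "B n \<in> sets ?F" for n
    unfolding B_def
  proof (intro sets.sets_Collect_finite_All)
    fix i assume "i \<in> {..<N}"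
    then have [measurable]: "g i \<in> borel_measurable ?F" using g by simp
    show "{\<omega> \<in> space ?F. \<bar>g i \<omega>\<bar> \<le> real n} \<in> sets ?F" by measurable
  qed simp
  define b :: "nat \<Rightarrow> 'a \<Rightarrow> real" where "b n = indicator (B n)" for n
  have b_F [measurable]: "b n \<in> borel_measurable ?F" for n
    unfolding b_def by measurable
  have b_M [measurable]: "b n \<in> borel_measurable M" for n
    using measurable_from_subalg[OF subalg b_F] .
  have b0: "0 \<le> b n \<omega>" for n \<omega> by (simp add: b_def)
  define G where "G n i \<omega> = (if i < N then b n \<omega> * g i \<omega> else 0)" for n i \<omega>
  have G_F: "G n i \<in> borel_measurable ?F" for n i
    unfolding G_def using g[of i] by (cases "i < N") auto
  have G_bd: "\<bar>G n i \<omega>\<bar> \<le> real n" for n i \<omega>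
    by (auto simp: G_def b_def B_def indicator_def)
  have G_int: "integrable M (\<lambda>\<omega>. G n i \<omega> * Y i \<omega>)" for n i
  proof (rule Bochner_Integration.integrable_bound)
    show "integrable M (\<lambda>\<omega>. real n * Y i \<omega>)" using Y_integrable by simp
    show "(\<lambda>\<omega>. G n i \<omega> * Y i \<omega>) \<in> borel_measurable M"
      using measurable_from_subalg[OF subalg G_F[of n i]] by measurable
    show "AE \<omega> in M. norm (G n i \<omega> * Y i \<omega>) \<le> norm (real n * Y i \<omega>)"
      using G_bd by (auto simp: abs_mult intro!: mult_right_mono)
  qed
  have bT: "(\<lambda>\<omega>. b n \<omega> * T \<omega>) = (\<lambda>\<omega>. \<Sum>i<N. G n i \<omega> * Y i \<omega>)" for n
    by (auto simp: T_def G_def sum_distrib_left mult.assoc fun_eq_iff)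
  have a: "AE \<omega> in M. real_cond_exp M ?F (\<lambda>\<omega>. b n \<omega> * T \<omega>) \<omega> = (\<Sum>i<N. G n i \<omega> * m (X i \<omega>))" for n
  proof -
    have "AE \<omega> in M. real_cond_exp M ?F (\<lambda>\<omega>. \<Sum>i<N. G n i \<omega> * Y i \<omega>) \<omega>
        = (\<Sum>i<N. real_cond_exp M ?F (\<lambda>\<omega>. G n i \<omega> * Y i \<omega>) \<omega>)"
      by (rule real_cond_exp_sum) (rule G_int)
    moreover have "AE \<omega> in M. \<forall>i\<in>{..<N}. real_cond_exp M ?F (\<lambda>\<omega>. G n i \<omega> * Y i \<omega>) \<omega> = G n i \<omega> * m (X i \<omega>)"
    proof (rule AE_finite_allI)
      fix i assume "i \<in> {..<N}"
      then have "AE \<omega> in M. real_cond_exp M ?F (Y i) \<omega> = m (X i \<omega>)" using cond_exp_Y[OF N] by simp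
      moreover have "AE \<omega> in M. real_cond_exp M ?F (\<lambda>\<omega>. G n i \<omega> * Y i \<omega>) \<omega> = G n i \<omega> * real_cond_exp M ?F (Y i) \<omega>"
        by (rule real_cond_exp_mult[OF G_F _ G_int]) simp
      ultimately show "AE \<omega> in M. real_cond_exp M ?F (\<lambda>\<omega>. G n i \<omega> * Y i \<omega>) \<omega> = G n i \<omega> * m (X i \<omega>)"
        by eventually_elim simp
    qed simp
    ultimately show ?thesis unfolding bT by eventually_elim simp
  qed
  \<comment> \<open>\<open>real_cond_exp\<close> is the difference of the extended conditional
    expectations of the positive and the negative part. A nonnegative measurable factor can be
    pulled out of each of these separately, whether or not \<open>T\<close> is integrable.\<close>
  have part: "AE \<omega> in M. ennreal (b n \<omega>) * nn_cond_exp M ?F (\<lambda>\<omega>. ennreal (h \<omega>)) \<omega> = nn_cond_exp M ?F (\<lambda>\<omega>. ennreal (b n \<omega> * h \<omega>)) \<omega>"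
    if [measurable]: "h \<in> borel_measurable M" for h n
    using nn_cond_exp_prod[of "\<lambda>\<omega>. ennreal (b n \<omega>)" "\<lambda>\<omega>. ennreal (h \<omega>)"] b0 by (simp add: ennreal_mult')
  have b': "AE \<omega> in M. \<omega> \<in> B n \<longrightarrow> real_cond_exp M ?F (\<lambda>\<omega>. b n \<omega> * T \<omega>) \<omega> = real_cond_exp M ?F T \<omega>" for n
    using part[OF T_meas, of n] part[of "\<lambda>\<omega>. - T \<omega>" n, OF borel_measurable_uminus[OF T_meas]]
    by eventually_elim (auto simp: real_cond_exp_def b_def)
  have "AE \<omega> in M. \<forall>n. \<omega> \<in> B n \<longrightarrow> real_cond_exp M ?F T \<omega> = (\<Sum>i<N. G n i \<omega> * m (X i \<omega>))"
    unfolding AE_all_countable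
  proof
    fix n show "AE \<omega> in M. \<omega> \<in> B n \<longrightarrow> real_cond_exp M ?F T \<omega> = (\<Sum>i<N. G n i \<omega> * m (X i \<omega>))"
      using a[of n] b'[of n] by eventually_elim auto
  qed
  then have "AE \<omega> in M. real_cond_exp M ?F T \<omega> = (\<Sum>i<N. g i \<omega> * m (X i \<omega>))"
  proof (rule AE_mp, intro AE_I2 impI)
    fix \<omega> assume \<omega>: "\<omega> \<in> space M"
      and *: "\<forall>n. \<omega> \<in> B n \<longrightarrow> real_cond_exp M ?F T \<omega> = (\<Sum>i<N. G n i \<omega> * m (X i \<omega>))"
    \<comment> \<open>At a given point the finitely many coefficients are real numbers, so the point
      lies in some \<open>B n\<close>.\<close>
    obtain n where n: "(\<Sum>i<N. \<bar>g i \<omega>\<bar>) \<le> real n" using real_arch_simple by blast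
    have "\<bar>g i \<omega>\<bar> \<le> real n" if "i < N" for i
      using that by (intro order_trans[OF member_le_sum n]) auto
    then have B: "\<omega> \<in> B n" using \<omega> by (simp add: B_def spF)
    then have "real_cond_exp M ?F T \<omega> = (\<Sum>i<N. G n i \<omega> * m (X i \<omega>))" using * by blast
    also have "\<dots> = (\<Sum>i<N. g i \<omega> * m (X i \<omega>))" using B by (simp add: G_def b_def)
    finally show "real_cond_exp M ?F T \<omega> = (\<Sum>i<N. g i \<omega> * m (X i \<omega>))" .
  qed
  then show ?thesis unfolding T_def .
qed

text \<open>Centering at the conditional expectation leaves the combination R of residuals. Tested
  on a covariate event, whose indicator is absorbed into the coefficients, the conditional second
  moment of R is identified by \<open>second_moment\<close>.\<close>

lemma has_cond_var_linear:
  fixes \<gamma> :: "nat \<Rightarrow> (nat \<Rightarrow> real) \<Rightarrow> real"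
  assumes N: "1 \<le> N" and \<gamma>: "\<And>i. i < N \<Longrightarrow> \<gamma> i \<in> borel_measurable (PiM {..<N} (\<lambda>_. borel))"
  shows "has_cond_var M (cov_sigma M X N) (\<lambda>\<omega>. \<Sum>i<N. \<gamma> i (covariates N \<omega>) * Y i \<omega>)
           (\<lambda>\<omega>. \<Sum>i<N. (\<gamma> i (covariates N \<omega>))\<^sup>2 * \<sigma>2 (X i \<omega>))"
proof -
  let ?F = "cov_sigma M X N"
  interpret sigma_finite_subalgebra M ?F by (rule sigma_finite_cov_sigma)
  define g where "g i \<omega> = \<gamma> i (covariates N \<omega>)" for i \<omega>
  define T where "T \<omega> = (\<Sum>i<N. g i \<omega> * Y i \<omega>)" for \<omega>
  define R where "R \<omega> = (\<Sum>i<N. g i \<omega> * (Y i \<omega> - m (X i \<omega>)))" for \<omega>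
  define V where "V \<omega> = (\<Sum>i<N. (g i \<omega>)\<^sup>2 * \<sigma>2 (X i \<omega>))" for \<omega>
  have gF: "g i \<in> borel_measurable ?F" if "i < N" for i
    unfolding g_def using measurable_compose[OF covariates_cov_sigma \<gamma>[OF that]] .
  have gM: "g i \<in> borel_measurable M" if "i < N" for i
    using measurable_from_subalg[OF subalg gF[OF that]] .
  have T_meas [measurable]: "T \<in> borel_measurable M"
    unfolding T_def using gM by (intro borel_measurable_sum borel_measurable_times) auto
  have R_meas [measurable]: "R \<in> borel_measurable M"
    unfolding R_def using gM by (intro borel_measurable_sum borel_measurable_times) auto
  have V_F [measurable]: "V \<in> borel_measurable ?F"
    unfolding V_def using gF X_cov_sigma
    by (intro borel_measurable_sum borel_measurable_times borel_measurable_power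
        measurable_compose[OF _ \<sigma>2_meas]) auto
  have pos: "AE \<omega> in M. \<forall>i\<in>{..<N}. 0 \<le> \<sigma>2 (X i \<omega>)"
    by (rule AE_finite_allI) (auto intro: \<sigma>2_nonneg_AE)
  have V_eq: "AE \<omega> in M. ennreal (V \<omega>) = (\<Sum>i<N. ennreal ((g i \<omega>)\<^sup>2) * ennreal (\<sigma>2 (X i \<omega>)))"
    using pos
  proof eventually_elim
    case (elim \<omega>)
    then have "(\<Sum>i<N. ennreal ((g i \<omega>)\<^sup>2) * ennreal (\<sigma>2 (X i \<omega>))) = (\<Sum>i<N. ennreal ((g i \<omega>)\<^sup>2 * \<sigma>2 (X i \<omega>)))"
      by (intro sum.cong) (auto simp: ennreal_mult)
    also have "\<dots> = ennreal (V \<omega>)" unfolding V_def using elim by (intro sum_ennreal) auto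
    finally show ?case by simp
  qed
  have "AE \<omega> in M. ennreal (V \<omega>) = nn_cond_exp M ?F (\<lambda>\<omega>. ennreal ((R \<omega>)\<^sup>2)) \<omega>"
  proof (rule nn_cond_exp_charact)
    fix A assume "A \<in> sets ?F"
    then obtain A' where A': "A' \<in> sets (PiM {..<N} (\<lambda>_. borel))" "A = covariates N -` A' \<inter> space M"
      by (rule cov_sigma_sets)
    have "(\<integral>\<^sup>+\<omega>. ennreal ((\<Sum>i<N. (indicator A' (covariates N \<omega>) * \<gamma> i (covariates N \<omega>)) * (Y i \<omega> - m (X i \<omega>)))\<^sup>2) \<partial>M)
       = (\<integral>\<^sup>+\<omega>. (\<Sum>i<N. ennreal ((indicator A' (covariates N \<omega>) * \<gamma> i (covariates N \<omega>))\<^sup>2) * ennreal (\<sigma>2 (X i \<omega>))) \<partial>M)"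
      using \<gamma> A'(1) by (intro second_moment[OF N]) auto
    moreover have "(\<integral>\<^sup>+\<omega>. ennreal ((\<Sum>i<N. (indicator A' (covariates N \<omega>) * \<gamma> i (covariates N \<omega>)) * (Y i \<omega> - m (X i \<omega>)))\<^sup>2) \<partial>M)
       = (\<integral>\<^sup>+\<omega>\<in>A. ennreal ((R \<omega>)\<^sup>2) \<partial>M)"
      by (intro nn_integral_cong) (auto simp: A'(2) R_def g_def indicator_def)
    moreover have "(\<integral>\<^sup>+\<omega>. (\<Sum>i<N. ennreal ((indicator A' (covariates N \<omega>) * \<gamma> i (covariates N \<omega>))\<^sup>2) * ennreal (\<sigma>2 (X i \<omega>))) \<partial>M)
       = (\<integral>\<^sup>+\<omega>\<in>A. (\<Sum>i<N. ennreal ((g i \<omega>)\<^sup>2) * ennreal (\<sigma>2 (X i \<omega>))) \<partial>M)"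
      by (intro nn_integral_cong) (auto simp: A'(2) g_def indicator_def)
    moreover have "(\<integral>\<^sup>+\<omega>\<in>A. (\<Sum>i<N. ennreal ((g i \<omega>)\<^sup>2) * ennreal (\<sigma>2 (X i \<omega>))) \<partial>M) = (\<integral>\<^sup>+\<omega>\<in>A. ennreal (V \<omega>) \<partial>M)"
      using V_eq by (intro nn_integral_cong_AE) auto
    ultimately show "(\<integral>\<^sup>+\<omega>\<in>A. ennreal ((R \<omega>)\<^sup>2) \<partial>M) = (\<integral>\<^sup>+\<omega>\<in>A. ennreal (V \<omega>) \<partial>M)" by simp
  qed auto
  moreover have "AE \<omega> in M. nn_cond_exp M ?F (\<lambda>\<omega>. ennreal ((T \<omega> - real_cond_exp M ?F T \<omega>)\<^sup>2)) \<omega>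
      = nn_cond_exp M ?F (\<lambda>\<omega>. ennreal ((R \<omega>)\<^sup>2)) \<omega>"
  proof (rule nn_cond_exp_cong)
    have "AE \<omega> in M. real_cond_exp M ?F T \<omega> = (\<Sum>i<N. g i \<omega> * m (X i \<omega>))"
      unfolding T_def using cond_exp_linear[OF N gF] by simp
    then show "AE \<omega> in M. ennreal ((T \<omega> - real_cond_exp M ?F T \<omega>)\<^sup>2) = ennreal ((R \<omega>)\<^sup>2)"
      by eventually_elim (simp add: T_def R_def sum_subtractf right_diff_distrib)
  qed auto
  moreover have "AE \<omega> in M. 0 \<le> V \<omega>"
    using pos by eventually_elim (auto simp: V_def intro!: sum_nonneg)
  ultimately have "AE \<omega> in M. 0 \<le> V \<omega> \<and>
      nn_cond_exp M ?F (\<lambda>\<omega>. ennreal ((T \<omega> - real_cond_exp M ?F T \<omega>)\<^sup>2)) \<omega> = ennreal (V \<omega>)"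
    by eventually_elim simp
  then show ?thesis unfolding has_cond_var_def T_def V_def g_def .
qed

end


section \<open>Local expansions\<close>

lemma cont_diff_order_continuous:
  assumes "continuously_differentiable_order k g" "0 < k"
  shows "continuous_on UNIV g"
proof -
  have "g differentiable (at s)" for s
    using assms unfolding continuously_differentiable_order_def by force
  then show ?thesis
    by (intro differentiable_imp_continuous_on) (simp add: differentiable_on_def differentiable_at_withinI)
qed

text \<open>Lagrange's remainder with the derivative of order k bounded on the compact interval
  [x - 2, x + 2]; the factorial in the denominator is estimated by 1.\<close>

lemma Taylor_window:
  assumes g: "continuously_differentiable_order k g" and k: "0 < k"
  shows "\<exists>C\<ge>0. \<forall>t. \<bar>t\<bar> \<le> 2 \<longrightarrow> \<bar>g (x + t) - (\<Sum>j<k. beta g x j * t ^ j)\<bar> \<le> C * \<bar>t\<bar> ^ k"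
proof -
  have "compact ((deriv ^^ k) g ` {x - 2..x + 2})"
    using g by (intro compact_continuous_image)
      (auto intro: continuous_on_subset simp: continuously_differentiable_order_def)
  then obtain C where C: "\<And>s. s \<in> {x - 2..x + 2} \<Longrightarrow> \<bar>(deriv ^^ k) g s\<bar> \<le> C"
    unfolding compact_eq_bounded_closed bounded_iff by (auto simp del: atLeastAtMost_iff)
  have C0: "0 \<le> C" using C[of x] by (simp add: order_trans[OF abs_ge_zero])
  have "\<bar>g (x + t) - (\<Sum>j<k. beta g x j * t ^ j)\<bar> \<le> C * \<bar>t\<bar> ^ k" if t: "\<bar>t\<bar> \<le> 2" for t
  proof (cases "t = 0")
    \<comment> \<open>The expansion used in the other case requires a point different from x. Here
      only j = 0 survives, because 0 ^ 0 = 1.\<close>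
    case True
    have "(\<Sum>j<k. beta g x j * 0 ^ j) = (\<Sum>j<k. if j = 0 then beta g x 0 else 0)"
      by (intro sum.cong) auto
    also have "\<dots> = g x" using k by (simp add: beta_def)
    finally have S: "(\<Sum>j<k. beta g x j * 0 ^ j) = g x" .
    show ?thesis unfolding True S using C0 by simp
  next
    case False
    have D: "\<forall>j s. j < k \<and> x - 2 \<le> s \<and> s \<le> x + 2 \<longrightarrow> DERIV ((deriv ^^ j) g) s :> (deriv ^^ Suc j) g s"
      using g by (auto simp: continuously_differentiable_order_def DERIV_deriv_iff_real_differentiable)
    have "\<exists>s. (if x + t < x then x + t < s \<and> s < x else x < s \<and> s < x + t) \<and>
        g (x + t) = (\<Sum>j<k. ((deriv ^^ j) g x / fact j) * (x + t - x) ^ j)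
          + ((deriv ^^ k) g s / fact k) * (x + t - x) ^ k"
      using t False by (intro Taylor[OF k _ D]) auto
    then obtain s where s: "if x + t < x then x + t < s \<and> s < x else x < s \<and> s < x + t"
      and eq: "g (x + t) = (\<Sum>j<k. ((deriv ^^ j) g x / fact j) * (x + t - x) ^ j)
          + ((deriv ^^ k) g s / fact k) * (x + t - x) ^ k"
      by blast
    have "\<bar>g (x + t) - (\<Sum>j<k. beta g x j * t ^ j)\<bar> = \<bar>(deriv ^^ k) g s\<bar> * \<bar>t\<bar> ^ k / fact k"
      unfolding eq by (simp add: beta_def abs_mult power_abs)
    also have "\<dots> \<le> \<bar>(deriv ^^ k) g s\<bar> * \<bar>t\<bar> ^ k / 1"
      by (intro divide_left_mono) auto
    also have "\<dots> \<le> C * \<bar>t\<bar> ^ k"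
      using C[of s] s t by (auto split: if_splits intro!: mult_right_mono)
    finally show ?thesis .
  qed
  then show ?thesis using C0 by blast
qed

lemma bounded_window:
  fixes g :: "real \<Rightarrow> real"
  assumes "continuous_on UNIV g"
  shows "\<exists>C\<ge>0. \<forall>s. \<bar>s - x\<bar> \<le> 2 \<longrightarrow> \<bar>g s\<bar> \<le> C"
proof -
  have "compact (g ` {x - 2..x + 2})"
    using assms by (intro compact_continuous_image) (auto intro: continuous_on_subset)
  then obtain C where C: "\<And>s. s \<in> {x - 2..x + 2} \<Longrightarrow> \<bar>g s\<bar> \<le> C"
    unfolding compact_eq_bounded_closed bounded_iff by (auto simp del: atLeastAtMost_iff)
  have "0 \<le> C" using order_trans[OF abs_ge_zero C[of x]] by simp
  then show ?thesis by (intro exI[of _ C] conjI allI impI C) auto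
qed

lemma scaled_window:
  fixes h t :: real
  assumes "0 < h" "h \<le> 1" "\<bar>t\<bar> \<le> 2"
  shows "\<bar>h * t\<bar> \<le> 2" "\<bar>(x + h * t) - x\<bar> \<le> 2" "\<bar>h * t\<bar> ^ n \<le> 2 ^ n * h ^ n"
proof -
  have "h * \<bar>t\<bar> \<le> 1 * 2" using assms by (intro mult_mono) auto
  then show "\<bar>h * t\<bar> \<le> 2" using assms by (simp add: abs_mult)
  then show "\<bar>(x + h * t) - x\<bar> \<le> 2" by simp
  have "\<bar>h * t\<bar> \<le> 2 * h" using assms by (simp add: abs_mult)
  then have "\<bar>h * t\<bar> ^ n \<le> (2 * h) ^ n" by (rule power_mono) simp
  then show "\<bar>h * t\<bar> ^ n \<le> 2 ^ n * h ^ n" by (simp add: power_mult_distrib)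
qed

section \<open>Uniform first-order expansions and their products\<close>

definition quadratic_error :: "(real \<Rightarrow> real \<Rightarrow> real) \<Rightarrow> bool" where
  "quadratic_error r \<longleftrightarrow> (\<exists>C\<ge>0. \<forall>h t. 0 < h \<longrightarrow> h \<le> 1 \<longrightarrow> \<bar>t\<bar> \<le> 2 \<longrightarrow> \<bar>r h t\<bar> \<le> C * h ^ 2)"

lemma quadratic_errorI:
  "0 \<le> C \<Longrightarrow> (\<And>h t. 0 < h \<Longrightarrow> h \<le> 1 \<Longrightarrow> \<bar>t\<bar> \<le> 2 \<Longrightarrow> \<bar>r h t\<bar> \<le> C * h ^ 2) \<Longrightarrow> quadratic_error r"
  unfolding quadratic_error_def by blast

lemma quadratic_errorE:
  assumes "quadratic_error r"
  obtains C where "0 \<le> C" "\<And>h t. 0 < h \<Longrightarrow> h \<le> 1 \<Longrightarrow> \<bar>t\<bar> \<le> 2 \<Longrightarrow> \<bar>r h t\<bar> \<le> C * h ^ 2"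
  using assms unfolding quadratic_error_def by blast

lemma linear_expansion:
  assumes "continuously_differentiable_order 2 g"
  shows "quadratic_error (\<lambda>h t. g (x + h * t) - (g x + h * (deriv g x * t)))"
proof -
  obtain C where C: "C \<ge> 0" "\<And>t. \<bar>t\<bar> \<le> 2 \<Longrightarrow> \<bar>g (x + t) - (\<Sum>j<2. beta g x j * t ^ j)\<bar> \<le> C * \<bar>t\<bar> ^ 2"
    using Taylor_window[OF assms, of x] by auto
  have "\<bar>g (x + h * t) - (g x + h * (deriv g x * t))\<bar> \<le> (C * 4) * h ^ 2"
    if h: "0 < h" "h \<le> 1" "\<bar>t\<bar> \<le> 2" for h t
  proof -
    have "\<bar>g (x + h * t) - (g x + h * (deriv g x * t))\<bar> \<le> C * \<bar>h * t\<bar> ^ 2"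
      using C(2)[OF scaled_window(1)[OF h]] by (simp add: beta_def numeral_2_eq_2 mult_ac)
    also have "\<dots> \<le> C * (2 ^ 2 * h ^ 2)" using C(1) scaled_window(3)[OF h, of 2] by (intro mult_left_mono) auto
    finally show ?thesis by simp
  qed
  then show ?thesis using C(1) by (intro quadratic_errorI[of "C * 4"]) auto
qed

text \<open>The remainder of the Taylor polynomial of degree p at the point with standardized
  coordinate t. Dividing by h^(p+1) brings it to order one, so that the bias appears as this power
  of h times a convergent quantity.\<close>

definition scaled_remainder :: "(real \<Rightarrow> real) \<Rightarrow> nat \<Rightarrow> real \<Rightarrow> real \<Rightarrow> real \<Rightarrow> real" where
  "scaled_remainder m p x h t = (m (x + h * t) - (\<Sum>l<p + 1. beta m x l * (h * t) ^ l)) / h ^ (p + 1)"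

text \<open>Two further Taylor terms survive the division as the terms of order 1 and h; the
  remainder of order p + 3 leaves h^2. This is where the smoothness of order p + 3 enters.\<close>

lemma scaled_remainder_expansion:
  assumes "continuously_differentiable_order (p + 3) m"
  shows "quadratic_error (\<lambda>h t. scaled_remainder m p x h t
    - (beta m x (p + 1) * t ^ (p + 1) + h * (beta m x (p + 2) * t ^ (p + 2))))"
proof -
  obtain C where C: "C \<ge> 0" "\<And>t. \<bar>t\<bar> \<le> 2 \<Longrightarrow> \<bar>m (x + t) - (\<Sum>j<p + 3. beta m x j * t ^ j)\<bar> \<le> C * \<bar>t\<bar> ^ (p + 3)"
    using Taylor_window[OF assms, of x] by auto
  have "\<bar>scaled_remainder m p x h t - (beta m x (p + 1) * t ^ (p + 1) + h * (beta m x (p + 2) * t ^ (p + 2)))\<bar>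
      \<le> (C * 2 ^ (p + 3)) * h ^ 2" if h: "0 < h" "h \<le> 1" "\<bar>t\<bar> \<le> 2" for h t
  proof -
    have "p + 3 = Suc (Suc (p + 1))" by simp
    then have S: "(\<Sum>j<p + 3. beta m x j * (h * t) ^ j) = (\<Sum>j<p + 1. beta m x j * (h * t) ^ j)
        + beta m x (p + 1) * (h * t) ^ (p + 1) + beta m x (p + 2) * (h * t) ^ (p + 2)"
      by (simp only: sum.lessThan_Suc) simp
    have "scaled_remainder m p x h t - (beta m x (p + 1) * t ^ (p + 1) + h * (beta m x (p + 2) * t ^ (p + 2)))
      = (m (x + h * t) - (\<Sum>j<p + 3. beta m x j * (h * t) ^ j)) / h ^ (p + 1)"
      unfolding S scaled_remainder_def using h by (simp add: field_simps power_mult_distrib)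
    then have "\<bar>scaled_remainder m p x h t - (beta m x (p + 1) * t ^ (p + 1) + h * (beta m x (p + 2) * t ^ (p + 2)))\<bar>
      = \<bar>m (x + h * t) - (\<Sum>j<p + 3. beta m x j * (h * t) ^ j)\<bar> / h ^ (p + 1)"
      using h by simp
    also have "\<dots> \<le> (C * (2 ^ (p + 3) * h ^ (p + 3))) / h ^ (p + 1)"
      using h C(2)[OF scaled_window(1)[OF h]] mult_left_mono[OF scaled_window(3)[OF h, of "p + 3"] C(1)]
      by (intro divide_right_mono) auto
    also have "\<dots> = (C * 2 ^ (p + 3)) * h ^ 2"
      using h by (simp add: field_simps power_add eval_nat_numeral)
    finally show ?thesis .
  qed
  then show ?thesis using C(1) by (intro quadratic_errorI[of "C * 2 ^ (p + 3)"]) auto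
qed

text \<open>The error consists of h^2 a1 b1, the error of q against the bounded factor g, and the
  first-order part of q against the error of g. The common bound D makes the constants uniform over
  the window.\<close>

lemma product_expansion:
  fixes q g :: "real \<Rightarrow> real \<Rightarrow> real" and a0 a1 b0 b1 :: "real \<Rightarrow> real"
  assumes q: "quadratic_error (\<lambda>h t. q h t - (a0 t + h * a1 t))"
    and g: "quadratic_error (\<lambda>h t. g h t - (b0 t + h * b1 t))"
    and bd: "\<And>t. \<bar>t\<bar> \<le> 2 \<Longrightarrow> \<bar>a0 t\<bar> \<le> D" "\<And>t. \<bar>t\<bar> \<le> 2 \<Longrightarrow> \<bar>a1 t\<bar> \<le> D"
      "\<And>t. \<bar>t\<bar> \<le> 2 \<Longrightarrow> \<bar>b0 t\<bar> \<le> D" "\<And>t. \<bar>t\<bar> \<le> 2 \<Longrightarrow> \<bar>b1 t\<bar> \<le> D"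
  shows "quadratic_error (\<lambda>h t. q h t * g h t - (a0 t * b0 t + h * (a0 t * b1 t + a1 t * b0 t)))"
proof -
  obtain A where A: "0 \<le> A" "\<And>h t. 0 < h \<Longrightarrow> h \<le> 1 \<Longrightarrow> \<bar>t\<bar> \<le> 2 \<Longrightarrow> \<bar>q h t - (a0 t + h * a1 t)\<bar> \<le> A * h ^ 2"
    using q by (rule quadratic_errorE) blast
  obtain B where B: "0 \<le> B" "\<And>h t. 0 < h \<Longrightarrow> h \<le> 1 \<Longrightarrow> \<bar>t\<bar> \<le> 2 \<Longrightarrow> \<bar>g h t - (b0 t + h * b1 t)\<bar> \<le> B * h ^ 2"
    using g by (rule quadratic_errorE) blast
  have D0: "0 \<le> D" using bd(1)[of 0] by (simp add: order_trans[OF abs_ge_zero])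
  have "\<bar>q h t * g h t - (a0 t * b0 t + h * (a0 t * b1 t + a1 t * b0 t))\<bar>
      \<le> (D * D + A * (2 * D + B) + 2 * D * B) * h ^ 2" if h: "0 < h" "h \<le> 1" "\<bar>t\<bar> \<le> 2" for h t
  proof -
    define eq where "eq = q h t - (a0 t + h * a1 t)"
    define eg where "eg = g h t - (b0 t + h * b1 t)"
    have e: "\<bar>eq\<bar> \<le> A * h ^ 2" "\<bar>eg\<bar> \<le> B * h ^ 2" using A(2)[OF h] B(2)[OF h] by (auto simp: eq_def eg_def)
    have h2: "h ^ 2 \<le> 1" using h power_mono[of h 1 2] by simp
    have lin: "\<bar>u + h * v\<bar> \<le> 2 * D" if "\<bar>u\<bar> \<le> D" "\<bar>v\<bar> \<le> D" for u v
    proof -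
      have "\<bar>h * v\<bar> \<le> 1 * D" unfolding abs_mult using h that by (intro mult_mono) auto
      then show ?thesis using that by linarith
    qed
    have g_bd: "\<bar>g h t\<bar> \<le> 2 * D + B"
    proof -
      have "B * h ^ 2 \<le> B" using B(1) h2 by (simp add: mult_left_le)
      moreover have "g h t = (b0 t + h * b1 t) + eg" by (simp add: eg_def)
      ultimately show ?thesis using lin[OF bd(3,4)[OF h(3)]] e(2) by linarith
    qed
    have "q h t * g h t - (a0 t * b0 t + h * (a0 t * b1 t + a1 t * b0 t))
        = h ^ 2 * (a1 t * b1 t) + eq * g h t + (a0 t + h * a1 t) * eg"
      by (simp add: eq_def eg_def algebra_simps power2_eq_square)
    also have "\<bar>\<dots>\<bar> \<le> \<bar>h ^ 2 * (a1 t * b1 t)\<bar> + \<bar>eq * g h t\<bar> + \<bar>(a0 t + h * a1 t) * eg\<bar>" by linarith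
    also have "\<dots> \<le> h ^ 2 * (D * D) + (A * h ^ 2) * (2 * D + B) + (2 * D) * (B * h ^ 2)"
      unfolding abs_mult using e g_bd lin[OF bd(1,2)[OF h(3)]] bd(2,4)[OF h(3)] D0 A(1) B(1)
      by (intro add_mono mult_mono) auto
    finally show ?thesis by (simp add: algebra_simps)
  qed
  then show ?thesis using D0 A(1) B(1)
    by (intro quadratic_errorI[of "D * D + A * (2 * D + B) + 2 * D * B"]) auto
qed

text \<open>The integrand is dominated by \<open>B * D\<close> on [-2, 2]; the factor 4 is the
  length of the window.\<close>

lemma compact_kernel_integral:
  fixes \<phi> w :: "real \<Rightarrow> real"
  assumes [measurable]: "\<phi> \<in> borel_measurable borel" "w \<in> borel_measurable borel"
    and van: "\<And>t. 2 < \<bar>t\<bar> \<Longrightarrow> \<phi> t = 0" and B: "\<And>t. \<bar>\<phi> t\<bar> \<le> B" and D: "\<And>t. \<bar>t\<bar> \<le> 2 \<Longrightarrow> \<bar>w t\<bar> \<le> D"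
  shows "integrable lborel (\<lambda>t. \<phi> t * w t)" and "\<bar>\<integral>t. \<phi> t * w t \<partial>lborel\<bar> \<le> 4 * B * D"
proof -
  have D0: "0 \<le> D" using D[of 0] by (simp add: order_trans[OF abs_ge_zero])
  have B0: "0 \<le> B" using B[of 0] by (simp add: order_trans[OF abs_ge_zero])
  have le: "\<bar>\<phi> t * w t\<bar> \<le> B * D * indicator {-2..2} t" for t
  proof (cases "\<bar>t\<bar> \<le> 2")
    case True
    then show ?thesis using B[of t] D[of t] B0 by (auto simp: abs_mult indicator_def intro!: mult_mono)
  next
    case False
    then show ?thesis using van[of t] B0 D0 by (auto simp: indicator_def)
  qed
  have int: "integrable lborel (\<lambda>t. B * D * indicator {-2..2::real} t)" by simp
  show I: "integrable lborel (\<lambda>t. \<phi> t * w t)"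
    by (rule Bochner_Integration.integrable_bound[OF int]) (use le B0 D0 in auto)
  have "\<bar>\<integral>t. \<phi> t * w t \<partial>lborel\<bar> \<le> (\<integral>t. \<bar>\<phi> t * w t\<bar> \<partial>lborel)"
    by (rule integral_abs_bound)
  also have "\<dots> \<le> (\<integral>t. B * D * indicator {-2..2::real} t \<partial>lborel)"
    using le by (intro integral_mono integrable_abs[OF I] int)
  finally show "\<bar>\<integral>t. \<phi> t * w t \<partial>lborel\<bar> \<le> 4 * B * D" by simp
qed


section \<open>Bounds holding with high probability\<close>

text \<open>The exceptional set \<open>B\<close> is explicit because \<open>Q C J\<close> itself need not be measurable.\<close>

definition whp :: "'a measure \<Rightarrow> (real \<Rightarrow> nat \<Rightarrow> 'a \<Rightarrow> bool) \<Rightarrow> bool" where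
  "whp M Q \<longleftrightarrow> (\<forall>\<epsilon>>0. \<exists>C0. \<forall>C\<ge>C0. \<forall>\<^sub>F J in sequentially.
     \<exists>B\<in>sets M. measure M B < \<epsilon> \<and> (\<forall>\<omega>\<in>space M - B. Q C J \<omega>))"

lemma whp_mono:
  assumes "whp M Q"
    and "\<And>C. \<exists>C'. \<forall>C''\<ge>C'. \<forall>\<^sub>F J in sequentially. \<forall>\<omega>\<in>space M. Q C J \<omega> \<longrightarrow> Q' C'' J \<omega>"
  shows "whp M Q'"
  unfolding whp_def
proof (intro allI impI)
  fix \<epsilon> :: real assume "\<epsilon> > 0"
  then obtain C where C: "\<forall>\<^sub>F J in sequentially. \<exists>B\<in>sets M. measure M B < \<epsilon> \<and> (\<forall>\<omega>\<in>space M - B. Q C J \<omega>)"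
    using assms(1) unfolding whp_def by blast
  obtain C' where C': "\<And>C''. C'' \<ge> C' \<Longrightarrow> \<forall>\<^sub>F J in sequentially. \<forall>\<omega>\<in>space M. Q C J \<omega> \<longrightarrow> Q' C'' J \<omega>"
    using assms(2)[of C] by blast
  have "\<forall>\<^sub>F J in sequentially. \<exists>B\<in>sets M. measure M B < \<epsilon> \<and> (\<forall>\<omega>\<in>space M - B. Q' C'' J \<omega>)" if "C'' \<ge> C'" for C''
    using C C'[OF that] by eventually_elim blast
  then show "\<exists>C0. \<forall>C\<ge>C0. \<forall>\<^sub>F J in sequentially. \<exists>B\<in>sets M. measure M B < \<epsilon> \<and> (\<forall>\<omega>\<in>space M - B. Q' C J \<omega>)"
    by blast
qed

text \<open>The form used throughout: for each constant in the hypothesis it suffices to find one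
  constant in the conclusion, since enlarging it is harmless when \<open>a\<close> is
  nonnegative.\<close>

lemma whp_le:
  assumes "whp M Q" and a: "\<And>J. 0 \<le> a J"
    and le: "\<And>C. \<exists>C'. \<forall>\<^sub>F J in sequentially. \<forall>\<omega>\<in>space M. Q C J \<omega> \<longrightarrow> \<bar>R J \<omega>\<bar> \<le> C' * a J"
  shows "whp M (\<lambda>C J \<omega>. \<bar>R J \<omega>\<bar> \<le> C * a J)"
proof (rule whp_mono[OF assms(1)])
  fix C
  obtain C' where C': "\<forall>\<^sub>F J in sequentially. \<forall>\<omega>\<in>space M. Q C J \<omega> \<longrightarrow> \<bar>R J \<omega>\<bar> \<le> C' * a J" using le by blast
  have "\<forall>\<^sub>F J in sequentially. \<forall>\<omega>\<in>space M. Q C J \<omega> \<longrightarrow> \<bar>R J \<omega>\<bar> \<le> C'' * a J" if "C'' \<ge> C'" for C''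
    using C' by eventually_elim (use mult_right_mono[OF that a] order_trans in blast)
  then show "\<exists>C'. \<forall>C''\<ge>C'. \<forall>\<^sub>F J in sequentially. \<forall>\<omega>\<in>space M. Q C J \<omega> \<longrightarrow> \<bar>R J \<omega>\<bar> \<le> C'' * a J" by blast
qed

text \<open>Because \<open>whp\<close> asserts its bound for all sufficiently large constants, one
  constant serves both statements; the exceptional sets get half of \<epsilon> each.\<close>

lemma (in prob_space) whp_conj:
  assumes "whp M P" "whp M Q"
  shows "whp M (\<lambda>C J \<omega>. P C J \<omega> \<and> Q C J \<omega>)"
  unfolding whp_def
proof (intro allI impI)
  fix \<epsilon> :: real assume "\<epsilon> > 0"
  then have e: "\<epsilon> / 2 > 0" by simp
  obtain A where A: "\<And>C. C \<ge> A \<Longrightarrow> \<forall>\<^sub>F J in sequentially. \<exists>B\<in>sets M. prob B < \<epsilon> / 2 \<and> (\<forall>\<omega>\<in>space M - B. P C J \<omega>)"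
    using assms(1) e unfolding whp_def by blast
  obtain D where D: "\<And>C. C \<ge> D \<Longrightarrow> \<forall>\<^sub>F J in sequentially. \<exists>B\<in>sets M. prob B < \<epsilon> / 2 \<and> (\<forall>\<omega>\<in>space M - B. Q C J \<omega>)"
    using assms(2) e unfolding whp_def by blast
  have "\<forall>\<^sub>F J in sequentially. \<exists>B\<in>sets M. prob B < \<epsilon> \<and> (\<forall>\<omega>\<in>space M - B. P C J \<omega> \<and> Q C J \<omega>)"
    if "C \<ge> max A D" for C
  proof -
    have "C \<ge> A" "C \<ge> D" using that by auto
    from A[OF this(1)] D[OF this(2)] show ?thesis
    proof eventually_elim
      case (elim J)
      then obtain B1 B2 where B: "B1 \<in> sets M" "prob B1 < \<epsilon> / 2" "\<forall>\<omega>\<in>space M - B1. P C J \<omega>"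
        "B2 \<in> sets M" "prob B2 < \<epsilon> / 2" "\<forall>\<omega>\<in>space M - B2. Q C J \<omega>"
        by blast
      have "prob (B1 \<union> B2) \<le> prob B1 + prob B2" using B by (intro measure_Un_le)
      then have "prob (B1 \<union> B2) < \<epsilon>" using B by simp
      then show ?case using B by (intro bexI[of _ "B1 \<union> B2"]) auto
    qed
  qed
  then show "\<exists>C0. \<forall>C\<ge>C0. \<forall>\<^sub>F J in sequentially. \<exists>B\<in>sets M. prob B < \<epsilon> \<and> (\<forall>\<omega>\<in>space M - B. P C J \<omega> \<and> Q C J \<omega>)"
    by blast
qed

lemma (in prob_space) whp_ball:
  assumes "finite I" "\<And>i. i \<in> I \<Longrightarrow> whp M (Q i)"
  shows "whp M (\<lambda>C J \<omega>. \<forall>i\<in>I. Q i C J \<omega>)"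
  using assms
proof (induction I rule: finite_induct)
  case empty
  then show ?case by (auto simp: whp_def intro!: bexI[of _ "{}"])
next
  case (insert i I)
  from whp_conj[of "Q i" "\<lambda>C J \<omega>. \<forall>i\<in>I. Q i C J \<omega>"] insert show ?case by simp
qed

lemma (in prob_space) big_O_P_whp:
  assumes R [measurable]: "\<And>n. R n \<in> borel_measurable M" and w: "whp M (\<lambda>C J \<omega>. \<bar>R J \<omega>\<bar> \<le> C * a J)"
  shows "big_O_P M R a"
  unfolding big_O_P_def
proof (intro conjI allI impI R)
  fix \<epsilon> :: real assume "\<epsilon> > 0"
  then obtain C where C: "\<forall>\<^sub>F J in sequentially. \<exists>B\<in>sets M. prob B < \<epsilon> \<and> (\<forall>\<omega>\<in>space M - B. \<bar>R J \<omega>\<bar> \<le> C * a J)"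
    using w unfolding whp_def by blast
  have "\<forall>\<^sub>F J in sequentially. prob {\<omega> \<in> space M. \<bar>R J \<omega>\<bar> > C * a J} < \<epsilon>"
    using C
  proof eventually_elim
    case (elim J)
    then obtain B where B: "B \<in> sets M" "prob B < \<epsilon>" "\<forall>\<omega>\<in>space M - B. \<bar>R J \<omega>\<bar> \<le> C * a J" by blast
    have "prob {\<omega> \<in> space M. \<bar>R J \<omega>\<bar> > C * a J} \<le> prob B"
      using B by (intro finite_measure_mono) force+
    then show ?case using B by simp
  qed
  then show "\<exists>C. \<forall>\<^sub>F J in sequentially. prob {\<omega> \<in> space M. \<bar>R J \<omega>\<bar> > C * a J} < \<epsilon>" by blast
qed

text \<open>For fixed \<epsilon> the constant C is fixed as well, and \<open>C * a J\<close>
  eventually falls below any given \<delta>.\<close>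

lemma (in prob_space) small_o_P_whp:
  assumes R [measurable]: "\<And>n. R n \<in> borel_measurable M" and w: "whp M (\<lambda>C J \<omega>. \<bar>R J \<omega>\<bar> \<le> C * a J)"
    and a: "a \<longlonglongrightarrow> 0"
  shows "small_o_P M R (\<lambda>_. 1)"
  unfolding small_o_P_def
proof (intro conjI allI impI R)
  fix \<delta> :: real assume \<delta>: "\<delta> > 0"
  show "(\<lambda>n. prob {\<omega> \<in> space M. \<bar>R n \<omega>\<bar> > \<delta> * 1}) \<longlonglongrightarrow> 0"
  proof (rule tendstoI)
    fix \<epsilon> :: real assume "\<epsilon> > 0"
    then obtain C where C: "\<forall>\<^sub>F J in sequentially. \<exists>B\<in>sets M. prob B < \<epsilon> \<and> (\<forall>\<omega>\<in>space M - B. \<bar>R J \<omega>\<bar> \<le> C * a J)"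
      using w unfolding whp_def by blast
    have "(\<lambda>J. C * a J) \<longlonglongrightarrow> C * 0" by (intro tendsto_intros a)
    then have "\<forall>\<^sub>F J in sequentially. C * a J < \<delta>" using \<delta> by (intro order_tendstoD) auto
    with C show "\<forall>\<^sub>F n in sequentially. dist (prob {\<omega> \<in> space M. \<bar>R n \<omega>\<bar> > \<delta> * 1}) 0 < \<epsilon>"
    proof eventually_elim
      case (elim J)
      then obtain B where B: "B \<in> sets M" "prob B < \<epsilon>" "\<forall>\<omega>\<in>space M - B. \<bar>R J \<omega>\<bar> \<le> C * a J" by blast
      have "prob {\<omega> \<in> space M. \<bar>R J \<omega>\<bar> > \<delta> * 1} \<le> prob B"
        using B elim(2) by (intro finite_measure_mono) force+
      then show ?case using B by simp
    qed
  qed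
qed

text \<open>Pairwise independence and centering remove the mixed terms; boundedness supplies the
  integrability needed to expand the square.\<close>

lemma (in prob_space) indep_sum_second_moment:
  fixes \<xi> :: "nat \<Rightarrow> 'a \<Rightarrow> real"
  assumes ind: "indep_vars (\<lambda>_. borel) \<xi> UNIV"
    and bd: "\<And>i \<omega>. \<omega> \<in> space M \<Longrightarrow> \<bar>\<xi> i \<omega>\<bar> \<le> K"
    and mean: "\<And>i. expectation (\<xi> i) = 0" and var: "\<And>i. expectation (\<lambda>\<omega>. (\<xi> i \<omega>)\<^sup>2) \<le> v"
  shows "integrable M (\<lambda>\<omega>. (\<Sum>i<N. \<xi> i \<omega>)\<^sup>2)" and "expectation (\<lambda>\<omega>. (\<Sum>i<N. \<xi> i \<omega>)\<^sup>2) \<le> real N * v"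
proof -
  have meas [measurable]: "\<xi> i \<in> borel_measurable M" for i
    using ind by (auto simp: indep_vars_def)
  have int: "integrable M (\<xi> i)" for i
    by (rule integrable_const_bound[of _ K]) (use bd in auto)
  have int2: "integrable M (\<lambda>\<omega>. \<xi> i \<omega> * \<xi> k \<omega>)" for i k
  proof (rule integrable_const_bound[of _ "K * K"])
    show "AE \<omega> in M. norm (\<xi> i \<omega> * \<xi> k \<omega>) \<le> K * K"
    proof (rule AE_I2)
      fix \<omega> assume "\<omega> \<in> space M"
      then show "norm (\<xi> i \<omega> * \<xi> k \<omega>) \<le> K * K"
        using bd[of \<omega> i] bd[of \<omega> k] unfolding real_norm_def abs_mult by (intro mult_mono) auto
    qed
  qed measurable
  have cross: "expectation (\<lambda>\<omega>. \<xi> i \<omega> * \<xi> k \<omega>) = 0" if "i \<noteq> k" for i k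
  proof -
    have "indep_vars (\<lambda>_. borel) \<xi> {i, k}" using ind by (rule indep_vars_subset) simp
    from indep_vars_lebesgue_integral[OF _ this] int have
      "expectation (\<lambda>\<omega>. \<Prod>j\<in>{i, k}. \<xi> j \<omega>) = (\<Prod>j\<in>{i, k}. expectation (\<xi> j))" by auto
    then show ?thesis using that mean by simp
  qed
  have expand: "(\<Sum>i<N. \<xi> i \<omega>)\<^sup>2 = (\<Sum>i<N. \<Sum>k<N. \<xi> i \<omega> * \<xi> k \<omega>)" for \<omega>
    by (simp add: power2_eq_square sum_product)
  show "integrable M (\<lambda>\<omega>. (\<Sum>i<N. \<xi> i \<omega>)\<^sup>2)"
    unfolding expand using int2 by (intro Bochner_Integration.integrable_sum)
  have "expectation (\<lambda>\<omega>. (\<Sum>i<N. \<xi> i \<omega>)\<^sup>2) = (\<Sum>i<N. \<Sum>k<N. expectation (\<lambda>\<omega>. \<xi> i \<omega> * \<xi> k \<omega>))"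
    unfolding expand using int2
    by (subst Bochner_Integration.integral_sum; (intro Bochner_Integration.integrable_sum sum.cong refl)?; simp)
  also have "\<dots> = (\<Sum>i<N. \<Sum>k<N. if k = i then expectation (\<lambda>\<omega>. (\<xi> i \<omega>)\<^sup>2) else 0)"
    using cross by (intro sum.cong refl) (auto simp: power2_eq_square)
  also have "\<dots> = (\<Sum>i<N. expectation (\<lambda>\<omega>. (\<xi> i \<omega>)\<^sup>2))" by simp
  also have "\<dots> \<le> (\<Sum>i<N. v)" by (intro sum_mono var)
  finally show "expectation (\<lambda>\<omega>. (\<Sum>i<N. \<xi> i \<omega>)\<^sup>2) \<le> real N * v" by simp
qed


section \<open>Kernel averages\<close>

locale pooled_asymptotics = pooled_sample +
  fixes x :: real and c :: nat and h :: "nat \<Rightarrow> real"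
  assumes f_smooth: "continuously_differentiable_order 2 f" and fx: "0 < f x" and c1: "1 \<le> c"
    and h_pos: "\<And>J. 0 < h J" and h_lim: "h \<longlonglongrightarrow> 0"
    and h_rate: "filterlim (\<lambda>J. real J * h J ^ 4) at_top sequentially"
begin

lemma f_cont: "continuous_on UNIV f"
  using cont_diff_order_continuous[OF f_smooth] by simp

lemma f_meas [measurable]: "f \<in> borel_measurable borel"
  using f_cont by (rule borel_measurable_continuous_onI)

lemma h_le_1: "\<forall>\<^sub>F J in sequentially. h J \<le> 1"
proof -
  have "\<forall>\<^sub>F J in sequentially. h J < 1" by (rule order_tendstoD(2)[OF h_lim]) simp
  then show ?thesis by eventually_elim simp
qed

definition rate :: "nat \<Rightarrow> real" where
  "rate J = 1 / sqrt (real (c * J) * h J)"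

lemma rate_nonneg: "0 \<le> rate J"
  using h_pos[of J] by (simp add: rate_def)

lemma rate_sq: "rate J ^ 2 = 1 / (real (c * J) * h J)"
  using h_pos[of J] by (simp add: rate_def power_divide)

lemma Jh_at_top: "filterlim (\<lambda>J. real J * h J) at_top sequentially"
proof (rule filterlim_at_top_mono[OF h_rate])
  show "\<forall>\<^sub>F J in sequentially. real J * h J ^ 4 \<le> real J * h J"
    using h_le_1
  proof eventually_elim
    case (elim J)
    have "h J ^ 4 \<le> h J ^ 1" using elim h_pos[of J] by (intro power_decreasing) auto
    then show ?case by (intro mult_left_mono) auto
  qed
qed

lemma cJh_at_top: "filterlim (\<lambda>J. real (c * J) * h J) at_top sequentially"
proof -
  have "filterlim (\<lambda>J. real c * (real J * h J)) at_top sequentially"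
    using c1 by (intro filterlim_tendsto_pos_mult_at_top[OF tendsto_const _ Jh_at_top]) auto
  then show ?thesis by (simp add: mult_ac)
qed

lemma rate_lim: "rate \<longlonglongrightarrow> 0"
proof -
  have "filterlim (\<lambda>J. sqrt (real (c * J) * h J)) at_top sequentially"
    by (rule filterlim_compose[OF sqrt_at_top cJh_at_top])
  from tendsto_divide_0[OF tendsto_const filterlim_at_top_imp_at_infinity[OF this], of 1]
  show ?thesis by (simp add: rate_def[abs_def])
qed

lemma rate_sq_le_rate: "\<forall>\<^sub>F J in sequentially. rate J ^ 2 \<le> rate J"
proof -
  have "\<forall>\<^sub>F J in sequentially. rate J < 1" by (rule order_tendstoD(2)[OF rate_lim]) simp
  then show ?thesis
    by eventually_elim (use rate_nonneg in \<open>auto simp: power2_eq_square intro: mult_left_le\<close>)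
qed

section \<open>Averages over individuals: concentration and localization\<close>

definition avg :: "(real \<Rightarrow> real) \<Rightarrow> nat \<Rightarrow> 'a \<Rightarrow> real" where
  "avg \<phi> J \<omega> = (\<Sum>i<c * J. \<phi> ((X i \<omega> - x) / h J)) / (real (c * J) * h J)"

text \<open>The expectation of \<open>avg\<close> after the substitution s = x + h t, whose factor h
  cancels the one in the normalization of \<open>avg\<close>.\<close>

definition mean :: "(real \<Rightarrow> real) \<Rightarrow> nat \<Rightarrow> real" where
  "mean \<phi> J = (\<integral>t. \<phi> t * f (x + h J * t) \<partial>lborel)"

lemma expectation_scaled:
  assumes [measurable]: "g \<in> borel_measurable borel" and H: "0 < H"
  shows "expectation (\<lambda>\<omega>. g ((X i \<omega> - x) / H)) = H * (\<integral>t. g t * f (x + H * t) \<partial>lborel)"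
proof -
  have "expectation (\<lambda>\<omega>. g ((X i \<omega> - x) / H)) = (\<integral>s. g ((s - x) / H) \<partial>distr M borel (X i))"
    by (rule integral_distr[symmetric]) auto
  also have "\<dots> = (\<integral>s. g ((s - x) / H) \<partial>distr M borel (X 0))" by (subst distr_X) (rule refl)
  also have "\<dots> = expectation (\<lambda>\<omega>. g ((X 0 \<omega> - x) / H))" by (rule integral_distr) auto
  also have "\<dots> = (\<integral>s. f s * g ((s - x) / H) \<partial>lborel)"
    by (rule distributed_integral[OF f_density(1), symmetric]) (auto simp: f_density(2))
  also have "\<dots> = \<bar>H\<bar> *\<^sub>R (\<integral>t. f (x + H * t) * g ((x + H * t - x) / H) \<partial>lborel)"
    using H by (intro lborel_integral_real_affine) simp
  finally show ?thesis using H by (simp add: mult.commute)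
qed

lemma avg_meas [measurable]:
  assumes [measurable]: "\<phi> \<in> borel_measurable borel"
  shows "avg \<phi> J \<in> borel_measurable M"
  unfolding avg_def by measurable

lemma f_window: obtains F where "0 \<le> F" "\<And>t J. h J \<le> 1 \<Longrightarrow> \<bar>t\<bar> \<le> 2 \<Longrightarrow> \<bar>f (x + h J * t)\<bar> \<le> F"
proof -
  obtain F where F: "F \<ge> 0" "\<And>s. \<bar>s - x\<bar> \<le> 2 \<Longrightarrow> \<bar>f s\<bar> \<le> F" using bounded_window[OF f_cont, of x] by blast
  show ?thesis using that[OF F(1)] F(2) scaled_window(2)[OF h_pos] by blast
qed

text \<open>One summand has variance of order h, since \<phi> vanishes outside a window of width
  proportional to h. Division of the sum by N h leaves a variance of order 1 / (N h), the squared
  rate, and Markov's inequality is applied to the squared sum.\<close>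

lemma avg_deviation:
  assumes [measurable]: "\<phi> \<in> borel_measurable borel" and J: "1 \<le> J" and C: "0 < C"
    and van: "\<And>t. 2 < \<bar>t\<bar> \<Longrightarrow> \<phi> t = 0" and B: "\<And>t. \<bar>\<phi> t\<bar> \<le> B"
    and F: "\<And>t. \<bar>t\<bar> \<le> 2 \<Longrightarrow> \<bar>f (x + h J * t)\<bar> \<le> F"
  shows "prob {\<omega> \<in> space M. C * rate J \<le> \<bar>avg \<phi> J \<omega> - mean \<phi> J\<bar>} \<le> 4 * B\<^sup>2 * F / C\<^sup>2"
proof -
  define N where "N = c * J"
  have N: "1 \<le> N" using J c1 by (simp add: N_def)
  have H: "0 < h J" by (rule h_pos)
  define a where "a = h J * mean \<phi> J"
  define \<xi> where "\<xi> i \<omega> = \<phi> ((X i \<omega> - x) / h J) - a" for i \<omega>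
  have bd: "\<bar>\<xi> i \<omega>\<bar> \<le> B + \<bar>a\<bar>" for i \<omega> unfolding \<xi>_def using B[of "(X i \<omega> - x) / h J"] by linarith
  have meas [measurable]: "(\<lambda>\<omega>. \<phi> ((X i \<omega> - x) / h J)) \<in> borel_measurable M" for i by measurable
  have int: "integrable M (\<lambda>\<omega>. \<phi> ((X i \<omega> - x) / h J))" for i
    by (rule integrable_const_bound[of _ B]) (use B in auto)
  have int2: "integrable M (\<lambda>\<omega>. (\<phi> ((X i \<omega> - x) / h J))\<^sup>2)" for i
    by (rule integrable_const_bound[of _ "B\<^sup>2"]) (use B in \<open>auto simp: abs_le_square_iff power2_abs intro!: power2_le_iff_abs_le[THEN iffD2] order_trans[OF abs_ge_zero]\<close>)
  have E: "expectation (\<lambda>\<omega>. \<phi> ((X i \<omega> - x) / h J)) = a" for i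
    using expectation_scaled[of \<phi>, OF _ H] by (simp add: a_def mean_def)
  have mean0: "expectation (\<xi> i) = 0" for i
    unfolding \<xi>_def using int E by (simp add: prob_space)
  have var: "expectation (\<lambda>\<omega>. (\<xi> i \<omega>)\<^sup>2) \<le> h J * (4 * B\<^sup>2 * F)" for i
  proof -
    have "expectation (\<lambda>\<omega>. (\<xi> i \<omega>)\<^sup>2)
        = expectation (\<lambda>\<omega>. (\<phi> ((X i \<omega> - x) / h J))\<^sup>2 - 2 * a * \<phi> ((X i \<omega> - x) / h J) + a\<^sup>2)"
      by (simp add: \<xi>_def power2_diff algebra_simps)
    also have "\<dots> = expectation (\<lambda>\<omega>. (\<phi> ((X i \<omega> - x) / h J))\<^sup>2) - 2 * a * a + a\<^sup>2"
      using int int2 E by (simp add: prob_space)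
    also have "\<dots> \<le> expectation (\<lambda>\<omega>. (\<phi> ((X i \<omega> - x) / h J))\<^sup>2)" by (simp add: power2_eq_square)
    also have "\<dots> = h J * (\<integral>t. (\<phi> t)\<^sup>2 * f (x + h J * t) \<partial>lborel)"
      by (rule expectation_scaled[OF _ H, of "\<lambda>t. (\<phi> t)\<^sup>2"]) measurable
    also have "\<dots> \<le> h J * (4 * B\<^sup>2 * F)"
    proof (intro mult_left_mono order_trans[OF abs_ge_self compact_kernel_integral(2)])
      show "\<bar>(\<phi> t)\<^sup>2\<bar> \<le> B\<^sup>2" for t
        using B[of t] by (simp add: abs_le_square_iff[symmetric] order_trans[OF abs_ge_zero])
    qed (use van F H in auto)
    finally show ?thesis .
  qed
  have ind: "indep_vars (\<lambda>_. borel) \<xi> UNIV"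
    using indep_vars_compose2[OF indep, of "\<lambda>_ z. \<phi> ((snd z - x) / h J) - a" "\<lambda>_. borel"]
    by (simp add: \<xi>_def[abs_def])
  note S = indep_sum_second_moment[OF ind bd mean0 var]
  have NH: "0 < real N * h J" using N H by simp
  have "avg \<phi> J \<omega> - mean \<phi> J = (\<Sum>i<N. \<xi> i \<omega>) / (real N * h J)" for \<omega>
  proof -
    have "real N * a / (real N * h J) = mean \<phi> J" using N H by (simp add: a_def)
    then show ?thesis by (simp add: avg_def \<xi>_def sum_subtractf diff_divide_distrib flip: N_def)
  qed
  then have "C * rate J \<le> \<bar>avg \<phi> J \<omega> - mean \<phi> J\<bar> \<longleftrightarrow> C\<^sup>2 * (real N * h J) \<le> (\<Sum>i<N. \<xi> i \<omega>)\<^sup>2" for \<omega>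
  proof -
    assume eq: "\<And>\<omega>. avg \<phi> J \<omega> - mean \<phi> J = (\<Sum>i<N. \<xi> i \<omega>) / (real N * h J)"
    have "C * rate J \<le> \<bar>avg \<phi> J \<omega> - mean \<phi> J\<bar> \<longleftrightarrow> (C * rate J)\<^sup>2 \<le> (avg \<phi> J \<omega> - mean \<phi> J)\<^sup>2"
      using C rate_nonneg[of J] by (simp add: abs_le_square_iff[symmetric])
    also have "\<dots> \<longleftrightarrow> C\<^sup>2 / (real N * h J) \<le> (\<Sum>i<N. \<xi> i \<omega>)\<^sup>2 / (real N * h J)\<^sup>2"
      unfolding eq power_mult_distrib rate_sq power_divide N_def by simp
    also have "\<dots> \<longleftrightarrow> C\<^sup>2 * (real N * h J) \<le> (\<Sum>i<N. \<xi> i \<omega>)\<^sup>2"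
    proof -
      have "u / d \<le> v / d\<^sup>2 \<longleftrightarrow> u * d \<le> v" if "0 < d" for u v d :: real
        using that by (simp add: field_simps power2_eq_square)
      from this[OF NH] show ?thesis .
    qed
    finally show ?thesis .
  qed
  then have "prob {\<omega> \<in> space M. C * rate J \<le> \<bar>avg \<phi> J \<omega> - mean \<phi> J\<bar>}
      = prob {\<omega> \<in> space M. (\<Sum>i<N. \<xi> i \<omega>)\<^sup>2 \<ge> C\<^sup>2 * (real N * h J)}" by simp
  also have "\<dots> \<le> expectation (\<lambda>\<omega>. (\<Sum>i<N. \<xi> i \<omega>)\<^sup>2) / (C\<^sup>2 * (real N * h J))"
    using S(1) C NH by (intro integral_Markov_inequality_measure[where A="space M"]) auto
  also have "\<dots> \<le> (real N * (h J * (4 * B\<^sup>2 * F))) / (C\<^sup>2 * (real N * h J))"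
    using S(2) C NH by (intro divide_right_mono) auto
  also have "\<dots> = 4 * B\<^sup>2 * F / C\<^sup>2"
  proof -
    have "real N \<noteq> 0" "h J \<noteq> 0" using N H by auto
    then show ?thesis using C by (simp add: field_simps)
  qed
  finally show ?thesis .
qed

text \<open>The kernel may vary with the bandwidth, as it does when it carries a Taylor remainder or
  \<open>\<sigma>2 (x + h J * t)\<close>; it has to be bounded uniformly in large J.\<close>

lemma whp_avg:
  assumes \<phi>: "\<And>J. \<phi> J \<in> borel_measurable borel"
    and ev: "\<forall>\<^sub>F J in sequentially. \<forall>t. \<bar>\<phi> J t\<bar> \<le> B \<and> (2 < \<bar>t\<bar> \<longrightarrow> \<phi> J t = 0)"
  shows "whp M (\<lambda>C J \<omega>. \<bar>avg (\<phi> J) J \<omega> - mean (\<phi> J) J\<bar> \<le> C * rate J)"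
  unfolding whp_def
proof (intro allI impI)
  fix \<epsilon> :: real assume \<epsilon>: "\<epsilon> > 0"
  obtain F where F: "0 \<le> F" "\<And>t J. h J \<le> 1 \<Longrightarrow> \<bar>t\<bar> \<le> 2 \<Longrightarrow> \<bar>f (x + h J * t)\<bar> \<le> F" by (rule f_window) blast
  \<comment> \<open>Makes the bound 4 B^2 F / C0^2 from \<open>avg_deviation\<close> at most
    \<epsilon>/2; the added 1 keeps C0 positive.\<close>
  define C0 where "C0 = sqrt ((4 * B\<^sup>2 * F + 1) / (\<epsilon> / 2))"
  have C0: "0 < C0" using \<epsilon> F(1) by (simp add: C0_def add_nonneg_pos)
  have "\<forall>\<^sub>F J in sequentially. \<exists>D\<in>sets M. prob D < \<epsilon> \<and> (\<forall>\<omega>\<in>space M - D. \<bar>avg (\<phi> J) J \<omega> - mean (\<phi> J) J\<bar> \<le> C * rate J)"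
    if C: "C \<ge> C0" for C
    using ev h_le_1 eventually_ge_at_top[of 1]
  proof eventually_elim
    case (elim J)
    have [measurable]: "avg (\<phi> J) J \<in> borel_measurable M" using \<phi> by (rule avg_meas)
    have "prob {\<omega> \<in> space M. C * rate J \<le> \<bar>avg (\<phi> J) J \<omega> - mean (\<phi> J) J\<bar>} \<le> 4 * B\<^sup>2 * F / C\<^sup>2"
      using elim C C0 F(2)[OF elim(2)] by (intro avg_deviation \<phi>) auto
    also have "\<dots> \<le> 4 * B\<^sup>2 * F / C0\<^sup>2"
      using C C0 F(1) by (intro divide_left_mono power_mono mult_pos_pos zero_less_power) auto
    also have "\<dots> \<le> \<epsilon> / 2"
      using \<epsilon> F(1) by (simp add: C0_def divide_le_eq add_nonneg_pos)
    also have "\<dots> < \<epsilon>" using \<epsilon> by simp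
    finally show ?case
      by (intro bexI[of _ "{\<omega> \<in> space M. C * rate J \<le> \<bar>avg (\<phi> J) J \<omega> - mean (\<phi> J) J\<bar>}"]) auto
  qed
  then show "\<exists>C0. \<forall>C\<ge>C0. \<forall>\<^sub>F J in sequentially. \<exists>D\<in>sets M. prob D < \<epsilon> \<and>
      (\<forall>\<omega>\<in>space M - D. \<bar>avg (\<phi> J) J \<omega> - mean (\<phi> J) J\<bar> \<le> C * rate J)" by blast
qed

lemma f_lower: "\<forall>\<^sub>F J in sequentially. \<forall>t. \<bar>t\<bar> \<le> 2 \<longrightarrow> f x / 2 \<le> f (x + h J * t)"
proof -
  have "isCont f x" using f_cont by (simp add: continuous_on_eq_continuous_at)
  then have "\<exists>d>0. \<forall>y. dist y x < d \<longrightarrow> dist (f y) (f x) < f x / 2"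
    using fx unfolding continuous_at_eps_delta by (metis half_gt_zero)
  then obtain d where d: "d > 0" "\<And>y. dist y x < d \<Longrightarrow> dist (f y) (f x) < f x / 2" by blast
  have "\<forall>\<^sub>F J in sequentially. h J < d / 2" using d(1) by (intro order_tendstoD(2)[OF h_lim]) simp
  then show ?thesis
  proof (eventually_elim, intro allI impI)
    fix J t assume J: "h J < d / 2" and t: "\<bar>t\<bar> \<le> (2::real)"
    have "\<bar>h J * t\<bar> \<le> h J * 2" unfolding abs_mult using t h_pos[of J] by (intro mult_mono) auto
    then have "dist (x + h J * t) x < d" using J by (simp add: dist_real_def)
    from d(2)[OF this] show "f x / 2 \<le> f (x + h J * t)" by (simp add: dist_real_def abs_if split: if_splits)
  qed
qed

text \<open>The count equals N h times an average whose mean stays above a positive constant. Since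
  N h tends to infinity, it eventually exceeds c.\<close>

lemma whp_count:
  fixes a b :: real
  assumes ab: "a < b" "-2 \<le> a" "b \<le> 2"
  shows "whp M (\<lambda>C J \<omega>. c \<le> card {i. i < c * J \<and> (X i \<omega> - x) / h J \<in> {a<..<b}})"
proof -
  define \<phi> :: "real \<Rightarrow> real" where "\<phi> = indicator {a<..<b}"
  have [measurable]: "\<phi> \<in> borel_measurable borel" unfolding \<phi>_def by measurable
  have van: "2 < \<bar>t\<bar> \<Longrightarrow> \<phi> t = 0" and le1: "\<bar>\<phi> t\<bar> \<le> 1" for t using ab by (auto simp: \<phi>_def indicator_def)
  \<comment> \<open>The length of (a, b) times f(x)/2, the latter being a lower bound for the
    density on the shrinking window.\<close>
  define d where "d = (b - a) * f x / 2"
  have d: "0 < d" using ab fx by (simp add: d_def)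
  have mean: "\<forall>\<^sub>F J in sequentially. d \<le> mean \<phi> J"
    using f_lower h_le_1
  proof eventually_elim
    case (elim J)
    obtain F where F: "0 \<le> F" "\<And>t J. h J \<le> 1 \<Longrightarrow> \<bar>t\<bar> \<le> 2 \<Longrightarrow> \<bar>f (x + h J * t)\<bar> \<le> F" by (rule f_window) blast
    have "integrable lborel (\<lambda>t. \<phi> t * f (x + h J * t))"
      by (rule compact_kernel_integral(1)[of _ _ 1 F]) (use van le1 F(2)[OF elim(2)] in auto)
    then have "(\<integral>t. f x / 2 * indicator {a<..<b} t \<partial>lborel) \<le> mean \<phi> J"
      unfolding mean_def
    proof (intro integral_mono)
      fix t show "f x / 2 * indicator {a<..<b} t \<le> \<phi> t * f (x + h J * t)"
        using elim(1)[rule_format, of t] ab by (auto simp: \<phi>_def indicator_def)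
    qed (use ab in auto)
    then show ?case using ab by (simp add: d_def mult.commute)
  qed
  have "whp M (\<lambda>C J \<omega>. \<bar>avg \<phi> J \<omega> - mean \<phi> J\<bar> \<le> C * rate J)"
    by (rule whp_avg[of "\<lambda>_. \<phi>" 1]) (use van le1 in auto)
  then show ?thesis
  proof (rule whp_mono, goal_cases)
    case (1 C)
    have "(\<lambda>J. C * rate J) \<longlonglongrightarrow> C * 0" by (intro tendsto_intros rate_lim)
    then have 1: "\<forall>\<^sub>F J in sequentially. C * rate J < d / 2" using d by (intro order_tendstoD(2)) auto
    have 2: "\<forall>\<^sub>F J in sequentially. real c / (d / 2) \<le> real (c * J) * h J"
      using cJh_at_top by (simp add: filterlim_at_top)
    have "\<forall>\<^sub>F J in sequentially. \<forall>\<omega>\<in>space M. \<bar>avg \<phi> J \<omega> - mean \<phi> J\<bar> \<le> C * rate J \<longrightarrow>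
        c \<le> card {i. i < c * J \<and> (X i \<omega> - x) / h J \<in> {a<..<b}}"
      using 1 2 mean eventually_ge_at_top[of 1]
    proof (eventually_elim, intro ballI impI)
      fix J \<omega> assume J: "C * rate J < d / 2" "real c / (d / 2) \<le> real (c * J) * h J" "d \<le> mean \<phi> J" "1 \<le> J"
        and *: "\<bar>avg \<phi> J \<omega> - mean \<phi> J\<bar> \<le> C * rate J"
      have "d / 2 \<le> avg \<phi> J \<omega>" using J(1,3) * by linarith
      moreover have "0 < real (c * J) * h J" using J(4) c1 h_pos[of J] by simp
      moreover have "(\<Sum>i<c * J. \<phi> ((X i \<omega> - x) / h J)) = real (card {i. i < c * J \<and> (X i \<omega> - x) / h J \<in> {a<..<b}})"
        unfolding \<phi>_def indicator_def by (subst sum_of_bool_eq) (auto intro!: arg_cong[where f=card])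
      ultimately have "d / 2 * (real (c * J) * h J) \<le> real (card {i. i < c * J \<and> (X i \<omega> - x) / h J \<in> {a<..<b}})"
        by (simp add: avg_def pos_le_divide_eq)
      moreover have "real c \<le> d / 2 * (real (c * J) * h J)" using J(2) d by (simp add: field_simps)
      ultimately show "c \<le> card {i. i < c * J \<and> (X i \<omega> - x) / h J \<in> {a<..<b}}" by linarith
    qed
    then show ?case by blast
  qed
qed

lemma whp_pools_local: "whp M (\<lambda>C J \<omega>. pools_local (\<lambda>i. X i \<omega>) c J x (h J))"
  unfolding pools_local_def by (intro whp_conj whp_count) auto

text \<open>The conditional variance is bounded pointwise by the squared rate times a local average
  of bounded expectation, so the unconditional second moment has the order of the squared rate. The
  absolute value is there because \<open>\<sigma>2\<close> is nonnegative only at almost every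
  covariate.\<close>

lemma whp_noise:
  fixes \<gamma> :: "nat \<Rightarrow> nat \<Rightarrow> (nat \<Rightarrow> real) \<Rightarrow> real"
  assumes \<gamma>: "\<And>J i. i < c * J \<Longrightarrow> \<gamma> J i \<in> borel_measurable (PiM {..<c * J} (\<lambda>_. borel))"
    and bd: "\<forall>\<^sub>F J in sequentially. \<forall>\<omega>\<in>space M. (\<Sum>i<c * J. (\<gamma> J i (covariates (c * J) \<omega>))\<^sup>2 * \<bar>\<sigma>2 (X i \<omega>)\<bar>)
      \<le> D * rate J ^ 2 * avg (indicator {-2..2}) J \<omega>"
  shows "whp M (\<lambda>C J \<omega>. \<bar>\<Sum>i<c * J. \<gamma> J i (covariates (c * J) \<omega>) * (Y i \<omega> - m (X i \<omega>))\<bar> \<le> C * rate J)"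
  unfolding whp_def
proof (intro allI impI)
  fix \<epsilon> :: real assume \<epsilon>: "\<epsilon> > 0"
  obtain F where F: "0 \<le> F" "\<And>t J. h J \<le> 1 \<Longrightarrow> \<bar>t\<bar> \<le> 2 \<Longrightarrow> \<bar>f (x + h J * t)\<bar> \<le> F" by (rule f_window) blast
  define Z where "Z J \<omega> = (\<Sum>i<c * J. \<gamma> J i (covariates (c * J) \<omega>) * (Y i \<omega> - m (X i \<omega>)))" for J \<omega>
  have Z_meas [measurable]: "Z J \<in> borel_measurable M" for J
    unfolding Z_def
  proof (intro borel_measurable_sum borel_measurable_times)
    fix i assume "i \<in> {..<c * J}"
    then show "(\<lambda>\<omega>. \<gamma> J i (covariates (c * J) \<omega>)) \<in> borel_measurable M"
      using measurable_compose[OF covariates_meas \<gamma>] by auto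
  qed measurable
  define \<phi> :: "real \<Rightarrow> real" where "\<phi> = indicator {-2..2}"
  have \<phi>_meas [measurable]: "\<phi> \<in> borel_measurable borel" by (simp add: \<phi>_def)
  \<comment> \<open>The factor \<open>4 * F\<close> bounds the expectation of the average of the
    window indicator.\<close>
  define D' where "D' = \<bar>D\<bar> * (4 * F)"
  have D': "0 \<le> D'" using F(1) by (simp add: D'_def)
  have moment: "\<forall>\<^sub>F J in sequentially. integrable M (\<lambda>\<omega>. (Z J \<omega>)\<^sup>2) \<and> expectation (\<lambda>\<omega>. (Z J \<omega>)\<^sup>2) \<le> D' * rate J ^ 2"
    using bd h_le_1 eventually_ge_at_top[of 1]
  proof eventually_elim
    case (elim J)
    have N: "1 \<le> c * J" using elim(3) c1 by simp
    have avg0: "0 \<le> avg \<phi> J \<omega>" for \<omega>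
      using h_pos[of J] by (auto simp: avg_def \<phi>_def intro!: divide_nonneg_nonneg sum_nonneg)
    have int: "integrable M (\<lambda>\<omega>. \<phi> ((X i \<omega> - x) / h J))" for i
      by (rule integrable_const_bound[of _ 1]) (auto simp: \<phi>_def indicator_def)
    have int_avg: "integrable M (avg \<phi> J)"
      unfolding avg_def using int by (intro Bochner_Integration.integrable_divide Bochner_Integration.integrable_sum) auto
    have "expectation (avg \<phi> J) = (\<Sum>i<c * J. h J * mean \<phi> J) / (real (c * J) * h J)"
      unfolding avg_def mean_def using int expectation_scaled[of \<phi>, OF _ h_pos] by simp
    also have "\<dots> = mean \<phi> J" using N h_pos[of J] by simp
    also have "\<dots> \<le> 4 * 1 * F"
      unfolding mean_def
      by (rule order_trans[OF abs_ge_self compact_kernel_integral(2)])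
        (use F(2)[OF elim(2)] in \<open>auto simp: \<phi>_def indicator_def\<close>)
    finally have E_avg: "expectation (avg \<phi> J) \<le> 4 * F" by simp
    have "(\<integral>\<^sup>+\<omega>. ennreal ((Z J \<omega>)\<^sup>2) \<partial>M)
        = (\<integral>\<^sup>+\<omega>. (\<Sum>i<c * J. ennreal ((\<gamma> J i (covariates (c * J) \<omega>))\<^sup>2) * ennreal (\<sigma>2 (X i \<omega>))) \<partial>M)"
      unfolding Z_def using \<gamma> by (intro second_moment N) auto
    also have "\<dots> \<le> (\<integral>\<^sup>+\<omega>. ennreal (\<bar>D\<bar> * rate J ^ 2 * avg \<phi> J \<omega>) \<partial>M)"
    proof (rule nn_integral_mono)
      fix \<omega> assume \<omega>: "\<omega> \<in> space M"
      have "(\<Sum>i<c * J. ennreal ((\<gamma> J i (covariates (c * J) \<omega>))\<^sup>2) * ennreal (\<sigma>2 (X i \<omega>)))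
          \<le> (\<Sum>i<c * J. ennreal ((\<gamma> J i (covariates (c * J) \<omega>))\<^sup>2 * \<bar>\<sigma>2 (X i \<omega>)\<bar>))"
        by (intro sum_mono) (auto simp: ennreal_mult intro!: mult_left_mono ennreal_leI)
      also have "\<dots> = ennreal (\<Sum>i<c * J. (\<gamma> J i (covariates (c * J) \<omega>))\<^sup>2 * \<bar>\<sigma>2 (X i \<omega>)\<bar>)"
        by (intro sum_ennreal) auto
      also have "\<dots> \<le> ennreal (\<bar>D\<bar> * rate J ^ 2 * avg \<phi> J \<omega>)"
      proof (rule ennreal_leI)
        have "D * rate J ^ 2 * avg \<phi> J \<omega> \<le> \<bar>D\<bar> * rate J ^ 2 * avg \<phi> J \<omega>"
          using avg0 by (intro mult_right_mono) auto
        then show "(\<Sum>i<c * J. (\<gamma> J i (covariates (c * J) \<omega>))\<^sup>2 * \<bar>\<sigma>2 (X i \<omega>)\<bar>) \<le> \<bar>D\<bar> * rate J ^ 2 * avg \<phi> J \<omega>"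
          using elim(1) \<omega> unfolding \<phi>_def by force
      qed
      finally show "(\<Sum>i<c * J. ennreal ((\<gamma> J i (covariates (c * J) \<omega>))\<^sup>2) * ennreal (\<sigma>2 (X i \<omega>)))
          \<le> ennreal (\<bar>D\<bar> * rate J ^ 2 * avg \<phi> J \<omega>)" .
    qed
    also have "\<dots> = ennreal (\<bar>D\<bar> * rate J ^ 2 * expectation (avg \<phi> J))"
      using int_avg avg0 by (subst nn_integral_eq_integral) auto
    also have "\<dots> \<le> ennreal (D' * rate J ^ 2)"
      using mult_left_mono[OF E_avg, of "\<bar>D\<bar> * rate J ^ 2"] by (intro ennreal_leI) (simp add: D'_def mult_ac)
    finally have nn: "(\<integral>\<^sup>+\<omega>. ennreal ((Z J \<omega>)\<^sup>2) \<partial>M) \<le> ennreal (D' * rate J ^ 2)" .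
    have I: "integrable M (\<lambda>\<omega>. (Z J \<omega>)\<^sup>2)"
      using order.strict_trans1[OF nn, of \<infinity>] by (intro integrableI_bounded) auto
    moreover have "expectation (\<lambda>\<omega>. (Z J \<omega>)\<^sup>2) \<le> D' * rate J ^ 2"
      using nn nn_integral_eq_integral[OF I] D' by (simp add: ennreal_le_iff)
    ultimately show ?case by simp
  qed
  define C0 where "C0 = sqrt ((D' + 1) / (\<epsilon> / 2))"
  have C0: "0 < C0" using \<epsilon> D' by (simp add: C0_def add_nonneg_pos)
  have "\<forall>\<^sub>F J in sequentially. \<exists>E\<in>sets M. prob E < \<epsilon> \<and> (\<forall>\<omega>\<in>space M - E. \<bar>Z J \<omega>\<bar> \<le> C * rate J)"
    if C: "C \<ge> C0" for C
    using moment eventually_ge_at_top[of 1]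
  proof eventually_elim
    case (elim J)
    have Cp: "0 < C" using C C0 by simp
    have r: "0 < rate J" using elim(2) c1 h_pos[of J] by (simp add: rate_def)
    have "prob {\<omega> \<in> space M. (Z J \<omega>)\<^sup>2 \<ge> (C * rate J)\<^sup>2} \<le> expectation (\<lambda>\<omega>. (Z J \<omega>)\<^sup>2) / (C * rate J)\<^sup>2"
      using elim(1) Cp r by (intro integral_Markov_inequality_measure[where A="space M"]) auto
    also have "\<dots> \<le> (D' * rate J ^ 2) / (C * rate J)\<^sup>2"
      using elim(1) by (intro divide_right_mono) auto
    also have "\<dots> = D' / C\<^sup>2" using r Cp by (simp add: field_simps)
    also have "\<dots> \<le> D' / C0\<^sup>2"
      using C C0 D' by (intro divide_left_mono power_mono mult_pos_pos zero_less_power) auto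
    also have "\<dots> \<le> \<epsilon> / 2"
      using \<epsilon> D' by (simp add: C0_def divide_le_eq add_nonneg_pos)
    also have "\<dots> < \<epsilon>" using \<epsilon> by simp
    finally have "prob {\<omega> \<in> space M. (Z J \<omega>)\<^sup>2 \<ge> (C * rate J)\<^sup>2} < \<epsilon>" .
    moreover have "\<bar>Z J \<omega>\<bar> \<le> C * rate J" if "\<not> (C * rate J)\<^sup>2 \<le> (Z J \<omega>)\<^sup>2" for \<omega>
      using that Cp r by (simp add: abs_le_square_iff[symmetric] not_le)
    ultimately show ?case
      by (intro bexI[of _ "{\<omega> \<in> space M. (Z J \<omega>)\<^sup>2 \<ge> (C * rate J)\<^sup>2}"]) auto
  qed
  then show "\<exists>C0. \<forall>C\<ge>C0. \<forall>\<^sub>F J in sequentially. \<exists>E\<in>sets M. prob E < \<epsilon> \<and>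
      (\<forall>\<omega>\<in>space M - E. \<bar>\<Sum>i<c * J. \<gamma> J i (covariates (c * J) \<omega>) * (Y i \<omega> - m (X i \<omega>))\<bar> \<le> C * rate J)"
    unfolding Z_def by blast
qed

end


section \<open>The estimator as a linear function of the responses\<close>

definition gram_mat :: "nat \<Rightarrow> real \<Rightarrow> (nat \<Rightarrow> real) \<Rightarrow> nat \<Rightarrow> nat \<Rightarrow> (nat \<Rightarrow> real) \<Rightarrow> real mat" where
  "gram_mat p x xs c J w = (design p x xs c J)\<^sup>T * mat_diag J w * design p x xs c J"

text \<open>The coefficient of the pooled response j in the estimator: row 0 of the inverse Gram
  matrix times column j of the transposed weighted design.\<close>

definition wls_coef :: "nat \<Rightarrow> real \<Rightarrow> (nat \<Rightarrow> real) \<Rightarrow> nat \<Rightarrow> nat \<Rightarrow> (nat \<Rightarrow> real) \<Rightarrow> nat \<Rightarrow> real" where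
  "wls_coef p x xs c J w j = w j * (\<Sum>l<p + 1. mat_inv (gram_mat p x xs c J w) $$ (0, l) * design p x xs c J $$ (j, l))"

lemma design_carrier [simp]: "design p x xs c J \<in> carrier_mat J (Suc p)"
  by (simp add: design_def)

lemma design_entry:
  "j < J \<Longrightarrow> l < p + 1 \<Longrightarrow> design p x xs c J $$ (j, l) = (\<Sum>k<c. (pool_cov xs c J j k - x) ^ l) / real c"
  by (simp add: design_def)

lemma gram_mat_carrier [simp]: "gram_mat p x xs c J w \<in> carrier_mat (Suc p) (Suc p)"
  unfolding gram_mat_def by (intro mult_carrier_mat[of _ _ J] transpose_carrier_mat[THEN iffD2]) auto

lemma gram_mat_entry:
  assumes "l < p + 1" "l' < p + 1"
  shows "gram_mat p x xs c J w $$ (l, l')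
    = (\<Sum>j<J. w j * design p x xs c J $$ (j, l) * design p x xs c J $$ (j, l'))"
proof -
  define D where "D = design p x xs c J"
  have D: "D \<in> carrier_mat J (p + 1)" by (simp add: D_def)
  have "gram_mat p x xs c J w = D\<^sup>T * (mat_diag J w * D)"
    unfolding gram_mat_def D_def by (intro assoc_mult_mat[of _ "p + 1" J _ J _ "p + 1"]) auto
  also have "mat_diag J w * D = Matrix.mat J (p + 1) (\<lambda>(i, j). w i * D $$ (i, j))"
    by (rule mat_diag_mult_left[OF D])
  finally show ?thesis
    using assms D unfolding D_def[symmetric]
    by (simp add: scalar_prod_def atLeast0LessThan mult_ac)
qed

lemma mat_inv_carrier:
  assumes A: "A \<in> carrier_mat n n"
  shows "mat_inv A \<in> carrier_mat n n"
  using mat_inv_nonsing(1)[OF A] mat_inv_sing[OF A] by (cases "Determinant.det A = 0") auto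

lemma wls_intercept_linear:
  "wls_intercept p x xs ys c J w = (\<Sum>j<J. wls_coef p x xs c J w j * pool_response xs ys c J j)"
proof -
  define n where "n = p + 1"
  define D where "D = design p x xs c J"
  define S where "S = mat_inv (gram_mat p x xs c J w)"
  define Z where "Z = Matrix.vec J (pool_response xs ys c J)"
  have D: "D \<in> carrier_mat J n" by (simp add: D_def n_def)
  have S: "S \<in> carrier_mat n n" unfolding S_def n_def by (intro mat_inv_carrier) simp
  have Z: "Z \<in> carrier_vec J" by (simp add: Z_def)
  have n0: "0 < n" by (simp add: n_def)
  have WZ: "(mat_diag J w *\<^sub>v Z) $ j = w j * pool_response xs ys c J j" if "j < J" for j
    using that by (simp add: mat_diag_def Z_def scalar_prod_def atLeast0LessThan if_distrib[of "\<lambda>a. a * _"] cong: if_cong)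
  have WZ_c: "mat_diag J w *\<^sub>v Z \<in> carrier_vec J"
    by (intro mult_mat_vec_carrier[OF _ Z]) (simp add: mat_diag_def)
  have u: "D\<^sup>T *\<^sub>v (mat_diag J w *\<^sub>v Z) \<in> carrier_vec n"
    using D by (intro mult_mat_vec_carrier[OF _ WZ_c]) auto
  have u_entry: "(D\<^sup>T *\<^sub>v (mat_diag J w *\<^sub>v Z)) $ l = (\<Sum>j<J. D $$ (j, l) * (w j * pool_response xs ys c J j))" if "l < n" for l
  proof -
    have "(D\<^sup>T *\<^sub>v v) $ l = (\<Sum>j<J. D $$ (j, l) * v $ j)" if "v \<in> carrier_vec J" for v
      using D \<open>l < n\<close> that by (simp add: scalar_prod_def atLeast0LessThan)
    from this[OF WZ_c] show ?thesis using WZ by simp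
  qed
  have "wls_intercept p x xs ys c J w = unit_vec n 0 \<bullet> (S *\<^sub>v (D\<^sup>T *\<^sub>v (mat_diag J w *\<^sub>v Z)))"
    by (simp add: wls_intercept_def Let_def S_def gram_mat_def D_def Z_def n_def)
  also have "\<dots> = (S *\<^sub>v (D\<^sup>T *\<^sub>v (mat_diag J w *\<^sub>v Z))) $ 0"
    using n0 mult_mat_vec_carrier[OF S u] by (intro scalar_prod_left_unit)
  also have "\<dots> = (\<Sum>l<n. S $$ (0, l) * (D\<^sup>T *\<^sub>v (mat_diag J w *\<^sub>v Z)) $ l)"
  proof -
    have "(S *\<^sub>v (D\<^sup>T *\<^sub>v (mat_diag J w *\<^sub>v Z))) $ 0 = Matrix.row S 0 \<bullet> (D\<^sup>T *\<^sub>v (mat_diag J w *\<^sub>v Z))"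
      using S n0 by (intro index_mult_mat_vec) simp
    also have "\<dots> = (\<Sum>l<n. Matrix.row S 0 $ l * (D\<^sup>T *\<^sub>v (mat_diag J w *\<^sub>v Z)) $ l)"
      unfolding scalar_prod_def using carrier_vecD[OF u] by (simp only: atLeast0LessThan)
    also have "\<dots> = (\<Sum>l<n. S $$ (0, l) * (D\<^sup>T *\<^sub>v (mat_diag J w *\<^sub>v Z)) $ l)"
      using S n0 by (intro sum.cong) auto
    finally show ?thesis .
  qed
  also have "\<dots> = (\<Sum>l<n. S $$ (0, l) * (\<Sum>j<J. D $$ (j, l) * (w j * pool_response xs ys c J j)))"
    using u_entry by (intro sum.cong) auto
  also have "\<dots> = (\<Sum>j<J. wls_coef p x xs c J w j * pool_response xs ys c J j)"
    unfolding wls_coef_def S_def[symmetric] D_def[symmetric] n_def[symmetric] sum_distrib_left sum_distrib_right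
    by (subst sum.swap) (simp add: mult_ac)
  finally show ?thesis .
qed

text \<open>The coefficient that individual i receives when the pool averages are combined with
  weights a. The sum over all positions, of which exactly one matches, avoids inverting the sorting
  permutation and keeps measurability immediate.\<close>

definition spread_coef :: "(nat \<Rightarrow> real) \<Rightarrow> nat \<Rightarrow> nat \<Rightarrow> (nat \<Rightarrow> real) \<Rightarrow> nat \<Rightarrow> real" where
  "spread_coef xs c J a i = (\<Sum>j<J. \<Sum>k<c. if pool_member xs c J j k = i then a j / real c else 0)"

lemma sum_spread_coef:
  "(\<Sum>i<c * J. spread_coef xs c J a i * y i) = (\<Sum>j<J. a j * ((\<Sum>k<c. y (pool_member xs c J j k)) / real c))"
proof -
  have "(\<Sum>i<c * J. spread_coef xs c J a i * y i)
      = (\<Sum>j<J. \<Sum>i<c * J. (\<Sum>k<c. if pool_member xs c J j k = i then a j / real c else 0) * y i)"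
    unfolding spread_coef_def sum_distrib_right[where A="{..<J}"] by (rule sum.swap)
  also have "\<dots> = (\<Sum>j<J. \<Sum>k<c. \<Sum>i<c * J. (if pool_member xs c J j k = i then a j / real c else 0) * y i)"
    unfolding sum_distrib_right by (intro sum.cong refl sum.swap)
  also have "\<dots> = (\<Sum>j<J. \<Sum>k<c. a j / real c * y (pool_member xs c J j k))"
  proof (intro sum.cong refl)
    fix j k assume "j \<in> {..<J}" "k \<in> {..<c}"
    then have "pool_member xs c J j k < c * J" by (intro pool_member_less) auto
    then show "(\<Sum>i<c * J. (if pool_member xs c J j k = i then a j / real c else 0) * y i)
        = a j / real c * y (pool_member xs c J j k)"
      by (subst sum.cong[OF refl, of _ _ "\<lambda>i. if pool_member xs c J j k = i then a j / real c * y i else 0"])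
        (auto simp: sum.delta)
  qed
  also have "\<dots> = (\<Sum>j<J. a j * ((\<Sum>k<c. y (pool_member xs c J j k)) / real c))"
    by (simp add: sum_distrib_left sum_divide_distrib)
  finally show ?thesis .
qed

lemma pool_member_inject:
  assumes "j < J" "k < c" "j' < J" "k' < c" and eq: "pool_member xs c J j k = pool_member xs c J j' k'"
  shows "j = j' \<and> k = k'"
proof -
  have "j * c + k = j' * c + k'"
    using eq pool_index_less[OF assms(1,2)] pool_index_less[OF assms(3,4)]
    unfolding pool_member_def by (subst (asm) nth_eq_iff_index_eq) auto
  moreover have "(i * c + n) div c = i" "(i * c + n) mod c = n" if "n < c" for i n
    using that by auto
  ultimately show ?thesis using assms by metis
qed

lemma spread_coef_member:
  assumes jk: "j < J" "k < c"
  shows "spread_coef xs c J a (pool_member xs c J j k) = a j / real c"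
proof -
  have "spread_coef xs c J a (pool_member xs c J j k)
      = (\<Sum>j'<J. \<Sum>k'<c. if j' = j then (if k' = k then a j / real c else 0) else 0)"
    unfolding spread_coef_def using jk pool_member_inject[of _ J _ c j k xs] by (intro sum.cong refl) auto
  also have "\<dots> = (\<Sum>j'<J. if j' = j then (\<Sum>k'<c. if k' = k then a j / real c else 0) else 0)"
    by (intro sum.cong refl) auto
  also have "\<dots> = a j / real c" using jk by (simp add: sum.delta)
  finally show ?thesis .
qed

text \<open>Squaring creates no mixed terms because each individual occupies exactly one position of
  one pool.\<close>

lemma sum_spread_coef_sq:
  "(\<Sum>i<c * J. (spread_coef xs c J a i)\<^sup>2 * s i) = (\<Sum>j<J. (a j / real c)\<^sup>2 * (\<Sum>k<c. s (pool_member xs c J j k)))"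
  by (subst sum_pool_members[symmetric, of _ _ _ xs]) (simp add: spread_coef_member sum_distrib_left)

lemma pool_cov_cong:
  assumes "\<And>i. i < c * J \<Longrightarrow> xs i = ys i" "j < J" "k < c"
  shows "pool_cov xs c J j k = pool_cov ys c J j k"
  using assms pool_member_cong[of c J xs ys] pool_member_less[of j J k c ys] by (simp add: pool_cov_def)

lemma design_cong:
  assumes "\<And>i. i < c * J \<Longrightarrow> xs i = ys i"
  shows "design p x xs c J = design p x ys c J"
  unfolding design_def using pool_cov_cong[OF assms] by (intro cong_mat) auto

lemma wls_coef_cong:
  assumes "\<And>i. i < c * J \<Longrightarrow> xs i = ys i" "\<And>j. j < J \<Longrightarrow> w j = w' j" "j < J"
  shows "wls_coef p x xs c J w j = wls_coef p x ys c J w' j"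
proof -
  have "mat_diag J w = mat_diag J w'"
    unfolding mat_diag_def using assms(2) by (intro cong_mat) auto
  then have "gram_mat p x xs c J w = gram_mat p x ys c J w'"
    unfolding gram_mat_def using design_cong[OF assms(1)] by simp
  then show ?thesis
    unfolding wls_coef_def using design_cong[OF assms(1)] assms(2,3) by simp
qed

lemma spread_coef_cong:
  assumes "\<And>i. i < c * J \<Longrightarrow> xs i = ys i" "\<And>j. j < J \<Longrightarrow> a j = b j"
  shows "spread_coef xs c J a i = spread_coef ys c J b i"
proof -
  have "pool_member xs c J = pool_member ys c J" using assms(1) by (rule pool_member_cong)
  then show ?thesis unfolding spread_coef_def using assms(2) by (intro sum.cong) auto
qed

lemma spread_coef_measurable:
  fixes X :: "nat \<Rightarrow> 'a \<Rightarrow> real"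
  assumes X: "\<And>i. i < c * J \<Longrightarrow> X i \<in> borel_measurable N"
    and a: "\<And>j. j < J \<Longrightarrow> a j \<in> borel_measurable N"
  shows "(\<lambda>\<omega>. spread_coef (\<lambda>i. X i \<omega>) c J (\<lambda>j. a j \<omega>) i) \<in> borel_measurable N"
  unfolding spread_coef_def
proof (intro borel_measurable_sum)
  fix j k assume "j \<in> {..<J}"
  then have [measurable]: "a j \<in> borel_measurable N" using a by simp
  have [measurable]: "(\<lambda>\<omega>. pool_member (\<lambda>i. X i \<omega>) c J j k) \<in> measurable N (count_space UNIV)"
    using X by (rule measurable_pool_member)
  show "(\<lambda>\<omega>. if pool_member (\<lambda>i. X i \<omega>) c J j k = i then a j \<omega> / real c else 0) \<in> borel_measurable N"
    by measurable
qed

lemma pool_cov_measurable: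
  fixes X :: "nat \<Rightarrow> 'a \<Rightarrow> real"
  assumes X: "\<And>i. i < c * J \<Longrightarrow> X i \<in> borel_measurable N" and "j < J" "k < c"
  shows "(\<lambda>\<omega>. pool_cov (\<lambda>i. X i \<omega>) c J j k) \<in> borel_measurable N"
  unfolding pool_cov_def using X X assms(2,3) by (rule measurable_pool_select)

lemma wls_coef_measurable:
  fixes X :: "nat \<Rightarrow> 'a \<Rightarrow> real"
  assumes X: "\<And>i. i < c * J \<Longrightarrow> X i \<in> borel_measurable N"
    and w: "\<And>j. j < J \<Longrightarrow> w j \<in> borel_measurable N" and j: "j < J"
  shows "(\<lambda>\<omega>. wls_coef p x (\<lambda>i. X i \<omega>) c J (\<lambda>j. w j \<omega>) j) \<in> borel_measurable N"
proof -
  have d: "(\<lambda>\<omega>. design p x (\<lambda>i. X i \<omega>) c J $$ (j, l)) \<in> borel_measurable N" if "j < J" "l < p + 1" for j l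
    unfolding design_entry[OF that] using that pool_cov_measurable[of c J X N, OF X]
    by (intro borel_measurable_divide borel_measurable_sum borel_measurable_power borel_measurable_diff) auto
  have "(\<lambda>\<omega>. mat_inv (gram_mat p x (\<lambda>i. X i \<omega>) c J (\<lambda>j. w j \<omega>)) $$ (0, l)) \<in> borel_measurable N" if "l < p + 1" for l
  proof (rule measurable_mat_inv[of _ "p + 1"])
    fix i k assume "i < p + 1" "k < p + 1"
    then show "(\<lambda>\<omega>. gram_mat p x (\<lambda>i. X i \<omega>) c J (\<lambda>j. w j \<omega>) $$ (i, k)) \<in> borel_measurable N"
      using d w by (simp only: gram_mat_entry) (intro borel_measurable_sum borel_measurable_times, auto)
  qed (use that in auto)
  then show ?thesis
    unfolding wls_coef_def using d w j
    by (intro borel_measurable_times borel_measurable_sum) auto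
qed


section \<open>Kernel averages of pools\<close>

definition bounded_on_window :: "(real \<Rightarrow> real) \<Rightarrow> bool" where
  "bounded_on_window a \<longleftrightarrow> (\<exists>D. \<forall>t. \<bar>t\<bar> \<le> 2 \<longrightarrow> \<bar>a t\<bar> \<le> D)"

lemma bounded_on_window_monomial: "bounded_on_window (\<lambda>t. k * t ^ l)"
  unfolding bounded_on_window_def
proof (intro exI allI impI)
  fix t :: real assume "\<bar>t\<bar> \<le> 2"
  then have "\<bar>t\<bar> ^ l \<le> 2 ^ l" by (rule power_mono) simp
  then show "\<bar>k * t ^ l\<bar> \<le> \<bar>k\<bar> * 2 ^ l" by (simp add: abs_mult power_abs mult_left_mono)
qed

definition pow_avg :: "nat \<Rightarrow> nat \<Rightarrow> (nat \<Rightarrow> real) \<Rightarrow> real" where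
  "pow_avg c l u = (\<Sum>k<c. u k ^ l) / real c"

context pooled_asymptotics
begin

text \<open>The first-order expansions of w and of the density are multiplied and integrated term by
  term. The error is uniform on the window that carries the kernel, so it integrates to
  \<open>4 * B * C\<close> times h^2.\<close>

lemma mean_expansion:
  fixes w :: "real \<Rightarrow> real \<Rightarrow> real" and a0 a1 \<phi> :: "real \<Rightarrow> real"
  assumes \<phi> [measurable]: "\<phi> \<in> borel_measurable borel"
    and van: "\<And>t. 2 < \<bar>t\<bar> \<Longrightarrow> \<phi> t = 0" and B: "\<And>t. \<bar>\<phi> t\<bar> \<le> B"
    and [measurable]: "\<And>H. w H \<in> borel_measurable borel" "a0 \<in> borel_measurable borel" "a1 \<in> borel_measurable borel"
    and w: "quadratic_error (\<lambda>H t. w H t - (a0 t + H * a1 t))"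
    and bd: "bounded_on_window a0" "bounded_on_window a1"
  shows "\<exists>C\<ge>0. \<forall>\<^sub>F J in sequentially. \<bar>mean (\<lambda>t. \<phi> t * w (h J) t) J
     - (f x * (\<integral>t. \<phi> t * a0 t \<partial>lborel)
        + h J * (f x * (\<integral>t. \<phi> t * a1 t \<partial>lborel) + deriv f x * (\<integral>t. \<phi> t * (t * a0 t) \<partial>lborel)))\<bar> \<le> C * h J ^ 2"
proof -
  obtain D0 where D0: "\<And>t. \<bar>t\<bar> \<le> 2 \<Longrightarrow> \<bar>a0 t\<bar> \<le> D0" using bd(1) unfolding bounded_on_window_def by blast
  obtain D1 where D1: "\<And>t. \<bar>t\<bar> \<le> 2 \<Longrightarrow> \<bar>a1 t\<bar> \<le> D1" using bd(2) unfolding bounded_on_window_def by blast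
  define D where "D = max (max D0 D1) (max \<bar>f x\<bar> (2 * \<bar>deriv f x\<bar>))"
  have d1: "\<bar>deriv f x * t\<bar> \<le> 2 * \<bar>deriv f x\<bar>" if "\<bar>t\<bar> \<le> 2" for t
    using mult_left_mono[OF that, of "\<bar>deriv f x\<bar>"] by (simp add: abs_mult mult.commute)
  have "quadratic_error (\<lambda>H t. w H t * f (x + H * t) - (a0 t * f x + H * (a0 t * (deriv f x * t) + a1 t * f x)))"
    by (rule product_expansion[OF w linear_expansion[OF f_smooth], of D])
      (auto simp: D_def intro: order_trans[OF D0] order_trans[OF D1] order_trans[OF d1])
  then obtain C where C: "0 \<le> C" "\<And>H t. 0 < H \<Longrightarrow> H \<le> 1 \<Longrightarrow> \<bar>t\<bar> \<le> 2 \<Longrightarrow>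
    \<bar>w H t * f (x + H * t) - (a0 t * f x + H * (a0 t * (deriv f x * t) + a1 t * f x))\<bar> \<le> C * H ^ 2"
    by (rule quadratic_errorE) blast
  have i0: "integrable lborel (\<lambda>t. \<phi> t * a0 t)"
    by (rule compact_kernel_integral(1)[OF _ _ van B D0]) auto
  have i1: "integrable lborel (\<lambda>t. \<phi> t * a1 t)"
    by (rule compact_kernel_integral(1)[OF _ _ van B D1]) auto
  have i2: "integrable lborel (\<lambda>t. \<phi> t * (t * a0 t))"
  proof (rule compact_kernel_integral(1)[OF _ _ van B])
    show "\<bar>t * a0 t\<bar> \<le> 2 * D0" if "\<bar>t\<bar> \<le> 2" for t
      unfolding abs_mult using that D0[OF that] by (intro mult_mono) auto
  qed auto
  have B0: "0 \<le> B" using B[of 0] by (rule order_trans[OF abs_ge_zero])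
  have "\<forall>\<^sub>F J in sequentially. \<bar>mean (\<lambda>t. \<phi> t * w (h J) t) J
     - (f x * (\<integral>t. \<phi> t * a0 t \<partial>lborel)
        + h J * (f x * (\<integral>t. \<phi> t * a1 t \<partial>lborel) + deriv f x * (\<integral>t. \<phi> t * (t * a0 t) \<partial>lborel)))\<bar> \<le> (4 * B * C) * h J ^ 2"
    using h_le_1
  proof eventually_elim
    case (elim J)
    define P where "P t = a0 t * f x + h J * (a0 t * (deriv f x * t) + a1 t * f x)" for t
    have [measurable]: "P \<in> borel_measurable borel" unfolding P_def by measurable
    have diff: "\<bar>w (h J) t * f (x + h J * t) - P t\<bar> \<le> C * h J ^ 2" if "\<bar>t\<bar> \<le> 2" for t
      unfolding P_def using C(2)[OF h_pos elim that] .
    note E = compact_kernel_integral[OF \<phi> _ van B diff]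
    have PE: "integrable lborel (\<lambda>t. \<phi> t * P t)"
      "(\<integral>t. \<phi> t * P t \<partial>lborel) = f x * (\<integral>t. \<phi> t * a0 t \<partial>lborel)
        + h J * (f x * (\<integral>t. \<phi> t * a1 t \<partial>lborel) + deriv f x * (\<integral>t. \<phi> t * (t * a0 t) \<partial>lborel))"
    proof -
      have eq: "\<phi> t * P t = f x * (\<phi> t * a0 t) + (h J * f x * (\<phi> t * a1 t) + h J * deriv f x * (\<phi> t * (t * a0 t)))" for t
        by (simp add: P_def algebra_simps)
      show "integrable lborel (\<lambda>t. \<phi> t * P t)" unfolding eq using i0 i1 i2 by auto
      show "(\<integral>t. \<phi> t * P t \<partial>lborel) = f x * (\<integral>t. \<phi> t * a0 t \<partial>lborel)
        + h J * (f x * (\<integral>t. \<phi> t * a1 t \<partial>lborel) + deriv f x * (\<integral>t. \<phi> t * (t * a0 t) \<partial>lborel))"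
        unfolding eq using i0 i1 i2 by (simp add: distrib_left mult.assoc)
    qed
    have "mean (\<lambda>t. \<phi> t * w (h J) t) J = (\<integral>t. \<phi> t * (w (h J) t * f (x + h J * t) - P t) + \<phi> t * P t \<partial>lborel)"
      unfolding mean_def by (intro Bochner_Integration.integral_cong) (auto simp: algebra_simps)
    also have "\<dots> = (\<integral>t. \<phi> t * (w (h J) t * f (x + h J * t) - P t) \<partial>lborel) + (\<integral>t. \<phi> t * P t \<partial>lborel)"
      using E(1) PE(1) by (intro Bochner_Integration.integral_add) auto
    finally show ?case using E(2) PE(2) by (simp add: mult_ac)
  qed
  then show ?thesis using C(1) B0 by (intro exI[of _ "4 * B * C"]) auto
qed

definition std :: "nat \<Rightarrow> 'a \<Rightarrow> nat \<Rightarrow> nat \<Rightarrow> real" where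
  "std J \<omega> = pool_std (\<lambda>i. X i \<omega>) c J x (h J)"

text \<open>The pool version of \<open>avg\<close>: \<Psi> acts on the whole pool while \<psi> is
  averaged over its members, and the normalization is J h because a pool counts once.\<close>

definition pool_avg :: "((nat \<Rightarrow> real) \<Rightarrow> real) \<Rightarrow> (real \<Rightarrow> real) \<Rightarrow> nat \<Rightarrow> 'a \<Rightarrow> real" where
  "pool_avg \<Psi> \<psi> J \<omega> = (\<Sum>j<J. \<Psi> (std J \<omega> j) * ((\<Sum>k<c. \<psi> (std J \<omega> j k)) / real c)) / (real J * h J)"

text \<open>The bound \<open>4 * L * B\<close> of \<open>pool_stat_close\<close> does not grow with
  J, so the normalization by J h leaves a multiple of the squared rate, J h being N h / c.\<close>

lemma pool_avg_close:
  assumes near: "near_diag L c \<Psi> \<phi>"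
    and van: "\<And>u. (\<And>k. k < c \<Longrightarrow> 1 < \<bar>u k\<bar>) \<Longrightarrow> \<Psi> u = 0" "\<And>t. 1 < \<bar>t\<bar> \<Longrightarrow> \<phi> t = 0"
    and \<psi>: "\<And>t. \<bar>t\<bar> \<le> 2 \<Longrightarrow> \<bar>\<psi> t\<bar> \<le> B"
    and loc: "pools_local (\<lambda>i. X i \<omega>) c J x (h J)" and J: "1 \<le> J"
  shows "\<bar>pool_avg \<Psi> \<psi> J \<omega> - avg (\<lambda>t. \<phi> t * \<psi> t) J \<omega>\<bar> \<le> 4 * L * B * real c * rate J ^ 2"
proof -
  have pos: "0 < real J * h J" using J h_pos[of J] by simp
  have "pool_avg \<Psi> \<psi> J \<omega> - avg (\<lambda>t. \<phi> t * \<psi> t) J \<omega>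
     = ((\<Sum>j<J. \<Psi> (std J \<omega> j) * ((\<Sum>k<c. \<psi> (std J \<omega> j k)) / real c))
        - (\<Sum>i<c * J. \<phi> ((X i \<omega> - x) / h J) * \<psi> ((X i \<omega> - x) / h J)) / real c) / (real J * h J)"
    by (simp add: pool_avg_def avg_def diff_divide_distrib mult.assoc)
  moreover have "\<bar>(\<Sum>j<J. \<Psi> (std J \<omega> j) * ((\<Sum>k<c. \<psi> (std J \<omega> j k)) / real c))
        - (\<Sum>i<c * J. \<phi> ((X i \<omega> - x) / h J) * \<psi> ((X i \<omega> - x) / h J)) / real c\<bar> \<le> 4 * L * B"
    unfolding std_def by (rule pool_stat_close[OF near c1 h_pos van _ loc]) (use \<psi> in auto)
  ultimately have "\<bar>pool_avg \<Psi> \<psi> J \<omega> - avg (\<lambda>t. \<phi> t * \<psi> t) J \<omega>\<bar> \<le> 4 * L * B / (real J * h J)"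
    using pos by (simp add: divide_right_mono)
  also have "\<dots> = 4 * L * B * real c * rate J ^ 2"
    using c1 J h_pos[of J] unfolding rate_sq by (simp add: field_simps)
  finally show ?thesis .
qed

end

text \<open>\<open>\<Omega>\<close> is the weight of a pool in the coordinates \<open>(X - x) / h\<close> and \<open>G\<close> its restriction to the diagonal:
  \<open>K\<close> for the average weights, \<open>K\<^sup>c\<close> for the product weights. The factor \<open>\<theta>\<close> normalizes the weights.\<close>

locale pooled_kernel = pooled_asymptotics +
  fixes \<Omega> :: "(nat \<Rightarrow> real) \<Rightarrow> real" and G :: "real \<Rightarrow> real" and p :: nat and \<theta> :: "nat \<Rightarrow> real"
  assumes m_smooth: "continuously_differentiable_order (p + 3) m"
    and \<sigma>2_smooth: "continuously_differentiable_order 2 \<sigma>2"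
    and near: "\<exists>L. near_diag L c \<Omega> G"
    and \<Omega>_van: "\<And>u. (\<And>k. k < c \<Longrightarrow> 1 < \<bar>u k\<bar>) \<Longrightarrow> \<Omega> u = 0"
    and \<Omega>_cong: "\<And>u v. (\<And>k. k < c \<Longrightarrow> u k = v k) \<Longrightarrow> \<Omega> u = \<Omega> v"
    and \<Omega>_meas: "\<And>(N :: (nat \<Rightarrow> real) measure) g. (\<And>k. k < c \<Longrightarrow> g k \<in> borel_measurable N) \<Longrightarrow>
      (\<lambda>\<omega>. \<Omega> (\<lambda>k. g k \<omega>)) \<in> borel_measurable N"
    and G_van: "\<And>t. 1 < \<bar>t\<bar> \<Longrightarrow> G t = 0"
    and G_meas [measurable]: "G \<in> borel_measurable borel"
    and \<theta>_pos: "\<And>J. 0 < \<theta> J"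
    and mu_inv: "invertible_mat (mu_mat G p 0)"
begin

section \<open>Standardized statistics and their nonrandom counterparts\<close>

definition n :: nat where "n = p + 1"

text \<open>The weighted Gram matrix with \<theta>, J h and one power of h per row and column index
  stripped off. Its second design factor is the average over the members that
  \<open>pool_avg\<close> takes of \<open>t ^ l'\<close>.\<close>

definition Gram :: "nat \<Rightarrow> 'a \<Rightarrow> nat \<Rightarrow> nat \<Rightarrow> real" where
  "Gram J \<omega> l l' = pool_avg (\<lambda>u. \<Omega> u * pow_avg c l u) (\<lambda>t. t ^ l') J \<omega>"

definition Bias :: "nat \<Rightarrow> 'a \<Rightarrow> nat \<Rightarrow> real" where
  "Bias J \<omega> l = pool_avg (\<lambda>u. \<Omega> u * pow_avg c l u) (scaled_remainder m p x (h J)) J \<omega>"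

definition Vmat :: "nat \<Rightarrow> 'a \<Rightarrow> nat \<Rightarrow> nat \<Rightarrow> real" where
  "Vmat J \<omega> l l' = pool_avg (\<lambda>u. (\<Omega> u * pow_avg c l u) * (\<Omega> u * pow_avg c l' u)) (\<lambda>t. \<sigma>2 (x + h J * t)) J \<omega>"

text \<open>The counterpart of \<open>Bias\<close> for the residuals. It is not a
  \<open>pool_avg\<close>, because residuals are not functions of the covariates.\<close>

definition Noise :: "nat \<Rightarrow> 'a \<Rightarrow> nat \<Rightarrow> real" where
  "Noise J \<omega> l = (\<Sum>j<J. \<Omega> (std J \<omega> j) * pow_avg c l (std J \<omega> j) *
     ((\<Sum>k<c. (let i = pool_member (\<lambda>i. X i \<omega>) c J j k in Y i \<omega> - m (X i \<omega>))) / real c)) / (real J * h J)"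

text \<open>The mean at the bandwidth \<open>h J\<close> of the average that approximates
  \<open>Gram\<close>, with the pool weight restricted to the diagonal; it is not yet the limit. The
  random matrix stays within the rate of it, and its dependence on h is a matter of
  analysis.\<close>

definition Gram0 :: "nat \<Rightarrow> nat \<Rightarrow> nat \<Rightarrow> real" where
  "Gram0 J l l' = mean (\<lambda>t. (G t * t ^ l) * t ^ l') J"

definition Bias0 :: "nat \<Rightarrow> nat \<Rightarrow> real" where
  "Bias0 J l = mean (\<lambda>t. (G t * t ^ l) * scaled_remainder m p x (h J) t) J"

definition Vmat0 :: "nat \<Rightarrow> nat \<Rightarrow> nat \<Rightarrow> real" where
  "Vmat0 J l l' = mean (\<lambda>t. ((G t * t ^ l) * (G t * t ^ l')) * \<sigma>2 (x + h J * t)) J"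

lemma near_l: "\<exists>L. near_diag L c (\<lambda>u. \<Omega> u * pow_avg c l u) (\<lambda>t. G t * t ^ l)"
  using near near_diag_power[OF c1, of l] near_diag_mult[OF _ _ c1] unfolding pow_avg_def by blast

lemma near_ll: "\<exists>L. near_diag L c (\<lambda>u. (\<Omega> u * pow_avg c l u) * (\<Omega> u * pow_avg c l' u)) (\<lambda>t. (G t * t ^ l) * (G t * t ^ l'))"
  using near_l[of l] near_l[of l'] near_diag_mult[OF _ _ c1] by blast

lemma kernel_bounded:
  assumes "near_diag L c \<Psi> \<phi>" "\<And>t. 1 < \<bar>t\<bar> \<Longrightarrow> \<phi> t = 0"
  shows "\<bar>\<phi> t\<bar> \<le> L"
  using near_diag_bound[OF assms(1) c1, of t] near_diag_nonneg[OF assms(1) c1] assms(2)[of t]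
  by (cases "\<bar>t\<bar> \<le> 2") auto

lemma scaled_remainder_meas [measurable]: "scaled_remainder m p x H \<in> borel_measurable borel"
  unfolding scaled_remainder_def by measurable

lemma scaled_remainder_bounded:
  "\<exists>D. \<forall>H t. 0 < H \<longrightarrow> H \<le> 1 \<longrightarrow> \<bar>t\<bar> \<le> 2 \<longrightarrow> \<bar>scaled_remainder m p x H t\<bar> \<le> D"
proof -
  obtain C where C: "0 \<le> C" "\<And>H t. 0 < H \<Longrightarrow> H \<le> 1 \<Longrightarrow> \<bar>t\<bar> \<le> 2 \<Longrightarrow>
     \<bar>scaled_remainder m p x H t - (beta m x (p + 1) * t ^ (p + 1) + H * (beta m x (p + 2) * t ^ (p + 2)))\<bar> \<le> C * H ^ 2"
    using scaled_remainder_expansion[OF m_smooth, of x] by (rule quadratic_errorE) blast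
  obtain D1 where D1: "\<And>t. \<bar>t\<bar> \<le> 2 \<Longrightarrow> \<bar>beta m x (p + 1) * t ^ (p + 1)\<bar> \<le> D1"
    using bounded_on_window_monomial[of "beta m x (p + 1)" "p + 1"] unfolding bounded_on_window_def by blast
  obtain D2 where D2: "\<And>t. \<bar>t\<bar> \<le> 2 \<Longrightarrow> \<bar>beta m x (p + 2) * t ^ (p + 2)\<bar> \<le> D2"
    using bounded_on_window_monomial[of "beta m x (p + 2)" "p + 2"] unfolding bounded_on_window_def by blast
  have "\<bar>scaled_remainder m p x H t\<bar> \<le> C + D1 + D2" if H: "0 < H" "H \<le> 1" and t: "\<bar>t\<bar> \<le> 2" for H t
  proof -
    have "C * H ^ 2 \<le> C * 1" using H C(1) power_mono[of H 1 2] by (intro mult_left_mono) auto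
    moreover have "\<bar>H * (beta m x (p + 2) * t ^ (p + 2))\<bar> \<le> 1 * D2"
      unfolding abs_mult[of H] using H D2[OF t] by (intro mult_mono) auto
    ultimately show ?thesis using C(2)[OF H t] D1[OF t] by linarith
  qed
  then show ?thesis by blast
qed

lemma \<sigma>2_window: "\<exists>D. \<forall>H t. 0 < H \<longrightarrow> H \<le> 1 \<longrightarrow> \<bar>t\<bar> \<le> 2 \<longrightarrow> \<bar>\<sigma>2 (x + H * t)\<bar> \<le> D"
  using bounded_window[OF \<sigma>2_cont, of x] scaled_window(2) by blast

text \<open>Two errors add up: pools against individuals, of the order of the squared rate on
  \<open>pools_local\<close>, and individuals against their mean, of the order of the rate.\<close>

lemma whp_kernel_avg:
  assumes near: "near_diag L c \<Psi> \<phi>" and van: "\<And>t. 1 < \<bar>t\<bar> \<Longrightarrow> \<phi> t = 0"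
    and [measurable]: "\<phi> \<in> borel_measurable borel" "\<And>H. \<psi> H \<in> borel_measurable borel"
    and \<psi>: "\<exists>D. \<forall>H t. 0 < H \<longrightarrow> H \<le> 1 \<longrightarrow> \<bar>t\<bar> \<le> 2 \<longrightarrow> \<bar>\<psi> H t\<bar> \<le> D"
    and van_\<Psi>: "\<And>u. (\<And>k. k < c \<Longrightarrow> 1 < \<bar>u k\<bar>) \<Longrightarrow> \<Psi> u = 0"
  shows "whp M (\<lambda>C J \<omega>. \<bar>pool_avg \<Psi> (\<psi> (h J)) J \<omega> - mean (\<lambda>t. \<phi> t * \<psi> (h J) t) J\<bar> \<le> C * rate J)"
proof -
  obtain D where D: "\<And>H t. 0 < H \<Longrightarrow> H \<le> 1 \<Longrightarrow> \<bar>t\<bar> \<le> 2 \<Longrightarrow> \<bar>\<psi> H t\<bar> \<le> D" using \<psi> by blast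
  have D0: "0 \<le> D" using D[of 1 0] by (simp add: order_trans[OF abs_ge_zero])
  have L0: "0 \<le> L" using near_diag_nonneg[OF near c1] .
  have "whp M (\<lambda>C J \<omega>. \<bar>avg (\<lambda>t. \<phi> t * \<psi> (h J) t) J \<omega> - mean (\<lambda>t. \<phi> t * \<psi> (h J) t) J\<bar> \<le> C * rate J)"
  proof (rule whp_avg[of _ "L * D"])
    show "\<forall>\<^sub>F J in sequentially. \<forall>t. \<bar>\<phi> t * \<psi> (h J) t\<bar> \<le> L * D \<and> (2 < \<bar>t\<bar> \<longrightarrow> \<phi> t * \<psi> (h J) t = 0)"
      using h_le_1
    proof (eventually_elim, intro allI conjI impI)
      fix J t assume J: "h J \<le> 1"
      show "\<bar>\<phi> t * \<psi> (h J) t\<bar> \<le> L * D"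
      proof (cases "\<bar>t\<bar> \<le> 2")
        case True
        then show ?thesis unfolding abs_mult
          using kernel_bounded[OF near van, of t] D[OF h_pos J True] L0 by (intro mult_mono) auto
      qed (use van[of t] L0 D0 in auto)
    qed (use van in auto)
  qed measurable
  from whp_conj[OF whp_pools_local this] show ?thesis
  proof (rule whp_le[OF _ rate_nonneg], goal_cases)
    case (1 C)
    have "\<forall>\<^sub>F J in sequentially. \<forall>\<omega>\<in>space M.
      pools_local (\<lambda>i. X i \<omega>) c J x (h J) \<and> \<bar>avg (\<lambda>t. \<phi> t * \<psi> (h J) t) J \<omega> - mean (\<lambda>t. \<phi> t * \<psi> (h J) t) J\<bar> \<le> C * rate J \<longrightarrow>
      \<bar>pool_avg \<Psi> (\<psi> (h J)) J \<omega> - mean (\<lambda>t. \<phi> t * \<psi> (h J) t) J\<bar> \<le> (C + 4 * L * D * real c) * rate J"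
      using h_le_1 rate_sq_le_rate eventually_ge_at_top[of 1]
    proof (eventually_elim, intro ballI impI)
      fix J \<omega> assume J: "h J \<le> 1" "rate J ^ 2 \<le> rate J" "1 \<le> J"
        and *: "pools_local (\<lambda>i. X i \<omega>) c J x (h J) \<and> \<bar>avg (\<lambda>t. \<phi> t * \<psi> (h J) t) J \<omega> - mean (\<lambda>t. \<phi> t * \<psi> (h J) t) J\<bar> \<le> C * rate J"
      have "\<bar>pool_avg \<Psi> (\<psi> (h J)) J \<omega> - avg (\<lambda>t. \<phi> t * \<psi> (h J) t) J \<omega>\<bar> \<le> 4 * L * D * real c * rate J ^ 2"
        using * D[OF h_pos J(1)] J(3) by (intro pool_avg_close[OF near van_\<Psi> van]) auto
      also have "\<dots> \<le> 4 * L * D * real c * rate J"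
        using L0 D0 J(2) by (intro mult_left_mono) auto
      finally show "\<bar>pool_avg \<Psi> (\<psi> (h J)) J \<omega> - mean (\<lambda>t. \<phi> t * \<psi> (h J) t) J\<bar> \<le> (C + 4 * L * D * real c) * rate J"
        using conjunct2[OF *] unfolding distrib_right by linarith
    qed
    then show ?case by blast
  qed
qed

lemma whp_Gram: "whp M (\<lambda>C J \<omega>. \<bar>Gram J \<omega> l l' - Gram0 J l l'\<bar> \<le> C * rate J)"
proof -
  obtain L where L: "near_diag L c (\<lambda>u. \<Omega> u * pow_avg c l u) (\<lambda>t. G t * t ^ l)" using near_l by blast
  have "\<exists>D. \<forall>H t. 0 < H \<longrightarrow> H \<le> 1 \<longrightarrow> \<bar>t\<bar> \<le> 2 \<longrightarrow> \<bar>t ^ l'\<bar> \<le> (D::real)"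
    using bounded_on_window_monomial[of 1 l'] unfolding bounded_on_window_def by auto
  then show ?thesis
    unfolding Gram_def Gram0_def
    by (intro whp_kernel_avg[OF L, of "\<lambda>_ t. t ^ l'"]) (auto simp: G_van \<Omega>_van)
qed

lemma whp_Bias: "whp M (\<lambda>C J \<omega>. \<bar>Bias J \<omega> l - Bias0 J l\<bar> \<le> C * rate J)"
proof -
  obtain L where L: "near_diag L c (\<lambda>u. \<Omega> u * pow_avg c l u) (\<lambda>t. G t * t ^ l)" using near_l by blast
  show ?thesis
    unfolding Bias_def Bias0_def
    using scaled_remainder_bounded
    by (intro whp_kernel_avg[OF L, of "scaled_remainder m p x"]) (auto simp: G_van \<Omega>_van)
qed

lemma whp_Vmat: "whp M (\<lambda>C J \<omega>. \<bar>Vmat J \<omega> l l' - Vmat0 J l l'\<bar> \<le> C * rate J)"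
proof -
  obtain L where L: "near_diag L c (\<lambda>u. (\<Omega> u * pow_avg c l u) * (\<Omega> u * pow_avg c l' u)) (\<lambda>t. (G t * t ^ l) * (G t * t ^ l'))"
    using near_ll by blast
  show ?thesis
    unfolding Vmat_def Vmat0_def
    using \<sigma>2_window
    by (intro whp_kernel_avg[OF L, of "\<lambda>H t. \<sigma>2 (x + H * t)"]) (auto simp: G_van \<Omega>_van)
qed

end

lemma eventually_uniform_bound:
  fixes F :: "'b \<Rightarrow> nat \<Rightarrow> real"
  assumes "finite I" and g: "\<And>J. 0 \<le> g J"
    and F: "\<And>i. i \<in> I \<Longrightarrow> \<exists>C\<ge>0. \<forall>\<^sub>F J in sequentially. F i J \<le> C * g J"
  shows "\<exists>C\<ge>0. \<forall>\<^sub>F J in sequentially. \<forall>i\<in>I. F i J \<le> C * g J"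
  using assms(1) F
proof (induction I rule: finite_induct)
  case (insert i I)
  then obtain C where C: "C \<ge> 0" "\<forall>\<^sub>F J in sequentially. \<forall>i\<in>I. F i J \<le> C * g J" by auto
  obtain D where D: "D \<ge> 0" "\<forall>\<^sub>F J in sequentially. F i J \<le> D * g J" using insert by blast
  have "\<forall>\<^sub>F J in sequentially. \<forall>i\<in>insert i I. F i J \<le> (C + D) * g J"
    using C(2) D(2)
  proof eventually_elim
    case (elim J)
    have "C * g J \<le> (C + D) * g J" "D * g J \<le> (C + D) * g J"
      using C(1) D(1) g by (auto intro!: mult_right_mono)
    then show ?case using elim by force
  qed
  then show ?case using C(1) D(1) by (intro exI[of _ "C + D"]) auto
qed auto

context pooled_kernel
begin

section \<open>Expansion of the nonrandom counterparts in the bandwidth\<close>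

lemma integral_mu: "(\<integral>t. (G t * t ^ l) * (k * t ^ i) \<partial>lborel) = k * mu G (l + i)"
proof -
  have "(\<integral>t. (G t * t ^ l) * (k * t ^ i) \<partial>lborel) = (\<integral>t. k * (t ^ (l + i) * G t) \<partial>lborel)"
    by (intro Bochner_Integration.integral_cong) (auto simp: power_add)
  then show ?thesis by (simp add: mu_def)
qed

text \<open>The factor \<open>t ^ l'\<close> is exact, so its own first-order part is 0 and the term
  in h comes from the slope of the density alone.\<close>

lemma Gram0_limit:
  "\<exists>C\<ge>0. \<forall>\<^sub>F J in sequentially.
     \<bar>Gram0 J l l' - (f x * mu G (l + l') + h J * deriv f x * mu G (l + l' + 1))\<bar> \<le> C * h J ^ 2"
proof -
  obtain L where L: "near_diag L c (\<lambda>u. \<Omega> u * pow_avg c l u) (\<lambda>t. G t * t ^ l)" using near_l by blast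
  have "\<exists>C\<ge>0. \<forall>\<^sub>F J in sequentially. \<bar>mean (\<lambda>t. (G t * t ^ l) * t ^ l') J
     - (f x * (\<integral>t. (G t * t ^ l) * t ^ l' \<partial>lborel)
        + h J * (f x * (\<integral>t. (G t * t ^ l) * 0 \<partial>lborel) + deriv f x * (\<integral>t. (G t * t ^ l) * (t * t ^ l') \<partial>lborel)))\<bar> \<le> C * h J ^ 2"
    by (rule mean_expansion[of _ L "\<lambda>_ t. t ^ l'"])
      (use kernel_bounded[OF L] bounded_on_window_monomial[of 1 l'] bounded_on_window_monomial[of 0 0] in
        \<open>auto simp: G_van quadratic_error_def\<close>)
  then show ?thesis
    using integral_mu[of l 1 l'] integral_mu[of l 1 "Suc l'"] by (simp add: Gram0_def mult.assoc)
qed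

text \<open>Two sources feed the term of order h: the Taylor coefficient of order p + 2 against f(x)
  and the one of order p + 1 against the slope of f. Both multiply the same moment.\<close>

lemma Bias0_limit:
  "\<exists>C\<ge>0. \<forall>\<^sub>F J in sequentially. \<bar>Bias0 J l - (beta m x (p + 1) * f x * mu G (l + (p + 1))
      + h J * ((beta m x (p + 2) * f x + beta m x (p + 1) * deriv f x) * mu G (l + (p + 2))))\<bar> \<le> C * h J ^ 2"
proof -
  obtain L where L: "near_diag L c (\<lambda>u. \<Omega> u * pow_avg c l u) (\<lambda>t. G t * t ^ l)" using near_l by blast
  have "\<exists>C\<ge>0. \<forall>\<^sub>F J in sequentially. \<bar>mean (\<lambda>t. (G t * t ^ l) * scaled_remainder m p x (h J) t) J
     - (f x * (\<integral>t. (G t * t ^ l) * (beta m x (p + 1) * t ^ (p + 1)) \<partial>lborel)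
        + h J * (f x * (\<integral>t. (G t * t ^ l) * (beta m x (p + 2) * t ^ (p + 2)) \<partial>lborel)
          + deriv f x * (\<integral>t. (G t * t ^ l) * (t * (beta m x (p + 1) * t ^ (p + 1))) \<partial>lborel)))\<bar> \<le> C * h J ^ 2"
    by (rule mean_expansion[of _ L "scaled_remainder m p x"])
      (use kernel_bounded[OF L] scaled_remainder_expansion[OF m_smooth, of x] bounded_on_window_monomial in
        \<open>auto simp: G_van simp del: power_Suc\<close>)
  moreover have "(\<integral>t. (G t * t ^ l) * (t * (beta m x (p + 1) * t ^ (p + 1))) \<partial>lborel)
      = beta m x (p + 1) * mu G (l + (p + 2))"
    using integral_mu[of l "beta m x (p + 1)" "p + 2"] by (simp add: mult_ac)
  ultimately show ?thesis
    by (simp only: integral_mu Bias0_def) (simp add: algebra_simps)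
qed

text \<open>An error of order h is enough, since the variance is claimed up to a factor 1 + o_P(1);
  the first-order term I goes into the constant.\<close>

lemma Vmat0_limit:
  "\<exists>C\<ge>0. \<forall>\<^sub>F J in sequentially. \<bar>Vmat0 J l l' - \<sigma>2 x * f x * nu G (l + l')\<bar> \<le> C * h J"
proof -
  define \<phi> where "\<phi> t = (G t * t ^ l) * (G t * t ^ l')" for t
  obtain L where L: "near_diag L c (\<lambda>u. (\<Omega> u * pow_avg c l u) * (\<Omega> u * pow_avg c l' u)) \<phi>"
    using near_ll unfolding \<phi>_def by blast
  have [measurable]: "\<phi> \<in> borel_measurable borel" unfolding \<phi>_def by measurable
  define I where "I = f x * (\<integral>t. \<phi> t * (deriv \<sigma>2 x * t) \<partial>lborel) + deriv f x * (\<integral>t. \<phi> t * (t * \<sigma>2 x) \<partial>lborel)"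
  have "\<exists>C\<ge>0. \<forall>\<^sub>F J in sequentially. \<bar>mean (\<lambda>t. \<phi> t * \<sigma>2 (x + h J * t)) J
     - (f x * (\<integral>t. \<phi> t * \<sigma>2 x \<partial>lborel) + h J * I)\<bar> \<le> C * h J ^ 2"
    unfolding I_def
    by (rule mean_expansion[of _ L "\<lambda>H t. \<sigma>2 (x + H * t)", OF _ _ _ _ _ _ linear_expansion[OF \<sigma>2_smooth]])
      (use kernel_bounded[OF L] bounded_on_window_monomial[of "\<sigma>2 x" 0] bounded_on_window_monomial[of "deriv \<sigma>2 x" 1] in
        \<open>auto simp: \<phi>_def G_van\<close>)
  then obtain C where C: "C \<ge> 0" "\<forall>\<^sub>F J in sequentially. \<bar>mean (\<lambda>t. \<phi> t * \<sigma>2 (x + h J * t)) J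
     - (f x * (\<integral>t. \<phi> t * \<sigma>2 x \<partial>lborel) + h J * I)\<bar> \<le> C * h J ^ 2" by blast
  have nu: "f x * (\<integral>t. \<phi> t * \<sigma>2 x \<partial>lborel) = \<sigma>2 x * f x * nu G (l + l')"
  proof -
    have "(\<integral>t. \<phi> t * \<sigma>2 x \<partial>lborel) = (\<integral>t. t ^ (l + l') * (G t)\<^sup>2 * \<sigma>2 x \<partial>lborel)"
      by (intro Bochner_Integration.integral_cong) (auto simp: \<phi>_def power_add power2_eq_square)
    then show ?thesis by (simp add: nu_def)
  qed
  have "\<forall>\<^sub>F J in sequentially. \<bar>Vmat0 J l l' - \<sigma>2 x * f x * nu G (l + l')\<bar> \<le> (C + \<bar>I\<bar>) * h J"
    using C(2) h_le_1
  proof eventually_elim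
    case (elim J)
    have "h J ^ 2 \<le> h J" using elim(2) h_pos[of J] by (simp add: power2_eq_square mult_left_le)
    then have "C * h J ^ 2 \<le> C * h J" using C(1) by (rule mult_left_mono)
    moreover have "\<bar>h J * I\<bar> = \<bar>I\<bar> * h J" using h_pos[of J] by (simp add: abs_mult)
    moreover have "Vmat0 J l l' = mean (\<lambda>t. \<phi> t * \<sigma>2 (x + h J * t)) J" by (simp add: Vmat0_def \<phi>_def)
    ultimately show ?case using elim(1) unfolding nu distrib_right by linarith
  qed
  then show ?thesis using C(1) by (intro exI[of _ "C + \<bar>I\<bar>"]) auto
qed

section \<open>The noise term\<close>

lemma std_eq: "X (pool_member (\<lambda>i. X i \<omega>) c J j k) \<omega> = x + h J * std J \<omega> j k"
  using h_pos[of J] by (simp add: std_def pool_std_def pool_cov_def)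

lemma std_covariates:
  assumes "j < J" "k < c"
  shows "pool_std (covariates (c * J) \<omega>) c J x (h J) j k = std J \<omega> j k"
  using pool_cov_cong[of c J "covariates (c * J) \<omega>" "\<lambda>i. X i \<omega>"] assms
  by (simp add: std_def pool_std_def covariates_def)

lemma \<Omega>_covariates:
  assumes "j < J"
  shows "\<Omega> (pool_std (covariates (c * J) \<omega>) c J x (h J) j) = \<Omega> (std J \<omega> j)"
  by (rule \<Omega>_cong) (rule std_covariates[OF assms])

lemma component_measurable:
  "i < N \<Longrightarrow> (\<lambda>xs. xs i) \<in> borel_measurable (PiM {..<N} (\<lambda>_. borel :: real measure))"
  by (intro measurable_component_singleton) simp

lemma pool_std_measurable:
  assumes "j < J" "k < c"
  shows "(\<lambda>xs. pool_std xs c J x (h J) j k) \<in> borel_measurable (PiM {..<c * J} (\<lambda>_. borel))"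
proof -
  have "(\<lambda>xs. pool_cov xs c J j k) \<in> borel_measurable (PiM {..<c * J} (\<lambda>_. borel))"
    by (rule pool_cov_measurable[of c J "\<lambda>i xs. xs i", OF component_measurable assms])
  then show ?thesis unfolding pool_std_def by measurable
qed

lemma \<Omega>_pool_std_measurable:
  assumes "j < J"
  shows "(\<lambda>xs. \<Omega> (pool_std xs c J x (h J) j)) \<in> borel_measurable (PiM {..<c * J} (\<lambda>_. borel))"
  using \<Omega>_meas[of "\<lambda>k xs. pool_std xs c J x (h J) j k", OF pool_std_measurable[OF assms]] by simp

text \<open>The coefficients \<open>a\<close> are set to 0 on pools that leave the window, so that the variance bound holds
  everywhere; on the event \<open>pools_local\<close> this changes nothing.\<close>

lemma whp_Noise: "whp M (\<lambda>C J \<omega>. \<bar>Noise J \<omega> l\<bar> \<le> C * rate J)"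
proof -
  obtain L where L: "near_diag L c (\<lambda>u. \<Omega> u * pow_avg c l u) (\<lambda>t. G t * t ^ l)" using near_l by blast
  obtain S where S: "\<And>H t. 0 < H \<Longrightarrow> H \<le> 1 \<Longrightarrow> \<bar>t\<bar> \<le> 2 \<Longrightarrow> \<bar>\<sigma>2 (x + H * t)\<bar> \<le> S" using \<sigma>2_window by blast
  have S0: "0 \<le> S" using S[of 1 0] by (simp add: order_trans[OF abs_ge_zero])
  define a where "a J xs j = (if \<forall>k\<in>{..<c}. \<bar>pool_std xs c J x (h J) j k\<bar> \<le> 2
      then \<Omega> (pool_std xs c J x (h J) j) * pow_avg c l (pool_std xs c J x (h J) j) / (real J * h J) else 0)" for J xs j
  define \<gamma> where "\<gamma> J i xs = spread_coef xs c J (a J xs) i" for J i xs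
  have a_cov: "a J (covariates (c * J) \<omega>) j = a J (\<lambda>i. X i \<omega>) j" if "j < J" for J \<omega> j
  proof -
    have "pow_avg c l (pool_std (covariates (c * J) \<omega>) c J x (h J) j) = pow_avg c l (std J \<omega> j)"
      unfolding pow_avg_def using std_covariates[OF that] by simp
    then show ?thesis
      unfolding a_def \<Omega>_covariates[OF that] using std_covariates[OF that] by (simp add: std_def)
  qed
  have \<gamma>_cov: "\<gamma> J i (covariates (c * J) \<omega>) = spread_coef (\<lambda>i. X i \<omega>) c J (a J (\<lambda>i. X i \<omega>)) i" for J i \<omega>
    unfolding \<gamma>_def
  proof (rule spread_coef_cong)
    show "covariates (c * J) \<omega> i = X i \<omega>" if "i < c * J" for i using that by (simp add: covariates_def)
  qed (rule a_cov)
  have "whp M (\<lambda>C J \<omega>. \<bar>\<Sum>i<c * J. \<gamma> J i (covariates (c * J) \<omega>) * (Y i \<omega> - m (X i \<omega>))\<bar> \<le> C * rate J)"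
  proof (rule whp_noise[where D = "L ^ 2 * S"])
    fix J i
    let ?P = "PiM {..<c * J} (\<lambda>_. borel) :: (nat \<Rightarrow> real) measure"
    note comp = component_measurable and ps = pool_std_measurable
    show "\<gamma> J i \<in> borel_measurable ?P"
      unfolding \<gamma>_def
    proof (rule spread_coef_measurable[of c J "\<lambda>i xs. xs i", OF comp])
      fix j assume j: "j < J"
      have [measurable]: "(\<lambda>xs. \<Omega> (pool_std xs c J x (h J) j)) \<in> borel_measurable ?P"
        using \<Omega>_pool_std_measurable[OF j] .
      have [measurable]: "(\<lambda>xs. pow_avg c l (pool_std xs c J x (h J) j)) \<in> borel_measurable ?P"
        unfolding pow_avg_def using ps[OF j]
        by (intro borel_measurable_divide borel_measurable_sum borel_measurable_power) auto
      have "{xs \<in> space ?P. \<forall>k\<in>{..<c}. \<bar>pool_std xs c J x (h J) j k\<bar> \<le> 2} \<in> sets ?P"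
      proof (rule sets.sets_Collect_finite_All)
        fix k assume "k \<in> {..<c}"
        then have [measurable]: "(\<lambda>xs. pool_std xs c J x (h J) j k) \<in> borel_measurable ?P" using ps[OF j] by simp
        show "{xs \<in> space ?P. \<bar>pool_std xs c J x (h J) j k\<bar> \<le> 2} \<in> sets ?P" by measurable
      qed simp
      then show "(\<lambda>xs. a J xs j) \<in> borel_measurable ?P"
        unfolding a_def by (intro measurable_If) auto
    qed auto
  next
    show "\<forall>\<^sub>F J in sequentially. \<forall>\<omega>\<in>space M. (\<Sum>i<c * J. (\<gamma> J i (covariates (c * J) \<omega>))\<^sup>2 * \<bar>\<sigma>2 (X i \<omega>)\<bar>)
      \<le> L ^ 2 * S * rate J ^ 2 * avg (indicator {-2..2}) J \<omega>"
      using h_le_1 eventually_ge_at_top[of 1]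
    proof (eventually_elim, intro ballI)
      fix J \<omega> assume J: "h J \<le> 1" "1 \<le> J"
      \<comment> \<open>Bounds the coefficient of an individual: L from the pool weight, 1 / (J h)
        from the normalization and 1 / c from averaging the pool.\<close>
      define r where "r = L / (real J * h J) / real c"
      have pos: "0 < real J * h J" using J h_pos[of J] by simp
      have "(\<Sum>i<c * J. (\<gamma> J i (covariates (c * J) \<omega>))\<^sup>2 * \<bar>\<sigma>2 (X i \<omega>)\<bar>)
          = (\<Sum>j<J. (a J (\<lambda>i. X i \<omega>) j / real c)\<^sup>2 * (\<Sum>k<c. \<bar>\<sigma>2 (x + h J * std J \<omega> j k)\<bar>))"
        unfolding \<gamma>_cov by (subst sum_spread_coef_sq) (simp add: std_eq)
      also have "\<dots> \<le> (\<Sum>j<J. \<Sum>k<c. r\<^sup>2 * S * indicator {-2..2} (std J \<omega> j k))"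
      proof (rule sum_mono)
        fix j assume "j \<in> {..<J}"
        show "(a J (\<lambda>i. X i \<omega>) j / real c)\<^sup>2 * (\<Sum>k<c. \<bar>\<sigma>2 (x + h J * std J \<omega> j k)\<bar>)
            \<le> (\<Sum>k<c. r\<^sup>2 * S * indicator {-2..2} (std J \<omega> j k))"
        proof (cases "\<forall>k\<in>{..<c}. \<bar>std J \<omega> j k\<bar> \<le> 2")
          case False
          then have "a J (\<lambda>i. X i \<omega>) j = 0" by (auto simp: a_def std_def)
          then show ?thesis using S0 by (auto intro!: sum_nonneg)
        next
          case True
          have le4: "\<bar>std J \<omega> j k - std J \<omega> j k'\<bar> \<le> 4" if "k < c" "k' < c" for k k'
            using True that by (smt (verit) lessThan_iff)
          have "\<bar>\<Omega> (std J \<omega> j) * pow_avg c l (std J \<omega> j)\<bar> \<le> L"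
            by (rule near_diagD(1)[OF L, of "std J \<omega> j" 4]) (use True le4 in auto)
          then have "\<bar>a J (\<lambda>i. X i \<omega>) j / real c\<bar> \<le> r"
            using True pos h_pos[of J] unfolding a_def r_def std_def[symmetric]
            by (auto simp: abs_mult intro!: divide_right_mono)
          then have "(a J (\<lambda>i. X i \<omega>) j / real c)\<^sup>2 \<le> r\<^sup>2"
            by (metis abs_ge_zero power2_abs power_mono)
          then have "(a J (\<lambda>i. X i \<omega>) j / real c)\<^sup>2 * (\<Sum>k<c. \<bar>\<sigma>2 (x + h J * std J \<omega> j k)\<bar>) \<le> r\<^sup>2 * (\<Sum>k<c. S)"
            using S[OF h_pos J(1)] True by (intro mult_mono sum_mono sum_nonneg) auto
          also have "\<dots> = (\<Sum>k<c. r\<^sup>2 * S * indicator {-2..2} (std J \<omega> j k))"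
            unfolding sum_distrib_left
          proof (rule sum.cong[OF refl])
            fix k assume "k \<in> {..<c}"
            then have "std J \<omega> j k \<in> {-2..2}" using bspec[OF True, of k] by (auto simp: abs_if split: if_splits)
            then show "r\<^sup>2 * S = r\<^sup>2 * S * indicator {-2..2} (std J \<omega> j k)" by simp
          qed
          finally show ?thesis .
        qed
      qed
      also have "\<dots> = r\<^sup>2 * S * (\<Sum>i<c * J. indicator {-2..2} ((X i \<omega> - x) / h J))"
        unfolding sum_distrib_left
        by (subst sum_pool_members[symmetric, of _ _ _ "\<lambda>i. X i \<omega>"]) (simp add: std_def pool_std_def pool_cov_def)
      also have "\<dots> = r\<^sup>2 * S * (avg (indicator {-2..2}) J \<omega> * (real (c * J) * h J))"
        using J c1 h_pos[of J] by (simp add: avg_def)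
      \<comment> \<open>As r = L / (c J h), multiplying its square by N h gives L^2 / (N h), which
        is L^2 times the squared rate.\<close>
      also have "\<dots> = L ^ 2 * S * rate J ^ 2 * avg (indicator {-2..2}) J \<omega>"
      proof -
        have "r\<^sup>2 * (real (c * J) * h J) = L ^ 2 * rate J ^ 2"
          using J c1 h_pos[of J] unfolding rate_sq r_def by (simp add: field_simps power2_eq_square)
        then show ?thesis by (simp add: mult_ac)
      qed
      finally show "(\<Sum>i<c * J. (\<gamma> J i (covariates (c * J) \<omega>))\<^sup>2 * \<bar>\<sigma>2 (X i \<omega>)\<bar>)
          \<le> L ^ 2 * S * rate J ^ 2 * avg (indicator {-2..2}) J \<omega>" .
    qed
  qed
  from whp_conj[OF whp_pools_local this] show ?thesis
  proof (rule whp_le[OF _ rate_nonneg], goal_cases)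
    case (1 C)
    have "\<bar>Noise J \<omega> l\<bar> \<le> C * rate J" if
      *: "pools_local (\<lambda>i. X i \<omega>) c J x (h J) \<and> \<bar>\<Sum>i<c * J. \<gamma> J i (covariates (c * J) \<omega>) * (Y i \<omega> - m (X i \<omega>))\<bar> \<le> C * rate J"
      for J \<omega>
    proof -
      have a_eq: "a J (\<lambda>i. X i \<omega>) j = \<Omega> (std J \<omega> j) * pow_avg c l (std J \<omega> j) / (real J * h J)" if j: "j < J" for j
      proof (cases "\<exists>k<c. \<bar>std J \<omega> j k\<bar> \<le> 1")
        case True
        then have "\<forall>k\<in>{..<c}. \<bar>std J \<omega> j k\<bar> \<le> 2"
          using pools_localD[OF conjunct1[OF *] h_pos j] unfolding std_def by blast
        then show ?thesis by (simp add: a_def std_def)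
      next
        \<comment> \<open>No member of the pool meets the kernel support, so its weight is 0 whether
          or not the truncation acts.\<close>
        case False
        then have "\<Omega> (std J \<omega> j) = 0" by (intro \<Omega>_van) force
        then show ?thesis by (simp add: a_def std_def)
      qed
      have "(\<Sum>i<c * J. \<gamma> J i (covariates (c * J) \<omega>) * (Y i \<omega> - m (X i \<omega>))) = Noise J \<omega> l"
        unfolding \<gamma>_cov
        by (subst sum_spread_coef) (simp add: a_eq Noise_def Let_def sum_divide_distrib)
      then show ?thesis using * by simp
    qed
    then show ?case by (intro exI[of _ C] always_eventually allI ballI impI) blast
  qed
qed

text \<open>In standardized coordinates the first row of the inverse Gram matrix solves a row system in which
  the powers of the bandwidth and the normalization \<open>\<theta>\<close> have cancelled.\<close>

definition Tstat :: "nat \<Rightarrow> 'a \<Rightarrow> real" where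
  "Tstat J \<omega> = wls_intercept p x (\<lambda>i. X i \<omega>) (\<lambda>i. Y i \<omega>) c J (\<lambda>j. \<theta> J * \<Omega> (std J \<omega> j))"

definition coef :: "nat \<Rightarrow> 'a \<Rightarrow> nat \<Rightarrow> real" where
  "coef J \<omega> = wls_coef p x (\<lambda>i. X i \<omega>) c J (\<lambda>j. \<theta> J * \<Omega> (std J \<omega> j))"

text \<open>The second conjunct ties y to the coefficients of the estimator, so that later arguments
  need no inverse of a random matrix.\<close>

definition row_solution :: "nat \<Rightarrow> 'a \<Rightarrow> (nat \<Rightarrow> real) \<Rightarrow> bool" where
  "row_solution J \<omega> y \<longleftrightarrow> (\<forall>l'<n. (\<Sum>l<n. y l * Gram J \<omega> l l') = (if l' = 0 then 1 else 0)) \<and>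
     (\<forall>j<J. coef J \<omega> j = \<Omega> (std J \<omega> j) * (\<Sum>l<n. y l * pow_avg c l (std J \<omega> j)) / (real J * h J))"

text \<open>The Gram matrix of the design arises from \<open>Gram\<close> by the positive factor
  \<kappa> and by scaling rows and columns with powers of H. A trivial row kernel of
  \<open>Gram\<close> therefore makes the actual Gram matrix invertible, and \<open>mat_inv\<close>
  is a genuine inverse.\<close>

lemma row_solution_exists:
  assumes J: "1 \<le> J"
    and ker: "\<And>z i. (\<And>l'. l' < n \<Longrightarrow> (\<Sum>l<n. z l * Gram J \<omega> l l') = 0) \<Longrightarrow> i < n \<Longrightarrow> z i = 0"
  shows "\<exists>y. row_solution J \<omega> y"
proof -
  define H where "H = h J"
  have H: "0 < H" using h_pos by (simp add: H_def)
  define \<kappa> where "\<kappa> = \<theta> J * (real J * H)"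
  have \<kappa>: "0 < \<kappa>" using \<theta>_pos[of J] J H by (simp add: \<kappa>_def)
  define w where "w j = \<theta> J * \<Omega> (std J \<omega> j)" for j
  define Gm where "Gm = gram_mat p x (\<lambda>i. X i \<omega>) c J w"
  have Gm: "Gm \<in> carrier_mat n n" by (simp add: Gm_def n_def)
  have design: "design p x (\<lambda>i. X i \<omega>) c J $$ (j, l) = H ^ l * pow_avg c l (std J \<omega> j)" if "j < J" "l < n" for j l
  proof -
    have "design p x (\<lambda>i. X i \<omega>) c J $$ (j, l) = (\<Sum>k<c. (pool_cov (\<lambda>i. X i \<omega>) c J j k - x) ^ l) / real c"
      using that by (intro design_entry) (auto simp: n_def)
    also have "\<dots> = (\<Sum>k<c. (H * std J \<omega> j k) ^ l) / real c"
      using H by (simp add: std_def pool_std_def H_def)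
    finally show ?thesis by (simp add: pow_avg_def power_mult_distrib sum_distrib_left)
  qed
  have entry: "Gm $$ (l, l') = \<kappa> * H ^ l * H ^ l' * Gram J \<omega> l l'" if "l < n" "l' < n" for l l'
  proof -
    have "Gm $$ (l, l') = (\<Sum>j<J. w j * (H ^ l * pow_avg c l (std J \<omega> j)) * (H ^ l' * pow_avg c l' (std J \<omega> j)))"
      unfolding Gm_def using that design by (subst gram_mat_entry) (auto simp: n_def)
    also have "\<dots> = \<theta> J * H ^ l * H ^ l' * (\<Sum>j<J. \<Omega> (std J \<omega> j) * pow_avg c l (std J \<omega> j) * pow_avg c l' (std J \<omega> j))"
      unfolding sum_distrib_left w_def by (intro sum.cong) auto
    also have "(\<Sum>j<J. \<Omega> (std J \<omega> j) * pow_avg c l (std J \<omega> j) * pow_avg c l' (std J \<omega> j)) = real J * H * Gram J \<omega> l l'"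
      using J H by (simp add: Gram_def pool_avg_def pow_avg_def[of c l'] H_def)
    finally show ?thesis by (simp add: \<kappa>_def mult_ac)
  qed
  have "Determinant.det (Matrix.mat n n (\<lambda>(i, j). Gm $$ (i, j))) \<noteq> 0"
  proof (rule row_kernel_trivial_imp_solution(1))
    fix z i assume z: "\<And>j. j < n \<Longrightarrow> (\<Sum>i<n. z i * Gm $$ (i, j)) = 0" and i: "i < n"
    have "(\<Sum>l<n. (z l * H ^ l) * Gram J \<omega> l l') = 0" if "l' < n" for l'
    proof -
      have "(\<Sum>l<n. z l * Gm $$ (l, l')) = \<kappa> * H ^ l' * (\<Sum>l<n. (z l * H ^ l) * Gram J \<omega> l l')"
        unfolding sum_distrib_left using entry that by (intro sum.cong) auto
      then show ?thesis using z[OF that] \<kappa> H by simp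
    qed
    from ker[OF this i] show "z i = 0" using H by simp
  qed
  moreover have "Matrix.mat n n (\<lambda>(i, j). Gm $$ (i, j)) = Gm" using Gm by (intro eq_matI) auto
  ultimately have det: "Determinant.det Gm \<noteq> 0" by simp
  note I = mat_inv_nonsing[OF Gm det]
  \<comment> \<open>The scaling turns row 0 of the inverse of the actual Gram matrix into a solution
    of the standardized system.\<close>
  define y where "y l = \<kappa> * H ^ l * mat_inv Gm $$ (0, l)" for l
  have n0: "0 < n" by (simp add: n_def)
  have "(\<Sum>l<n. y l * Gram J \<omega> l l') = (if l' = 0 then 1 else 0)" if l': "l' < n" for l'
  proof -
    have "H ^ l' * (\<Sum>l<n. y l * Gram J \<omega> l l') = (\<Sum>l<n. mat_inv Gm $$ (0, l) * Gm $$ (l, l'))"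
      unfolding sum_distrib_left y_def using entry l' by (intro sum.cong) auto
    also have "\<dots> = (mat_inv Gm * Gm) $$ (0, l')"
      using I(1) Gm l' n0 by (simp add: scalar_prod_def atLeast0LessThan)
    also have "\<dots> = (if l' = 0 then 1 else 0)" using I(3) l' n0 by simp
    \<comment> \<open>The factor \<open>H ^ l'\<close> is 1 at l' = 0, and elsewhere the right-hand
      side is 0, so it can be cancelled.\<close>
    finally show ?thesis using H by (auto split: if_splits)
  qed
  moreover have "coef J \<omega> j = \<Omega> (std J \<omega> j) * (\<Sum>l<n. y l * pow_avg c l (std J \<omega> j)) / (real J * h J)" if j: "j < J" for j
  proof -
    have "coef J \<omega> j = w j * (\<Sum>l<n. mat_inv Gm $$ (0, l) * (H ^ l * pow_avg c l (std J \<omega> j)))"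
      unfolding coef_def wls_coef_def w_def[symmetric] Gm_def[symmetric] n_def[symmetric]
      using design[OF j] by (intro arg_cong2[where f="(*)"] sum.cong) auto
    also have "\<dots> = w j * ((\<Sum>l<n. y l * pow_avg c l (std J \<omega> j)) / \<kappa>)"
      unfolding y_def sum_divide_distrib using \<kappa> by (intro arg_cong2[where f="(*)"] sum.cong) auto
    finally show ?thesis
      using \<theta>_pos[of J] J H by (simp add: w_def \<kappa>_def H_def field_simps)
  qed
  ultimately show ?thesis unfolding row_solution_def by blast
qed

lemma Tstat_linear: "Tstat J \<omega> = (\<Sum>j<J. coef J \<omega> j * ((\<Sum>k<c. Y (pool_member (\<lambda>i. X i \<omega>) c J j k) \<omega>) / real c))"
  unfolding Tstat_def coef_def wls_intercept_linear pool_response_def ..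

lemma coef_sum:
  assumes "row_solution J \<omega> y"
  shows "(\<Sum>j<J. coef J \<omega> j * r j)
     = (\<Sum>l<n. y l * ((\<Sum>j<J. \<Omega> (std J \<omega> j) * pow_avg c l (std J \<omega> j) * r j) / (real J * h J)))"
proof -
  have "(\<Sum>j<J. coef J \<omega> j * r j) = (\<Sum>j<J. \<Sum>l<n. y l * (\<Omega> (std J \<omega> j) * pow_avg c l (std J \<omega> j) * r j / (real J * h J)))"
  proof (rule sum.cong[OF refl])
    fix j assume "j \<in> {..<J}"
    then have "coef J \<omega> j * r j = \<Omega> (std J \<omega> j) * (\<Sum>l<n. y l * pow_avg c l (std J \<omega> j)) / (real J * h J) * r j"
      using assms by (simp add: row_solution_def)
    also have "\<dots> = (\<Sum>l<n. y l * (\<Omega> (std J \<omega> j) * pow_avg c l (std J \<omega> j) * r j / (real J * h J)))"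
      unfolding sum_distrib_left sum_divide_distrib sum_distrib_right by (intro sum.cong) auto
    finally show "coef J \<omega> j * r j = (\<Sum>l<n. y l * (\<Omega> (std J \<omega> j) * pow_avg c l (std J \<omega> j) * r j / (real J * h J)))" .
  qed
  also have "\<dots> = (\<Sum>l<n. \<Sum>j<J. y l * (\<Omega> (std J \<omega> j) * pow_avg c l (std J \<omega> j) * r j / (real J * h J)))"
    by (rule sum.swap)
  finally show ?thesis by (simp add: sum_distrib_left sum_divide_distrib)
qed

text \<open>An exact identity. The Taylor polynomial of m contributes the coefficients
  \<open>beta m x l' * h J ^ l'\<close> against the entries of y \<open>Gram\<close>, which is the
  unit row, so only \<open>beta m x 0 = m x\<close> survives. What remains are the residuals and the
  scaled Taylor remainders.\<close>

lemma Tstat_decomposition: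
  assumes y: "row_solution J \<omega> y"
  shows "Tstat J \<omega> - m x = (\<Sum>l<n. y l * Noise J \<omega> l) + h J ^ (p + 1) * (\<Sum>l<n. y l * Bias J \<omega> l)"
proof -
  define mem where "mem j k = pool_member (\<lambda>i. X i \<omega>) c J j k" for j k
  have Hne: "h J ^ (p + 1) \<noteq> 0" using h_pos[of J] by simp
  have mX: "m (X (mem j k) \<omega>) = (\<Sum>l'<n. beta m x l' * h J ^ l' * std J \<omega> j k ^ l')
      + h J ^ (p + 1) * scaled_remainder m p x (h J) (std J \<omega> j k)" for j k
    using Hne unfolding mem_def std_eq scaled_remainder_def n_def by (simp add: power_mult_distrib mult.assoc)
  have resp: "(\<Sum>k<c. Y (mem j k) \<omega>) / real c
      = (\<Sum>k<c. Y (mem j k) \<omega> - m (X (mem j k) \<omega>)) / real c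
        + (\<Sum>l'<n. beta m x l' * h J ^ l' * pow_avg c l' (std J \<omega> j))
        + h J ^ (p + 1) * ((\<Sum>k<c. scaled_remainder m p x (h J) (std J \<omega> j k)) / real c)" for j
  proof -
    have "(\<Sum>k<c. Y (mem j k) \<omega>) = (\<Sum>k<c. Y (mem j k) \<omega> - m (X (mem j k) \<omega>)) + (\<Sum>k<c. m (X (mem j k) \<omega>))"
      by (simp add: sum_subtractf)
    also have "(\<Sum>k<c. m (X (mem j k) \<omega>)) = (\<Sum>l'<n. beta m x l' * h J ^ l' * (\<Sum>k<c. std J \<omega> j k ^ l'))
        + h J ^ (p + 1) * (\<Sum>k<c. scaled_remainder m p x (h J) (std J \<omega> j k))"
      unfolding mX sum.distrib sum_distrib_left by (subst sum.swap) (rule refl)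
    finally show ?thesis
      by (simp only: add_divide_distrib pow_avg_def times_divide_eq_right sum_divide_distrib[where A="{..<n}"] add.assoc)
  qed
  have R: "(\<Sum>j<J. \<Omega> (std J \<omega> j) * pow_avg c l (std J \<omega> j) * ((\<Sum>k<c. Y (mem j k) \<omega>) / real c)) / (real J * h J)
      = Noise J \<omega> l + (\<Sum>l'<n. beta m x l' * h J ^ l' * Gram J \<omega> l l') + h J ^ (p + 1) * Bias J \<omega> l" for l
  proof -
    define a where "a j = \<Omega> (std J \<omega> j) * pow_avg c l (std J \<omega> j)" for j
    have N: "Noise J \<omega> l = (\<Sum>j<J. a j * ((\<Sum>k<c. Y (mem j k) \<omega> - m (X (mem j k) \<omega>)) / real c)) / (real J * h J)"
      by (simp add: Noise_def a_def mem_def Let_def)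
    have Gr: "Gram J \<omega> l l' = (\<Sum>j<J. a j * pow_avg c l' (std J \<omega> j)) / (real J * h J)" for l'
      by (simp add: Gram_def pool_avg_def a_def pow_avg_def[of c l'])
    have B: "Bias J \<omega> l = (\<Sum>j<J. a j * ((\<Sum>k<c. scaled_remainder m p x (h J) (std J \<omega> j k)) / real c)) / (real J * h J)"
      by (simp add: Bias_def pool_avg_def a_def)
    have "(\<Sum>j<J. a j * (\<Sum>l'<n. beta m x l' * h J ^ l' * pow_avg c l' (std J \<omega> j)))
        = (\<Sum>l'<n. beta m x l' * h J ^ l' * (\<Sum>j<J. a j * pow_avg c l' (std J \<omega> j)))"
      unfolding sum_distrib_left by (subst sum.swap) (simp add: mult_ac)
    moreover have "(\<Sum>j<J. a j * (h J ^ (p + 1) * ((\<Sum>k<c. scaled_remainder m p x (h J) (std J \<omega> j k)) / real c)))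
        = h J ^ (p + 1) * (\<Sum>j<J. a j * ((\<Sum>k<c. scaled_remainder m p x (h J) (std J \<omega> j k)) / real c))"
      unfolding sum_distrib_left by (simp only: mult.left_commute)
    ultimately show ?thesis
      unfolding a_def[symmetric] resp distrib_left sum.distrib add_divide_distrib N B Gr
      by (simp only: times_divide_eq_right sum_divide_distrib[where A="{..<n}"])
  qed
  have "(\<Sum>l<n. y l * (\<Sum>l'<n. beta m x l' * h J ^ l' * Gram J \<omega> l l'))
      = (\<Sum>l'<n. beta m x l' * h J ^ l' * (\<Sum>l<n. y l * Gram J \<omega> l l'))"
    unfolding sum_distrib_left by (subst sum.swap) (simp add: mult_ac)
  also have "\<dots> = (\<Sum>l'<n. if l' = 0 then beta m x 0 else 0)"
    using y by (intro sum.cong) (auto simp: row_solution_def)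
  also have "\<dots> = m x" by (simp add: n_def beta_def sum.delta)
  finally have mx: "(\<Sum>l<n. y l * (\<Sum>l'<n. beta m x l' * h J ^ l' * Gram J \<omega> l l')) = m x" .
  have "Tstat J \<omega> = (\<Sum>l<n. y l * (Noise J \<omega> l + (\<Sum>l'<n. beta m x l' * h J ^ l' * Gram J \<omega> l l') + h J ^ (p + 1) * Bias J \<omega> l))"
    unfolding Tstat_linear mem_def[symmetric] coef_sum[OF y] R ..
  also have "\<dots> = (\<Sum>l<n. y l * Noise J \<omega> l) + m x + h J ^ (p + 1) * (\<Sum>l<n. y l * Bias J \<omega> l)"
  proof -
    have "(\<Sum>l<n. y l * (h J ^ (p + 1) * Bias J \<omega> l)) = h J ^ (p + 1) * (\<Sum>l<n. y l * Bias J \<omega> l)"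
      unfolding sum_distrib_left by (simp only: mult.left_commute)
    then show ?thesis by (simp only: distrib_left sum.distrib mx)
  qed
  finally show ?thesis by simp
qed

definition Vstat :: "nat \<Rightarrow> 'a \<Rightarrow> real" where
  "Vstat J \<omega> = (\<Sum>j<J. (coef J \<omega> j / real c)\<^sup>2 * (\<Sum>k<c. \<sigma>2 (X (pool_member (\<lambda>i. X i \<omega>) c J j k) \<omega>)))"

text \<open>Each pool contributes its squared coefficient times 1/c times its average of
  \<open>\<sigma>2\<close>. Of the two factors 1 / (J h) in the squared coefficient, one normalizes
  \<open>Vmat\<close> and the other joins 1/c to form the squared rate.\<close>

lemma Vstat_quadratic:
  assumes y: "row_solution J \<omega> y"
  shows "Vstat J \<omega> = rate J ^ 2 * (\<Sum>l<n. \<Sum>l'<n. y l * y l' * Vmat J \<omega> l l')"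
proof -
  define a where "a j l = \<Omega> (std J \<omega> j) * pow_avg c l (std J \<omega> j)" for j l
  define s where "s j = (\<Sum>k<c. \<sigma>2 (x + h J * std J \<omega> j k)) / real c" for j
  have V: "Vmat J \<omega> l l' = (\<Sum>j<J. a j l * a j l' * s j) / (real J * h J)" for l l'
    by (simp add: Vmat_def pool_avg_def a_def s_def)
  have "(\<Sum>l<n. \<Sum>l'<n. y l * y l' * Vmat J \<omega> l l')
      = (\<Sum>l<n. \<Sum>l'<n. \<Sum>j<J. (y l * a j l) * (y l' * a j l') * s j / (real J * h J))"
    unfolding V times_divide_eq_right sum_distrib_left sum_divide_distrib
    by (intro sum.cong refl) (simp add: mult_ac)
  also have "\<dots> = (\<Sum>l<n. \<Sum>j<J. \<Sum>l'<n. (y l * a j l) * (y l' * a j l') * s j / (real J * h J))"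
    by (intro sum.cong refl sum.swap)
  also have "\<dots> = (\<Sum>j<J. \<Sum>l<n. \<Sum>l'<n. (y l * a j l) * (y l' * a j l') * s j / (real J * h J))"
    by (rule sum.swap)
  also have "\<dots> = (\<Sum>j<J. (\<Sum>l<n. y l * a j l)\<^sup>2 * s j / (real J * h J))"
    unfolding power2_eq_square sum_product by (simp add: sum_distrib_right sum_divide_distrib)
  finally have Q: "(\<Sum>l<n. \<Sum>l'<n. y l * y l' * Vmat J \<omega> l l') = (\<Sum>j<J. (\<Sum>l<n. y l * a j l)\<^sup>2 * s j / (real J * h J))" .
  show ?thesis
    unfolding Q Vstat_def sum_distrib_left[where A="{..<J}"] std_eq
  proof (rule sum.cong[OF refl])
    fix j assume j: "j \<in> {..<J}"
    then have J: "0 < J" by auto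
    define q where "q = (\<Sum>l<n. y l * a j l)"
    have cf: "coef J \<omega> j = q / (real J * h J)"
      using y j unfolding q_def by (simp add: row_solution_def a_def sum_distrib_left mult_ac)
    have sm: "(\<Sum>k<c. \<sigma>2 (x + h J * std J \<omega> j k)) = real c * s j" using c1 by (simp add: s_def)
    show "(coef J \<omega> j / real c)\<^sup>2 * (\<Sum>k<c. \<sigma>2 (x + h J * std J \<omega> j k))
        = rate J ^ 2 * ((\<Sum>l<n. y l * a j l)\<^sup>2 * s j / (real J * h J))"
      unfolding cf sm rate_sq q_def[symmetric]
      using J c1 h_pos[of J] by (simp add: field_simps power2_eq_square)
  qed
qed

section \<open>The estimator as a combination of individual responses\<close>

definition response_coef :: "nat \<Rightarrow> nat \<Rightarrow> (nat \<Rightarrow> real) \<Rightarrow> real" where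
  "response_coef J i xs =
     spread_coef xs c J (wls_coef p x xs c J (\<lambda>j. \<theta> J * \<Omega> (pool_std xs c J x (h J) j))) i"

lemma response_coef_measurable:
  "response_coef J i \<in> borel_measurable (PiM {..<c * J} (\<lambda>_. borel))"
  unfolding response_coef_def
proof (rule spread_coef_measurable[of c J "\<lambda>i xs. xs i", OF component_measurable])
  fix j assume j: "j < J"
  show "(\<lambda>xs. wls_coef p x xs c J (\<lambda>j. \<theta> J * \<Omega> (pool_std xs c J x (h J) j)) j)
      \<in> borel_measurable (PiM {..<c * J} (\<lambda>_. borel))"
    by (rule wls_coef_measurable[of c J "\<lambda>i xs. xs i", OF component_measurable _ j])
      (auto intro!: borel_measurable_times borel_measurable_const \<Omega>_pool_std_measurable)
qed

lemma response_coef_covariates: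
  "response_coef J i (covariates (c * J) \<omega>) = spread_coef (\<lambda>i. X i \<omega>) c J (coef J \<omega>) i"
  unfolding response_coef_def
proof (rule spread_coef_cong)
  show X: "covariates (c * J) \<omega> i = X i \<omega>" if "i < c * J" for i using that by (simp add: covariates_def)
  fix j assume "j < J"
  then show "wls_coef p x (covariates (c * J) \<omega>) c J (\<lambda>j. \<theta> J * \<Omega> (pool_std (covariates (c * J) \<omega>) c J x (h J) j)) j
      = coef J \<omega> j"
    unfolding coef_def by (intro wls_coef_cong X) (auto simp: \<Omega>_covariates)
qed

lemma Tstat_responses: "Tstat J \<omega> = (\<Sum>i<c * J. response_coef J i (covariates (c * J) \<omega>) * Y i \<omega>)"
  unfolding response_coef_covariates by (subst sum_spread_coef) (simp add: Tstat_linear)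

lemma Vstat_responses: "Vstat J \<omega> = (\<Sum>i<c * J. (response_coef J i (covariates (c * J) \<omega>))\<^sup>2 * \<sigma>2 (X i \<omega>))"
  unfolding response_coef_covariates by (subst sum_spread_coef_sq) (simp add: Vstat_def)

lemma response_coef_covariates_measurable [measurable]:
  "(\<lambda>\<omega>. response_coef J i (covariates (c * J) \<omega>)) \<in> borel_measurable M"
  by (rule measurable_compose[OF covariates_meas response_coef_measurable])

lemma Tstat_measurable [measurable]: "Tstat J \<in> borel_measurable M"
  unfolding Tstat_responses[abs_def] by measurable

lemma Vstat_measurable [measurable]: "Vstat J \<in> borel_measurable M"
  unfolding Vstat_responses[abs_def] by measurable

lemma Tstat_cond_var:
  assumes "1 \<le> J"
  shows "has_cond_var M (cov_sigma M X (c * J)) (Tstat J) (Vstat J)"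
proof -
  have "1 \<le> c * J" using assms c1 by simp
  from has_cond_var_linear[OF this, of "response_coef J"] response_coef_measurable show ?thesis
    unfolding Tstat_responses[abs_def] Vstat_responses[abs_def] by blast
qed


section \<open>The limiting linear system\<close>

definition Sinv :: "nat \<Rightarrow> nat \<Rightarrow> real" where
  "Sinv i j = mat_inv (mu_mat G p 0) $$ (i, j)"

lemma mu_mat_carrier: "mu_mat G p l \<in> carrier_mat n n"
  by (simp add: mu_mat_def n_def)

lemma mu_mat_entry: "i < n \<Longrightarrow> j < n \<Longrightarrow> mu_mat G p l $$ (i, j) = mu G (i + j + l)"
  by (simp add: mu_mat_def n_def)

lemma mat_inv_mu_carrier: "mat_inv (mu_mat G p 0) \<in> carrier_mat n n"
  by (rule mat_inv_carrier[OF mu_mat_carrier])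

lemma n_pos: "0 < n"
  by (simp add: n_def)

lemma mu_Sinv:
  assumes "i < n" "k < n"
  shows "(\<Sum>j<n. mu G (i + j) * Sinv j k) = (if i = k then 1 else 0)"
    and "(\<Sum>j<n. Sinv i j * mu G (j + k)) = (if i = k then 1 else 0)"
proof -
  have d: "Determinant.det (mu_mat G p 0) \<noteq> 0"
    using invertible_imp_det_nonzero[OF mu_mat_carrier mu_inv] .
  note I = mat_inv_nonsing[OF mu_mat_carrier d]
  have "(mu_mat G p 0 * mat_inv (mu_mat G p 0)) $$ (i, k) = (\<Sum>j<n. mu G (i + j) * Sinv j k)"
    using assms I(1) mu_mat_carrier[of 0]
    by (auto simp: scalar_prod_def atLeast0LessThan Sinv_def mu_mat_entry intro!: sum.cong)
  then show "(\<Sum>j<n. mu G (i + j) * Sinv j k) = (if i = k then 1 else 0)"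
    using I(2) assms by simp
  have "(mat_inv (mu_mat G p 0) * mu_mat G p 0) $$ (i, k) = (\<Sum>j<n. Sinv i j * mu G (j + k))"
    using assms I(1) mu_mat_carrier[of 0]
    by (auto simp: scalar_prod_def atLeast0LessThan Sinv_def mu_mat_entry intro!: sum.cong)
  then show "(\<Sum>j<n. Sinv i j * mu G (j + k)) = (if i = k then 1 else 0)"
    using I(3) assms by simp
qed

text \<open>The moment matrix is symmetric because its entries depend on i + j only, and so is its
  inverse. In the variance constant this exchanges column 0 of the inverse for row 0.\<close>

lemma Sinv_sym:
  assumes "i < n" "j < n"
  shows "Sinv j i = Sinv i j"
proof -
  have "Sinv j i = (\<Sum>k<n. (if i = k then 1 else 0) * Sinv j k)" using assms by (simp add: mult_delta_left)
  also have "\<dots> = (\<Sum>k<n. (\<Sum>l<n. Sinv i l * mu G (l + k)) * Sinv j k)"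
    using mu_Sinv(2)[OF assms(1)] by (intro sum.cong) auto
  also have "\<dots> = (\<Sum>l<n. Sinv i l * (\<Sum>k<n. Sinv j k * mu G (k + l)))"
    unfolding sum_distrib_left sum_distrib_right by (subst sum.swap) (simp add: mult_ac add.commute)
  also have "\<dots> = (\<Sum>l<n. Sinv i l * (if j = l then 1 else 0))"
    using mu_Sinv(2)[OF assms(2)] by (intro sum.cong) auto
  also have "\<dots> = Sinv i j" using assms by (simp add: mult_delta_right)
  finally show ?thesis .
qed

lemma mu_solve:
  assumes "i < n"
  shows "(\<Sum>j<n. mu G (i + j) * (\<Sum>k<n. Sinv j k * v k)) = v i"
proof -
  have "(\<Sum>j<n. mu G (i + j) * (\<Sum>k<n. Sinv j k * v k)) = (\<Sum>k<n. (\<Sum>j<n. mu G (i + j) * Sinv j k) * v k)"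
    unfolding sum_distrib_left sum_distrib_right by (subst sum.swap) (simp add: mult_ac)
  also have "\<dots> = (\<Sum>k<n. (if i = k then 1 else 0) * v k)"
    using mu_Sinv(1)[OF assms] by (intro sum.cong) auto
  also have "\<dots> = v i" using assms by (simp add: mult_delta_left)
  finally show ?thesis .
qed

lemma mat_inv_mult_vec:
  assumes "v \<in> carrier_vec n" "l < n"
  shows "(mat_inv (mu_mat G p 0) *\<^sub>v v) $ l = (\<Sum>k<n. Sinv l k * v $ k)"
  using assms mat_inv_mu_carrier by (auto simp: scalar_prod_def atLeast0LessThan Sinv_def intro!: sum.cong)

lemma mu_mat_mult_vec:
  assumes "v \<in> carrier_vec n" "l < n"
  shows "(mu_mat G p i *\<^sub>v v) $ l = (\<Sum>k<n. mu G (l + k + i) * v $ k)"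
  using assms mu_mat_carrier[of i] by (auto simp: scalar_prod_def atLeast0LessThan mu_mat_entry intro!: sum.cong)

text \<open>Entry l of the inverse moment matrix applied to \<open>mu_vec G p q\<close>.\<close>

definition sol :: "nat \<Rightarrow> nat \<Rightarrow> real" where
  "sol q l = (\<Sum>k<n. Sinv l k * mu G (q + k))"

text \<open>Entry l of the correction vector in which \<open>mu_mat G p 1\<close> stands between two
  inverse moment matrices, applied to \<open>mu_vec G p (p + 1)\<close>.\<close>

definition sol' :: "nat \<Rightarrow> real" where
  "sol' l = (\<Sum>k<n. Sinv l k * (\<Sum>i<n. mu G (k + i + 1) * sol (p + 1) i))"

lemma bias_vec_entry:
  assumes "l < n"
  shows "bias_vec G p m f x H $ l = beta m x (p + 1) * sol (p + 1) l + H / f x *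
     ((beta m x (p + 2) * f x + beta m x (p + 1) * deriv f x) * sol (p + 2) l - beta m x (p + 1) * deriv f x * sol' l)"
    and "bias_vec G p m f x H \<in> carrier_vec n"
proof -
  define S where "S = mat_inv (mu_mat G p 0)"
  have S: "S \<in> carrier_mat n n" by (simp add: S_def mat_inv_mu_carrier)
  have v: "mu_vec G p q \<in> carrier_vec n" for q by (simp add: mu_vec_def n_def)
  have v_entry: "mu_vec G p q $ k = mu G (q + k)" if "k < n" for q k using that by (simp add: mu_vec_def n_def)
  have s: "S *\<^sub>v mu_vec G p q \<in> carrier_vec n" for q using S v by (rule mult_mat_vec_carrier)
  have s_entry: "(S *\<^sub>v mu_vec G p q) $ k = sol q k" if "k < n" for q k
    unfolding S_def mat_inv_mult_vec[OF v that] sol_def using v_entry by (intro sum.cong) auto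
  have t: "mu_mat G p 1 *\<^sub>v (S *\<^sub>v mu_vec G p (p + 1)) \<in> carrier_vec n"
    using mu_mat_carrier s by (rule mult_mat_vec_carrier)
  have t_entry: "(mu_mat G p 1 *\<^sub>v (S *\<^sub>v mu_vec G p (p + 1))) $ k = (\<Sum>i<n. mu G (k + i + 1) * sol (p + 1) i)" if "k < n" for k
    unfolding mu_mat_mult_vec[OF s that] using s_entry by (intro sum.cong) auto
  have st: "S *\<^sub>v (mu_mat G p 1 *\<^sub>v (S *\<^sub>v mu_vec G p (p + 1))) \<in> carrier_vec n"
    using S t by (rule mult_mat_vec_carrier)
  have st_entry: "(S *\<^sub>v (mu_mat G p 1 *\<^sub>v (S *\<^sub>v mu_vec G p (p + 1)))) $ k = sol' k" if "k < n" for k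
    using mat_inv_mult_vec[OF t that] t_entry unfolding S_def[symmetric] sol'_def by simp
  note eq = bias_vec_def Let_def S_def[symmetric]
  show "bias_vec G p m f x H \<in> carrier_vec n"
    unfolding eq using s st by auto
  show "bias_vec G p m f x H $ l = beta m x (p + 1) * sol (p + 1) l + H / f x *
     ((beta m x (p + 2) * f x + beta m x (p + 1) * deriv f x) * sol (p + 2) l - beta m x (p + 1) * deriv f x * sol' l)"
    unfolding eq using carrier_vecD[OF s] carrier_vecD[OF st] assms s_entry[OF assms] st_entry[OF assms]
    by (simp del: index_mult_mat_vec dim_mult_mat_vec)
qed

lemma var_const_eq: "var_const G p = (\<Sum>l<n. \<Sum>l'<n. Sinv 0 l * Sinv 0 l' * nu G (l + l'))"
proof -
  define S where "S = mat_inv (mu_mat G p 0)"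
  have S: "S \<in> carrier_mat n n" by (simp add: S_def mat_inv_mu_carrier)
  have e: "unit_vec n 0 \<in> carrier_vec n" by simp
  have se: "S *\<^sub>v unit_vec n 0 \<in> carrier_vec n" using S e by (rule mult_mat_vec_carrier)
  have se_entry: "(S *\<^sub>v unit_vec n 0) $ k = Sinv 0 k" if k: "k < n" for k
  proof -
    have "(S *\<^sub>v unit_vec n 0) $ k = (\<Sum>i<n. Sinv k i * unit_vec n 0 $ i)"
      unfolding S_def by (rule mat_inv_mult_vec[OF e k])
    also have "\<dots> = (\<Sum>i<n. if i = 0 then Sinv k 0 else 0)" by (intro sum.cong) auto
    also have "\<dots> = Sinv k 0" using n_pos by (simp add: sum.delta)
    finally show ?thesis using Sinv_sym[OF n_pos k] by simp
  qed
  have N: "nu_mat G p \<in> carrier_mat n n" by (simp add: nu_mat_def n_def)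
  have ne: "nu_mat G p *\<^sub>v (S *\<^sub>v unit_vec n 0) \<in> carrier_vec n" using N se by (rule mult_mat_vec_carrier)
  have ne_entry: "(nu_mat G p *\<^sub>v v) $ k = (\<Sum>i<n. nu G (k + i) * v $ i)" if "k < n" "v \<in> carrier_vec n" for v k
    using that N by (auto simp: scalar_prod_def atLeast0LessThan nu_mat_def n_def intro!: sum.cong)
  have "var_const G p = unit_vec n 0 \<bullet> (S *\<^sub>v (nu_mat G p *\<^sub>v (S *\<^sub>v unit_vec n 0)))"
    by (simp add: var_const_def Let_def S_def n_def)
  also have "\<dots> = (S *\<^sub>v (nu_mat G p *\<^sub>v (S *\<^sub>v unit_vec n 0))) $ 0"
    using mult_mat_vec_carrier[OF S ne] n_pos by (intro scalar_prod_left_unit)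
  also have "\<dots> = (\<Sum>l<n. Sinv 0 l * (nu_mat G p *\<^sub>v (S *\<^sub>v unit_vec n 0)) $ l)"
    unfolding S_def by (rule mat_inv_mult_vec[OF ne[unfolded S_def] n_pos])
  also have "\<dots> = (\<Sum>l<n. Sinv 0 l * (\<Sum>l'<n. nu G (l + l') * Sinv 0 l'))"
    using ne_entry[OF _ se] se_entry by (intro sum.cong) auto
  finally show ?thesis by (simp add: sum_distrib_left mult_ac)
qed

text \<open>The quadratic form is the integral of \<open>(q G)\<^sup>2\<close> for the polynomial \<open>q\<close> with coefficients
  \<open>Sinv 0\<close>; if it vanished, so would \<open>\<integral>q G\<close>, which is the \<open>(0, 0)\<close> entry of the identity.\<close>

lemma var_const_nonzero: "var_const G p \<noteq> 0"
proof
  assume vc: "var_const G p = 0"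
  define q where "q t = (\<Sum>l<n. Sinv 0 l * t ^ l)" for t :: real
  have [measurable]: "q \<in> borel_measurable borel" unfolding q_def by measurable
  obtain L where L: "near_diag L c (\<lambda>u. \<Omega> u * pow_avg c 0 u) (\<lambda>t. G t * t ^ 0)" using near_l by blast
  have Gb: "\<bar>G t\<bar> \<le> L" for t using kernel_bounded[OF L, of t] G_van by simp
  have G2: "2 < \<bar>t\<bar> \<Longrightarrow> G t = 0" for t using G_van by simp
  have mono: "integrable lborel (\<lambda>t. G t * t ^ l)" "integrable lborel (\<lambda>t. G t * (G t * t ^ l))" for l
  proof -
    have b: "\<bar>t ^ l\<bar> \<le> 2 ^ l" if "\<bar>t\<bar> \<le> 2" for t :: real
      using power_mono[OF that, of l] by (simp add: power_abs)
    show "integrable lborel (\<lambda>t. G t * t ^ l)"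
      by (rule compact_kernel_integral(1)[OF _ _ G2 Gb b]) auto
    show "integrable lborel (\<lambda>t. G t * (G t * t ^ l))"
    proof (rule compact_kernel_integral(1)[OF _ _ G2 Gb])
      show "\<bar>G t * t ^ l\<bar> \<le> L * 2 ^ l" if "\<bar>t\<bar> \<le> 2" for t
        unfolding abs_mult using Gb[of t] b[OF that] order_trans[OF abs_ge_zero Gb[of t]] by (intro mult_mono) auto
    qed auto
  qed
  have expand: "(q t * G t)\<^sup>2 = (\<Sum>l<n. \<Sum>l'<n. Sinv 0 l * Sinv 0 l' * (G t * (G t * t ^ (l + l'))))" for t
    unfolding q_def power2_eq_square sum_product sum_distrib_right sum_distrib_left
    by (simp add: power_add mult_ac)
  have int_sq: "integrable lborel (\<lambda>t. (q t * G t)\<^sup>2)"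
    unfolding expand using mono by (intro Bochner_Integration.integrable_sum integrable_mult_right) auto
  have nu: "nu G l = (\<integral>t. G t * (G t * t ^ l) \<partial>lborel)" for l
    unfolding nu_def by (intro Bochner_Integration.integral_cong) (auto simp: power2_eq_square)
  have "(\<integral>t. (q t * G t)\<^sup>2 \<partial>lborel) = var_const G p"
    unfolding expand var_const_eq nu using mono
    by (subst Bochner_Integration.integral_sum; (intro Bochner_Integration.integrable_sum integrable_mult_right sum.cong refl)?; simp)
  then have "(\<integral>t. (q t * G t)\<^sup>2 \<partial>lborel) = 0" using vc by simp
  then have "AE t in lborel. (q t * G t)\<^sup>2 = 0"
    using integral_nonneg_eq_0_iff_AE[OF int_sq] by simp
  then have ae: "AE t in lborel. q t * G t = 0" by simp
  have "(\<integral>t. q t * G t \<partial>lborel) = (\<integral>t. 0 \<partial>(lborel :: real measure))"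
    by (intro integral_cong_AE) (use ae in auto)
  moreover have "(\<integral>t. q t * G t \<partial>lborel) = (\<integral>t. (\<Sum>l<n. Sinv 0 l * (G t * t ^ l)) \<partial>lborel)"
    by (intro Bochner_Integration.integral_cong) (auto simp: q_def sum_distrib_left sum_distrib_right mult_ac)
  moreover have "\<dots> = (\<Sum>l<n. Sinv 0 l * mu G (l + 0))"
  proof -
    have "mu G l = (\<integral>t. G t * t ^ l \<partial>lborel)" for l by (simp add: mu_def mult.commute)
    then show ?thesis using mono(1) by simp
  qed
  ultimately show False using mu_Sinv(2)[OF n_pos n_pos] by simp
qed

definition Gram_lim :: "nat \<Rightarrow> nat \<Rightarrow> real" where
  "Gram_lim l l' = f x * mu G (l + l')"

text \<open>\<open>near_invertible_row_bound\<close> at f(x) times the moment matrix, whose inverse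
  is \<open>Sinv\<close> divided by f(x). Both \<delta> and K are fixed before the perturbed matrix
  A is given.\<close>

lemma Gram_lim_row_bound:
  "\<exists>\<delta>>0. \<exists>K\<ge>0. \<forall>A z w k. (\<forall>i<n. \<forall>j<n. \<bar>A i j - Gram_lim i j\<bar> \<le> \<delta>) \<longrightarrow>
     (\<forall>j<n. \<bar>\<Sum>i<n. z i * A i j\<bar> \<le> w) \<longrightarrow> k < n \<longrightarrow> \<bar>z k\<bar> \<le> K * w"
proof -
  define S where "S j k = Sinv j k / f x" for j k
  define \<beta> where "\<beta> = 1 + (\<Sum>j<n. \<Sum>k<n. \<bar>S j k\<bar>)"
  \<comment> \<open>Turns the smallness condition of \<open>near_invertible_row_bound\<close> into
    an equality.\<close>
  define \<delta> where "\<delta> = 1 / (2 * (real n * real n * \<beta>))"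
  have \<beta>1: "1 \<le> \<beta>" unfolding \<beta>_def by (simp add: sum_nonneg)
  have S: "\<bar>S j k\<bar> \<le> \<beta>" if "j < n" "k < n" for j k
  proof -
    have "\<bar>S j k\<bar> \<le> (\<Sum>k<n. \<bar>S j k\<bar>)" using that by (intro member_le_sum) auto
    also have "\<dots> \<le> (\<Sum>j<n. \<Sum>k<n. \<bar>S j k\<bar>)"
      using that by (intro member_le_sum[of j "{..<n}" "\<lambda>j. \<Sum>k<n. \<bar>S j k\<bar>"]) (auto intro: sum_nonneg)
    finally show ?thesis by (simp add: \<beta>_def)
  qed
  have inv: "(\<Sum>j<n. Gram_lim i j * S j k) = (if i = k then 1 else 0)" if "i < n" "k < n" for i k
    using mu_Sinv(1)[OF that] fx by (simp add: Gram_lim_def S_def)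
  have n\<beta>: "0 < real n * real n * \<beta>" using n_pos \<beta>1 by simp
  have "\<bar>z k\<bar> \<le> 2 * real n * \<beta> * w"
    if "\<forall>i<n. \<forall>j<n. \<bar>A i j - Gram_lim i j\<bar> \<le> \<delta>" "\<forall>j<n. \<bar>\<Sum>i<n. z i * A i j\<bar> \<le> w" "k < n" for A z w k
    by (rule near_invertible_row_bound[of n Gram_lim S \<beta> A \<delta> z w k])
      (use that inv S n\<beta> in \<open>auto simp: \<delta>_def\<close>)
  moreover have "0 < \<delta>" using n\<beta> by (simp add: \<delta>_def)
  moreover have "0 \<le> 2 * real n * \<beta>" using \<beta>1 by simp
  ultimately show ?thesis by blast
qed


section \<open>Expansion of the estimator\<close>

lemma Gram0_close:
  "\<exists>C\<ge>0. \<forall>\<^sub>F J in sequentially. \<forall>l<n. \<forall>l'<n. \<bar>Gram0 J l l' - Gram_lim l l'\<bar> \<le> C * h J"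
proof -
  have "\<exists>C\<ge>0. \<forall>\<^sub>F J in sequentially. \<bar>Gram0 J (fst i) (snd i) - Gram_lim (fst i) (snd i)\<bar> \<le> C * h J" for i
  proof -
    obtain C where C: "C \<ge> 0" "\<forall>\<^sub>F J in sequentially.
       \<bar>Gram0 J (fst i) (snd i) - (f x * mu G (fst i + snd i) + h J * deriv f x * mu G (fst i + snd i + 1))\<bar> \<le> C * h J ^ 2"
      using Gram0_limit by blast
    define a where "a = deriv f x * mu G (fst i + snd i + 1)"
    have "\<forall>\<^sub>F J in sequentially. \<bar>Gram0 J (fst i) (snd i) - Gram_lim (fst i) (snd i)\<bar> \<le> (C + \<bar>a\<bar>) * h J"
      using C(2) h_le_1
    proof eventually_elim
      case (elim J)
      have "h J ^ 2 \<le> h J" using elim(2) h_pos[of J] by (simp add: power2_eq_square mult_left_le)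
      then have "C * h J ^ 2 \<le> C * h J" using C(1) by (rule mult_left_mono)
      moreover have "\<bar>h J * a\<bar> = \<bar>a\<bar> * h J" using h_pos[of J] by (simp add: abs_mult)
      moreover have "h J * deriv f x * mu G (fst i + snd i + 1) = h J * a" by (simp add: a_def)
      ultimately show ?case using elim(1) unfolding Gram_lim_def distrib_right by linarith
    qed
    then show ?thesis using C(1) by (intro exI[of _ "C + \<bar>a\<bar>"]) auto
  qed
  then have "\<exists>C\<ge>0. \<forall>\<^sub>F J in sequentially. \<forall>i\<in>{..<n} \<times> {..<n}. \<bar>Gram0 J (fst i) (snd i) - Gram_lim (fst i) (snd i)\<bar> \<le> C * h J"
    by (intro eventually_uniform_bound) (auto intro: less_imp_le[OF h_pos])
  then obtain C where "0 \<le> C" and C: "\<forall>\<^sub>F J in sequentially. \<forall>i\<in>{..<n} \<times> {..<n}. \<bar>Gram0 J (fst i) (snd i) - Gram_lim (fst i) (snd i)\<bar> \<le> C * h J" by blast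
  then show ?thesis by (intro exI[of _ C] conjI eventually_mono[OF C]) auto
qed

lemma Vmat0_close:
  "\<exists>C\<ge>0. \<forall>\<^sub>F J in sequentially. \<forall>l<n. \<forall>l'<n. \<bar>Vmat0 J l l' - \<sigma>2 x * f x * nu G (l + l')\<bar> \<le> C * h J"
proof -
  have "\<exists>C\<ge>0. \<forall>\<^sub>F J in sequentially. \<forall>i\<in>{..<n} \<times> {..<n}.
      \<bar>Vmat0 J (fst i) (snd i) - \<sigma>2 x * f x * nu G (fst i + snd i)\<bar> \<le> C * h J"
    using Vmat0_limit by (intro eventually_uniform_bound) (auto intro: less_imp_le[OF h_pos])
  then obtain C where "0 \<le> C" and C: "\<forall>\<^sub>F J in sequentially. \<forall>i\<in>{..<n} \<times> {..<n}.
      \<bar>Vmat0 J (fst i) (snd i) - \<sigma>2 x * f x * nu G (fst i + snd i)\<bar> \<le> C * h J" by blast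
  then show ?thesis by (intro exI[of _ C] conjI eventually_mono[OF C]) auto
qed

lemma Bias0_bounded: "\<exists>C\<ge>0. \<forall>\<^sub>F J in sequentially. \<forall>l<n. \<bar>Bias0 J l\<bar> \<le> C"
proof -
  have "\<exists>C\<ge>0. \<forall>\<^sub>F J in sequentially. \<bar>Bias0 J l\<bar> \<le> C * 1" for l
  proof -
    define a where "a = beta m x (p + 1) * f x * mu G (l + (p + 1))"
    define b where "b = (beta m x (p + 2) * f x + beta m x (p + 1) * deriv f x) * mu G (l + (p + 2))"
    obtain C where C: "C \<ge> 0" "\<forall>\<^sub>F J in sequentially. \<bar>Bias0 J l - (a + h J * b)\<bar> \<le> C * h J ^ 2"
      using Bias0_limit[of l] unfolding a_def b_def by blast
    have "\<forall>\<^sub>F J in sequentially. \<bar>Bias0 J l\<bar> \<le> (C + \<bar>a\<bar> + \<bar>b\<bar>) * 1"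
      using C(2) h_le_1
    proof eventually_elim
      case (elim J)
      have "C * h J ^ 2 \<le> C * 1"
        using elim(2) h_pos[of J] C(1) power_mono[of "h J" 1 2] by (intro mult_left_mono) auto
      moreover have "\<bar>h J * b\<bar> \<le> 1 * \<bar>b\<bar>"
        unfolding abs_mult using elim(2) h_pos[of J] by (intro mult_right_mono) auto
      moreover have "\<bar>Bias0 J l\<bar> \<le> \<bar>Bias0 J l - (a + h J * b)\<bar> + \<bar>a\<bar> + \<bar>h J * b\<bar>" by arith
      ultimately show ?case using elim(1) by simp
    qed
    then show ?thesis using C(1) by (intro exI[of _ "C + \<bar>a\<bar> + \<bar>b\<bar>"]) auto
  qed
  then have "\<exists>C\<ge>0. \<forall>\<^sub>F J in sequentially. \<forall>l\<in>{..<n}. \<bar>Bias0 J l\<bar> \<le> C * 1"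
    by (intro eventually_uniform_bound) auto
  then show ?thesis by (simp add: Ball_def)
qed

text \<open>The claimed vector is substituted into the system with matrix \<open>Gram0\<close> and
  right-hand side \<open>Bias0\<close>. Orders 1 and h agree exactly; the residual consists of the
  error terms of the two expansions and one explicit term, all of order h^2.\<close>

lemma bias_vec_residual:
  "\<exists>C\<ge>0. \<forall>\<^sub>F J in sequentially. \<forall>l<n.
     \<bar>Bias0 J l - (\<Sum>l'<n. Gram0 J l l' * bias_vec G p m f x (h J) $ l')\<bar> \<le> C * h J ^ 2"
proof -
  define \<beta>1 where "\<beta>1 = beta m x (p + 1)"
  define \<beta>2 where "\<beta>2 = beta m x (p + 2)"
  define t where "t l = (\<beta>2 * f x + \<beta>1 * deriv f x) * sol (p + 2) l - \<beta>1 * deriv f x * sol' l" for l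
  define bv where "bv J l = bias_vec G p m f x (h J) $ l" for J l
  have bv: "bv J l = \<beta>1 * sol (p + 1) l + h J / f x * t l" if "l < n" for J l
    unfolding bv_def bias_vec_entry(1)[OF that] by (simp add: \<beta>1_def \<beta>2_def t_def)
  define W where "W l = (\<Sum>i<n. mu G (l + i + 1) * sol (p + 1) i)" for l
  have mu_s: "(\<Sum>l'<n. mu G (l + l') * sol q l') = mu G (q + l)" if "l < n" for q l
    unfolding sol_def using mu_solve[OF that, of "\<lambda>k. mu G (q + k)"] .
  have mu_s': "(\<Sum>l'<n. mu G (l + l') * sol' l') = W l" if "l < n" for l
    unfolding sol'_def W_def using mu_solve[OF that, of "\<lambda>k. \<Sum>i<n. mu G (k + i + 1) * sol (p + 1) i"] .
  have "\<exists>C\<ge>0. \<forall>\<^sub>F J in sequentially. \<bar>Bias0 J l - (\<Sum>l'<n. Gram0 J l l' * bv J l')\<bar> \<le> C * h J ^ 2" if l: "l < n" for l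
  proof -
    define E where "E J l' = Gram0 J l l' - (f x * mu G (l + l') + h J * deriv f x * mu G (l + l' + 1))" for J l'
    have "\<exists>C\<ge>0. \<forall>\<^sub>F J in sequentially. \<forall>l'\<in>{..<n}. \<bar>E J l'\<bar> \<le> C * h J ^ 2"
      unfolding E_def using Gram0_limit[of l] by (intro eventually_uniform_bound) auto
    then obtain CE where CE: "CE \<ge> 0" "\<forall>\<^sub>F J in sequentially. \<forall>l'\<in>{..<n}. \<bar>E J l'\<bar> \<le> CE * h J ^ 2" by blast
    obtain CB where CB: "CB \<ge> 0" "\<forall>\<^sub>F J in sequentially. \<bar>Bias0 J l - (\<beta>1 * f x * mu G (l + (p + 1))
        + h J * ((\<beta>2 * f x + \<beta>1 * deriv f x) * mu G (l + (p + 2))))\<bar> \<le> CB * h J ^ 2"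
      using Bias0_limit[of l] unfolding \<beta>1_def \<beta>2_def by blast
    \<comment> \<open>Coefficient of the explicit h^2 term: the first-order part of the Gram matrix
      meets the first-order part of the bias vector.\<close>
    define c0 where "c0 = deriv f x / f x * (\<Sum>l'<n. mu G (l + l' + 1) * t l')"
    define Bb where "Bb = (\<Sum>l'<n. \<bar>\<beta>1 * sol (p + 1) l'\<bar> + \<bar>t l' / f x\<bar>)"
    have Gb: "(\<Sum>l'<n. Gram0 J l l' * bv J l') = \<beta>1 * f x * mu G (l + (p + 1))
        + h J * ((\<beta>2 * f x + \<beta>1 * deriv f x) * mu G (l + (p + 2))) + h J ^ 2 * c0 + (\<Sum>l'<n. E J l' * bv J l')" for J
    proof -
      have "(\<Sum>l'<n. Gram0 J l l' * bv J l')
          = (\<Sum>l'<n. f x * \<beta>1 * (mu G (l + l') * sol (p + 1) l') + h J * (mu G (l + l') * t l')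
             + h J * deriv f x * \<beta>1 * (mu G (l + l' + 1) * sol (p + 1) l')
             + h J ^ 2 * (deriv f x / f x) * (mu G (l + l' + 1) * t l') + E J l' * bv J l')"
      proof (rule sum.cong[OF refl])
        fix l' assume "l' \<in> {..<n}"
        then have b: "bv J l' = \<beta>1 * sol (p + 1) l' + h J / f x * t l'" by (intro bv) simp
        have "Gram0 J l l' = f x * mu G (l + l') + h J * deriv f x * mu G (l + l' + 1) + E J l'"
          by (simp add: E_def)
        then have "Gram0 J l l' * bv J l' = (f x * mu G (l + l') + h J * deriv f x * mu G (l + l' + 1)) * bv J l' + E J l' * bv J l'"
          by (simp add: distrib_right)
        also have "(f x * mu G (l + l') + h J * deriv f x * mu G (l + l' + 1)) * bv J l'
            = f x * \<beta>1 * (mu G (l + l') * sol (p + 1) l') + h J * (mu G (l + l') * t l')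
             + h J * deriv f x * \<beta>1 * (mu G (l + l' + 1) * sol (p + 1) l')
             + h J ^ 2 * (deriv f x / f x) * (mu G (l + l' + 1) * t l')"
          unfolding b using fx by (simp add: field_simps power2_eq_square)
        finally show "Gram0 J l l' * bv J l' = f x * \<beta>1 * (mu G (l + l') * sol (p + 1) l') + h J * (mu G (l + l') * t l')
             + h J * deriv f x * \<beta>1 * (mu G (l + l' + 1) * sol (p + 1) l')
             + h J ^ 2 * (deriv f x / f x) * (mu G (l + l' + 1) * t l') + E J l' * bv J l'" .
      qed
      also have "\<dots> = f x * \<beta>1 * (\<Sum>l'<n. mu G (l + l') * sol (p + 1) l') + h J * (\<Sum>l'<n. mu G (l + l') * t l')
             + h J * deriv f x * \<beta>1 * W l
             + h J ^ 2 * (deriv f x / f x) * (\<Sum>l'<n. mu G (l + l' + 1) * t l') + (\<Sum>l'<n. E J l' * bv J l')"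
        unfolding W_def sum.distrib sum_distrib_left[symmetric] ..
      \<comment> \<open>The term with \<open>W l\<close> coming from \<open>sol'\<close> is the
        negative of the one coming from the first-order part of the Gram matrix; this cancellation
        is the reason for the correction term in \<open>bias_vec\<close>.\<close>
      also have "(\<Sum>l'<n. mu G (l + l') * t l') = (\<beta>2 * f x + \<beta>1 * deriv f x) * mu G (p + 2 + l) - \<beta>1 * deriv f x * W l"
      proof -
        have "(\<Sum>l'<n. mu G (l + l') * t l') = (\<beta>2 * f x + \<beta>1 * deriv f x) * (\<Sum>l'<n. mu G (l + l') * sol (p + 2) l')
            - \<beta>1 * deriv f x * (\<Sum>l'<n. mu G (l + l') * sol' l')"
          unfolding t_def right_diff_distrib sum_subtractf sum_distrib_left by (simp only: mult.left_commute)
        then show ?thesis unfolding mu_s[OF l] mu_s'[OF l] .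
      qed
      finally show ?thesis unfolding mu_s[OF l] by (simp add: c0_def algebra_simps)
    qed
    have "\<forall>\<^sub>F J in sequentially. \<bar>Bias0 J l - (\<Sum>l'<n. Gram0 J l l' * bv J l')\<bar>
        \<le> (CB + \<bar>c0\<bar> + real n * (CE * Bb)) * h J ^ 2"
      using CE(2) CB(2) h_le_1
    proof eventually_elim
      case (elim J)
      have Bb: "\<bar>bv J l'\<bar> \<le> Bb" if "l' < n" for l'
      proof -
        have "bv J l' = \<beta>1 * sol (p + 1) l' + h J * (t l' / f x)" unfolding bv[OF that] by simp
        then have "\<bar>bv J l'\<bar> \<le> \<bar>\<beta>1 * sol (p + 1) l'\<bar> + \<bar>h J * (t l' / f x)\<bar>"
          by (simp only: abs_triangle_ineq)
        also have "\<bar>h J * (t l' / f x)\<bar> \<le> 1 * \<bar>t l' / f x\<bar>"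
          unfolding abs_mult using elim(3) h_pos[of J] by (intro mult_right_mono) auto
        also have "\<bar>\<beta>1 * sol (p + 1) l'\<bar> + 1 * \<bar>t l' / f x\<bar> \<le> Bb"
          unfolding Bb_def using that
          by (simp only: mult_1) (rule member_le_sum[of l' "{..<n}" "\<lambda>l'. \<bar>\<beta>1 * sol (p + 1) l'\<bar> + \<bar>t l' / f x\<bar>"], auto)
        finally show ?thesis by simp
      qed
      have "\<bar>\<Sum>l'<n. E J l' * bv J l'\<bar> \<le> (\<Sum>l'<n. (CE * h J ^ 2) * Bb)"
        using elim(1) Bb CE(1)
        by (intro order_trans[OF sum_abs] sum_mono) (auto simp: abs_mult intro!: mult_mono)
      then have "\<bar>\<Sum>l'<n. E J l' * bv J l'\<bar> \<le> real n * (CE * Bb) * h J ^ 2" by (simp add: mult_ac)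
      moreover have "\<bar>h J ^ 2 * c0\<bar> = \<bar>c0\<bar> * h J ^ 2" by (simp add: abs_mult)
      ultimately show ?case using elim(2) unfolding Gb distrib_right by linarith
    qed
    moreover have "0 \<le> CB + \<bar>c0\<bar> + real n * (CE * Bb)"
      using CB(1) CE(1) by (auto simp: Bb_def intro!: add_nonneg_nonneg mult_nonneg_nonneg sum_nonneg)
    ultimately show ?thesis by blast
  qed
  then have "\<exists>C\<ge>0. \<forall>\<^sub>F J in sequentially. \<forall>l\<in>{..<n}. \<bar>Bias0 J l - (\<Sum>l'<n. Gram0 J l l' * bv J l')\<bar> \<le> C * h J ^ 2"
    by (intro eventually_uniform_bound) auto
  then show ?thesis by (simp add: bv_def Ball_def)
qed

section \<open>Perturbation of the random row system\<close>

definition Ev :: "real \<Rightarrow> nat \<Rightarrow> 'a \<Rightarrow> bool" where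
  "Ev C J \<omega> \<longleftrightarrow>
     (\<forall>l\<in>{..<n}. (\<forall>l'\<in>{..<n}. \<bar>Gram J \<omega> l l' - Gram0 J l l'\<bar> \<le> C * rate J \<and> \<bar>Vmat J \<omega> l l' - Vmat0 J l l'\<bar> \<le> C * rate J) \<and>
       \<bar>Bias J \<omega> l - Bias0 J l\<bar> \<le> C * rate J \<and> \<bar>Noise J \<omega> l\<bar> \<le> C * rate J)"

text \<open>All random estimates are collected in one event with a common constant; on it the rest
  of the analysis is deterministic.\<close>

lemma whp_Ev: "whp M Ev"
  unfolding Ev_def[abs_def] by (intro whp_ball whp_conj whp_Gram whp_Vmat whp_Bias whp_Noise) auto

lemma EvD:
  assumes "Ev C J \<omega>" "l < n"
  shows "l' < n \<Longrightarrow> \<bar>Gram J \<omega> l l' - Gram0 J l l'\<bar> \<le> C * rate J"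
    and "l' < n \<Longrightarrow> \<bar>Vmat J \<omega> l l' - Vmat0 J l l'\<bar> \<le> C * rate J"
    and "\<bar>Bias J \<omega> l - Bias0 J l\<bar> \<le> C * rate J" and "\<bar>Noise J \<omega> l\<bar> \<le> C * rate J"
  using assms unfolding Ev_def by auto

text \<open>K is chosen before C: whatever C is, \<open>C * rate J\<close> plus the distance of
  \<open>Gram0\<close> from its limit eventually falls below the fixed \<delta>.\<close>

lemma Ev_row_solution:
  "\<exists>K\<ge>0. \<forall>C. \<forall>\<^sub>F J in sequentially. \<forall>\<omega>. Ev C J \<omega> \<longrightarrow>
     (\<forall>z w k. (\<forall>j<n. \<bar>\<Sum>i<n. z i * Gram J \<omega> i j\<bar> \<le> w) \<longrightarrow> k < n \<longrightarrow> \<bar>z k\<bar> \<le> K * w) \<and>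
     (\<exists>y. row_solution J \<omega> y \<and> (\<forall>l<n. \<bar>y l\<bar> \<le> K))"
proof -
  obtain \<delta> K where \<delta>: "\<delta> > 0" and K: "K \<ge> 0" "\<And>A z w k. (\<forall>i<n. \<forall>j<n. \<bar>A i j - Gram_lim i j\<bar> \<le> \<delta>) \<Longrightarrow>
     (\<forall>j<n. \<bar>\<Sum>i<n. z i * A i j\<bar> \<le> w) \<Longrightarrow> k < n \<Longrightarrow> \<bar>z k\<bar> \<le> K * w"
    using Gram_lim_row_bound by blast
  obtain C1 where C1: "\<forall>\<^sub>F J in sequentially. \<forall>l<n. \<forall>l'<n. \<bar>Gram0 J l l' - Gram_lim l l'\<bar> \<le> C1 * h J"
    using Gram0_close by blast
  have "\<forall>\<^sub>F J in sequentially. \<forall>\<omega>. Ev C J \<omega> \<longrightarrow>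
     (\<forall>z w k. (\<forall>j<n. \<bar>\<Sum>i<n. z i * Gram J \<omega> i j\<bar> \<le> w) \<longrightarrow> k < n \<longrightarrow> \<bar>z k\<bar> \<le> K * w) \<and>
     (\<exists>y. row_solution J \<omega> y \<and> (\<forall>l<n. \<bar>y l\<bar> \<le> K))" for C
  proof -
    have "(\<lambda>J. C * rate J + C1 * h J) \<longlonglongrightarrow> C * 0 + C1 * 0" by (intro tendsto_intros rate_lim h_lim)
    then have "\<forall>\<^sub>F J in sequentially. C * rate J + C1 * h J < \<delta>" using \<delta> by (intro order_tendstoD(2)) auto
    then show ?thesis
      using C1 eventually_ge_at_top[of 1]
    proof (eventually_elim, intro allI impI)
      fix J \<omega> assume J: "C * rate J + C1 * h J < \<delta>" "\<forall>l<n. \<forall>l'<n. \<bar>Gram0 J l l' - Gram_lim l l'\<bar> \<le> C1 * h J" "1 \<le> J"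
        and ev: "Ev C J \<omega>"
      have close: "\<forall>i<n. \<forall>j<n. \<bar>Gram J \<omega> i j - Gram_lim i j\<bar> \<le> \<delta>"
      proof (intro allI impI)
        fix i j assume ij: "i < n" "j < n"
        have "\<bar>Gram0 J i j - Gram_lim i j\<bar> \<le> C1 * h J" using J(2) ij by blast
        then show "\<bar>Gram J \<omega> i j - Gram_lim i j\<bar> \<le> \<delta>" using EvD(1)[OF ev ij] J(1) by linarith
      qed
      note row = K(2)[OF close]
      have "\<exists>y. row_solution J \<omega> y"
      proof (rule row_solution_exists[OF J(3)])
        fix z i assume z: "\<And>l'. l' < n \<Longrightarrow> (\<Sum>l<n. z l * Gram J \<omega> l l') = 0" and i: "i < n"
        have "\<bar>z i\<bar> \<le> K * 0" by (rule row[OF _ i]) (simp add: z)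
        then show "z i = 0" by simp
      qed
      then obtain y where y: "row_solution J \<omega> y" by blast
      \<comment> \<open>Here w = 1, because the image of y is a unit row; the kernel argument above
        took w = 0.\<close>
      have "\<bar>y l\<bar> \<le> K * 1" if "l < n" for l
        by (rule row[OF _ that]) (use y in \<open>simp add: row_solution_def\<close>)
      then have "\<exists>y. row_solution J \<omega> y \<and> (\<forall>l<n. \<bar>y l\<bar> \<le> K)" using y by auto
      then show "(\<forall>z w k. (\<forall>j<n. \<bar>\<Sum>i<n. z i * Gram J \<omega> i j\<bar> \<le> w) \<longrightarrow> k < n \<longrightarrow> \<bar>z k\<bar> \<le> K * w) \<and>
         (\<exists>y. row_solution J \<omega> y \<and> (\<forall>l<n. \<bar>y l\<bar> \<le> K))" using row by blast
    qed
  qed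
  then show ?thesis using K(1) by blast
qed

text \<open>Solvability of the mean system is established for large J only, hence the choice
  operator, which is defined for every J.\<close>

definition y0 :: "nat \<Rightarrow> nat \<Rightarrow> real" where
  "y0 J = (SOME y. \<forall>l'<n. (\<Sum>l<n. y l * Gram0 J l l') = (if l' = 0 then 1 else 0))"

lemma y0_solution:
  "\<exists>K\<ge>0. \<forall>\<^sub>F J in sequentially. (\<forall>l'<n. (\<Sum>l<n. y0 J l * Gram0 J l l') = (if l' = 0 then 1 else 0)) \<and>
     (\<forall>l<n. \<bar>y0 J l\<bar> \<le> K)"
proof -
  obtain \<delta> K where \<delta>: "\<delta> > 0" and K: "K \<ge> 0" "\<And>A z w k. (\<forall>i<n. \<forall>j<n. \<bar>A i j - Gram_lim i j\<bar> \<le> \<delta>) \<Longrightarrow>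
     (\<forall>j<n. \<bar>\<Sum>i<n. z i * A i j\<bar> \<le> w) \<Longrightarrow> k < n \<Longrightarrow> \<bar>z k\<bar> \<le> K * w"
    using Gram_lim_row_bound by blast
  obtain C1 where C1: "\<forall>\<^sub>F J in sequentially. \<forall>l<n. \<forall>l'<n. \<bar>Gram0 J l l' - Gram_lim l l'\<bar> \<le> C1 * h J"
    using Gram0_close by blast
  have "(\<lambda>J. C1 * h J) \<longlonglongrightarrow> C1 * 0" by (intro tendsto_intros h_lim)
  then have "\<forall>\<^sub>F J in sequentially. C1 * h J < \<delta>" using \<delta> by (intro order_tendstoD(2)) auto
  then have "\<forall>\<^sub>F J in sequentially. (\<forall>l'<n. (\<Sum>l<n. y0 J l * Gram0 J l l') = (if l' = 0 then 1 else 0)) \<and>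
     (\<forall>l<n. \<bar>y0 J l\<bar> \<le> K)"
    using C1
  proof eventually_elim
    case (elim J)
    then have close: "\<forall>i<n. \<forall>j<n. \<bar>Gram0 J i j - Gram_lim i j\<bar> \<le> \<delta>" by force
    note row = K(2)[OF close]
    have "\<exists>y. \<forall>j<n. (\<Sum>l<n. y l * Gram0 J l j) = (if j = 0 then 1 else 0)"
    proof (rule row_kernel_trivial_imp_solution(2))
      fix z i assume z: "\<And>j. j < n \<Longrightarrow> (\<Sum>l<n. z l * Gram0 J l j) = 0" and i: "i < n"
      have "\<bar>z i\<bar> \<le> K * 0" by (rule row[OF _ i]) (simp add: z)
      then show "z i = 0" by simp
    qed
    then have sol: "\<forall>j<n. (\<Sum>l<n. y0 J l * Gram0 J l j) = (if j = 0 then 1 else 0)"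
      unfolding y0_def by (rule someI_ex)
    have "\<bar>y0 J l\<bar> \<le> K * 1" if "l < n" for l
      by (rule row[OF _ that]) (use sol in simp)
    then show ?case using sol by simp
  qed
  then show ?thesis using K(1) by blast
qed

lemma sum_abs_bound:
  fixes a b :: "nat \<Rightarrow> real"
  assumes "\<And>l. l < n \<Longrightarrow> \<bar>a l\<bar> \<le> A" "\<And>l. l < n \<Longrightarrow> \<bar>b l\<bar> \<le> B"
  shows "\<bar>\<Sum>l<n. a l * b l\<bar> \<le> real n * (A * B)"
proof -
  have "\<bar>\<Sum>l<n. a l * b l\<bar> \<le> (\<Sum>l<n. A * B)"
  proof (intro order_trans[OF sum_abs] sum_mono)
    fix l assume "l \<in> {..<n}"
    then show "\<bar>a l * b l\<bar> \<le> A * B"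
      unfolding abs_mult using assms[of l] by (intro mult_mono order_trans[OF abs_ge_zero assms(1)]) auto
  qed
  then show ?thesis by simp
qed

text \<open>y and \<open>y0\<close> solve neighbouring systems, so the row bound applied to y - y0
  makes their difference of the order of the rate. The fluctuation of the bias then has this order
  as well, and its prefactor h^(p+1) is at most 1.\<close>

lemma whp_expansion:
  "whp M (\<lambda>C J \<omega>. \<bar>Tstat J \<omega> - m x - h J ^ (p + 1) * (\<Sum>l<n. y0 J l * Bias0 J l)\<bar> \<le> C * rate J)"
proof -
  obtain K where K: "K \<ge> 0" "\<And>C. \<forall>\<^sub>F J in sequentially. \<forall>\<omega>. Ev C J \<omega> \<longrightarrow>
     (\<forall>z w k. (\<forall>j<n. \<bar>\<Sum>i<n. z i * Gram J \<omega> i j\<bar> \<le> w) \<longrightarrow> k < n \<longrightarrow> \<bar>z k\<bar> \<le> K * w) \<and>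
     (\<exists>y. row_solution J \<omega> y \<and> (\<forall>l<n. \<bar>y l\<bar> \<le> K))"
    using Ev_row_solution by blast
  obtain K0 where K0: "K0 \<ge> 0" "\<forall>\<^sub>F J in sequentially.
      (\<forall>l'<n. (\<Sum>l<n. y0 J l * Gram0 J l l') = (if l' = 0 then 1 else 0)) \<and> (\<forall>l<n. \<bar>y0 J l\<bar> \<le> K0)"
    using y0_solution by blast
  obtain B0 where B0: "B0 \<ge> 0" "\<forall>\<^sub>F J in sequentially. \<forall>l<n. \<bar>Bias0 J l\<bar> \<le> B0"
    using Bias0_bounded by blast
  show ?thesis
  proof (rule whp_le[OF whp_Ev rate_nonneg], goal_cases)
    case (1 C)
    define C' where "C' = real n * (K * \<bar>C\<bar>) + (real n * (K * \<bar>C\<bar>) + real n * ((K * (real n * (K0 * \<bar>C\<bar>))) * B0))"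
    have "\<forall>\<^sub>F J in sequentially. \<forall>\<omega>\<in>space M. Ev C J \<omega> \<longrightarrow>
       \<bar>Tstat J \<omega> - m x - h J ^ (p + 1) * (\<Sum>l<n. y0 J l * Bias0 J l)\<bar> \<le> C' * rate J"
      using K(2)[of C] K0(2) B0(2) h_le_1
    proof (eventually_elim, intro ballI impI)
      fix J \<omega>
      assume row: "\<forall>\<omega>. Ev C J \<omega> \<longrightarrow>
         (\<forall>z w k. (\<forall>j<n. \<bar>\<Sum>i<n. z i * Gram J \<omega> i j\<bar> \<le> w) \<longrightarrow> k < n \<longrightarrow> \<bar>z k\<bar> \<le> K * w) \<and>
         (\<exists>y. row_solution J \<omega> y \<and> (\<forall>l<n. \<bar>y l\<bar> \<le> K))"
        and y0: "(\<forall>l'<n. (\<Sum>l<n. y0 J l * Gram0 J l l') = (if l' = 0 then 1 else 0)) \<and> (\<forall>l<n. \<bar>y0 J l\<bar> \<le> K0)"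
        and B: "\<forall>l<n. \<bar>Bias0 J l\<bar> \<le> B0" and h1: "h J \<le> 1" and ev: "Ev C J \<omega>"
      have bound: "\<And>z w k. (\<forall>j<n. \<bar>\<Sum>i<n. z i * Gram J \<omega> i j\<bar> \<le> w) \<Longrightarrow> k < n \<Longrightarrow> \<bar>z k\<bar> \<le> K * w"
        using row ev by blast
      obtain y where y: "row_solution J \<omega> y" "\<And>l. l < n \<Longrightarrow> \<bar>y l\<bar> \<le> K" using row ev by blast
      define e where "e = \<bar>C\<bar> * rate J"
      have le_e: "C * rate J \<le> e" unfolding e_def using rate_nonneg by (intro mult_right_mono) auto
      have y0': "\<And>l. l < n \<Longrightarrow> \<bar>y0 J l\<bar> \<le> K0" using y0 by blast
      have diff: "\<bar>y l - y0 J l\<bar> \<le> K * (real n * (K0 * e))" if "l < n" for l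
      proof (rule bound[OF _ that], intro allI impI)
        fix j assume j: "j < n"
        have "(\<Sum>i<n. (y i - y0 J i) * Gram J \<omega> i j)
            = (\<Sum>i<n. y i * Gram J \<omega> i j) - (\<Sum>i<n. y0 J i * Gram0 J i j) - (\<Sum>i<n. y0 J i * (Gram J \<omega> i j - Gram0 J i j))"
          by (simp add: sum_subtractf[symmetric] algebra_simps)
        also have "\<dots> = - (\<Sum>i<n. y0 J i * (Gram J \<omega> i j - Gram0 J i j))"
          using y(1) y0 j by (simp add: row_solution_def)
        also have "\<bar>\<dots>\<bar> \<le> real n * (K0 * e)"
          unfolding abs_minus_cancel using y0' EvD(1)[OF ev _ j] le_e by (intro sum_abs_bound) (auto intro: order_trans)
        finally show "\<bar>\<Sum>i<n. (y i - y0 J i) * Gram J \<omega> i j\<bar> \<le> real n * (K0 * e)" .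
      qed
      \<comment> \<open>Three errors: the noise, the fluctuation of \<open>Bias\<close> around its
        mean, and the difference of the two solutions.\<close>
      have T: "Tstat J \<omega> - m x - h J ^ (p + 1) * (\<Sum>l<n. y0 J l * Bias0 J l)
          = (\<Sum>l<n. y l * Noise J \<omega> l) + h J ^ (p + 1) * ((\<Sum>l<n. y l * (Bias J \<omega> l - Bias0 J l)) + (\<Sum>l<n. (y l - y0 J l) * Bias0 J l))"
        unfolding Tstat_decomposition[OF y(1)]
        by (simp add: left_diff_distrib right_diff_distrib sum_subtractf distrib_left)
      have n1: "\<bar>\<Sum>l<n. y l * Noise J \<omega> l\<bar> \<le> real n * (K * e)"
        using y(2) EvD(4)[OF ev] le_e by (intro sum_abs_bound) (auto intro: order_trans)
      have n2: "\<bar>\<Sum>l<n. y l * (Bias J \<omega> l - Bias0 J l)\<bar> \<le> real n * (K * e)"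
        using y(2) EvD(3)[OF ev] le_e by (intro sum_abs_bound) (auto intro: order_trans)
      have n3: "\<bar>\<Sum>l<n. (y l - y0 J l) * Bias0 J l\<bar> \<le> real n * ((K * (real n * (K0 * e))) * B0)"
        using diff B by (intro sum_abs_bound) auto
      define s where "s = (\<Sum>l<n. y l * (Bias J \<omega> l - Bias0 J l)) + (\<Sum>l<n. (y l - y0 J l) * Bias0 J l)"
      have "\<bar>h J ^ (p + 1) * s\<bar> \<le> 1 * \<bar>s\<bar>"
        unfolding abs_mult using h1 h_pos[of J] by (intro mult_right_mono) (auto simp: power_le_one simp del: power_Suc)
      moreover have "\<bar>s\<bar> \<le> real n * (K * e) + real n * ((K * (real n * (K0 * e))) * B0)"
        unfolding s_def using n2 n3 by linarith
      ultimately have "\<bar>Tstat J \<omega> - m x - h J ^ (p + 1) * (\<Sum>l<n. y0 J l * Bias0 J l)\<bar>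
          \<le> real n * (K * e) + (real n * (K * e) + real n * ((K * (real n * (K0 * e))) * B0))"
        unfolding T s_def[symmetric] using n1 by linarith
      also have "\<dots> = C' * rate J" by (simp add: C'_def e_def algebra_simps)
      finally show "\<bar>Tstat J \<omega> - m x - h J ^ (p + 1) * (\<Sum>l<n. y0 J l * Bias0 J l)\<bar> \<le> C' * rate J" .
    qed
    then show ?case by blast
  qed
qed

text \<open>Multiplying the approximate equation of \<open>bias_vec_residual\<close> by
  \<open>y0\<close> from the left turns \<open>Gram0\<close> into the unit row, which reads off
  entry 0 of \<open>bias_vec\<close>.\<close>

lemma bias_remainder:
  "\<exists>C\<ge>0. \<forall>\<^sub>F J in sequentially. \<bar>(\<Sum>l<n. y0 J l * Bias0 J l) - bias_vec G p m f x (h J) $ 0\<bar> \<le> C * h J ^ 2"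
proof -
  obtain K0 where K0: "K0 \<ge> 0" "\<forall>\<^sub>F J in sequentially.
      (\<forall>l'<n. (\<Sum>l<n. y0 J l * Gram0 J l l') = (if l' = 0 then 1 else 0)) \<and> (\<forall>l<n. \<bar>y0 J l\<bar> \<le> K0)"
    using y0_solution by blast
  obtain C where C: "C \<ge> 0" "\<forall>\<^sub>F J in sequentially. \<forall>l<n.
     \<bar>Bias0 J l - (\<Sum>l'<n. Gram0 J l l' * bias_vec G p m f x (h J) $ l')\<bar> \<le> C * h J ^ 2"
    using bias_vec_residual by blast
  have "\<forall>\<^sub>F J in sequentially. \<bar>(\<Sum>l<n. y0 J l * Bias0 J l) - bias_vec G p m f x (h J) $ 0\<bar> \<le> (real n * (K0 * C)) * h J ^ 2"
    using K0(2) C(2)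
  proof eventually_elim
    case (elim J)
    define b where "b l = bias_vec G p m f x (h J) $ l" for l
    have "(\<Sum>l<n. y0 J l * (\<Sum>l'<n. Gram0 J l l' * b l')) = (\<Sum>l'<n. (\<Sum>l<n. y0 J l * Gram0 J l l') * b l')"
      unfolding sum_distrib_left sum_distrib_right by (subst sum.swap) (simp add: mult_ac)
    also have "\<dots> = (\<Sum>l'<n. (if l' = 0 then 1 else 0) * b l')" using elim(1) by (intro sum.cong) auto
    also have "\<dots> = b 0" using n_pos by (simp add: mult_delta_left)
    finally have "(\<Sum>l<n. y0 J l * Bias0 J l) - b 0 = (\<Sum>l<n. y0 J l * (Bias0 J l - (\<Sum>l'<n. Gram0 J l l' * b l')))"
      by (simp add: right_diff_distrib sum_subtractf)
    also have "\<bar>\<dots>\<bar> \<le> real n * (K0 * (C * h J ^ 2))"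
      using elim unfolding b_def by (intro sum_abs_bound) auto
    finally show ?case by (simp add: b_def mult_ac)
  qed
  then show ?thesis using K0(1) C(1) by (intro exI[of _ "real n * (K0 * C)"]) auto
qed

lemma Tstat_expansion: "has_expansion M Tstat G p c m f x h"
proof -
  define \<rho> where "\<rho> J = (\<Sum>l<n. y0 J l * Bias0 J l) - bias_vec G p m f x (h J) $ 0" for J
  \<comment> \<open>The nonrandom scalar error sits in entry 0, the only one that the unit vector
    reads.\<close>
  define r where "r J = Matrix.vec (p + 1) (\<lambda>l. if l = 0 then \<rho> J else 0)" for J
  \<comment> \<open>R is everything outside the nonrandom part, so for J \<ge> 1 the identity holds
    by construction and only the order of R is at issue.\<close>
  define R where "R J \<omega> = (if J = 0 then 0 else Tstat J \<omega> - m x - h J ^ (p + 1) * (\<Sum>l<n. y0 J l * Bias0 J l))" for J \<omega>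
  have "(\<lambda>J. r J $ l) \<in> O(\<lambda>J. (h J)\<^sup>2)" if "l \<le> p" for l
  proof (cases "l = 0")
    case True
    obtain C where "\<forall>\<^sub>F J in sequentially. \<bar>\<rho> J\<bar> \<le> C * h J ^ 2" using bias_remainder unfolding \<rho>_def by blast
    then show ?thesis using True by (intro bigoI[of _ C]) (auto simp: r_def elim!: eventually_mono)
  next
    case False
    then have "(\<lambda>J. r J $ l) = (\<lambda>J. 0)" using that by (simp add: r_def)
    then show ?thesis by simp
  qed
  moreover have "big_O_P M R (\<lambda>J. 1 / sqrt (real (c * J) * h J))"
  proof (rule big_O_P_whp)
    show "R J \<in> borel_measurable M" for J by (cases "J = 0") (simp_all add: R_def[abs_def])
    have "whp M (\<lambda>C J \<omega>. \<bar>R J \<omega>\<bar> \<le> C * rate J)"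
    proof (rule whp_le[OF whp_expansion rate_nonneg], goal_cases)
      case (1 C)
      show ?case
        by (rule exI[of _ C], rule eventually_mono[OF eventually_ge_at_top[of 1]]) (auto simp: R_def)
    qed
    then show "whp M (\<lambda>C J \<omega>. \<bar>R J \<omega>\<bar> \<le> C * (1 / sqrt (real (c * J) * h J)))" by (simp only: rate_def)
  qed
  moreover have "Tstat J \<omega> - m x = unit_vec (p + 1) 0 \<bullet> (h J ^ (p + 1) \<cdot>\<^sub>v (bias_vec G p m f x (h J) + r J)) + R J \<omega>"
    if "1 \<le> J" for J \<omega>
  proof -
    have b: "bias_vec G p m f x (h J) \<in> carrier_vec (p + 1)" using bias_vec_entry(2)[OF n_pos] by (simp add: n_def)
    have r: "r J \<in> carrier_vec (p + 1)" by (simp add: r_def)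
    have "unit_vec (p + 1) 0 \<bullet> (h J ^ (p + 1) \<cdot>\<^sub>v (bias_vec G p m f x (h J) + r J))
        = (h J ^ (p + 1) \<cdot>\<^sub>v (bias_vec G p m f x (h J) + r J)) $ 0"
      using b r by (intro scalar_prod_left_unit smult_carrier_vec[THEN iffD2] add_carrier_vec) auto
    also have "\<dots> = h J ^ (p + 1) * (bias_vec G p m f x (h J) $ 0 + r J $ 0)"
      using carrier_vecD[OF b] carrier_vecD[OF r] by simp
    also have "\<dots> = h J ^ (p + 1) * (\<Sum>l<n. y0 J l * Bias0 J l)" by (simp add: r_def \<rho>_def)
    finally show ?thesis using that by (simp add: R_def)
  qed
  moreover have "\<forall>J. r J \<in> carrier_vec (p + 1)" by (simp add: r_def)
  ultimately show ?thesis unfolding has_expansion_def by blast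
qed


section \<open>The conditional variance\<close>

lemma rate_h_nonneg: "0 \<le> rate J + h J"
  using rate_nonneg[of J] h_pos[of J] by simp

text \<open>The matrices are compared directly with their limits, at the cost of an additional error
  of order h. The rest is the perturbation of a quadratic form in its vector and in its
  matrix.\<close>

lemma whp_variance:
  "whp M (\<lambda>C J \<omega>. \<bar>Vstat J \<omega> * (real (c * J) * h J) - \<sigma>2 x / f x * var_const G p\<bar> \<le> C * (rate J + h J))"
proof -
  obtain K where K: "K \<ge> 0" "\<And>C. \<forall>\<^sub>F J in sequentially. \<forall>\<omega>. Ev C J \<omega> \<longrightarrow>
     (\<forall>z w k. (\<forall>j<n. \<bar>\<Sum>i<n. z i * Gram J \<omega> i j\<bar> \<le> w) \<longrightarrow> k < n \<longrightarrow> \<bar>z k\<bar> \<le> K * w) \<and>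
     (\<exists>y. row_solution J \<omega> y \<and> (\<forall>l<n. \<bar>y l\<bar> \<le> K))"
    using Ev_row_solution by blast
  obtain C1 where C1: "C1 \<ge> 0" "\<forall>\<^sub>F J in sequentially. \<forall>l<n. \<forall>l'<n. \<bar>Gram0 J l l' - Gram_lim l l'\<bar> \<le> C1 * h J"
    using Gram0_close by blast
  obtain C2 where C2: "C2 \<ge> 0" "\<forall>\<^sub>F J in sequentially. \<forall>l<n. \<forall>l'<n. \<bar>Vmat0 J l l' - \<sigma>2 x * f x * nu G (l + l')\<bar> \<le> C2 * h J"
    using Vmat0_close by blast
  define yi where "yi l = Sinv 0 l / f x" for l
  define Vi where "Vi l l' = \<sigma>2 x * f x * nu G (l + l')" for l l'
  define Yb where "Yb = (\<Sum>l<n. \<bar>yi l\<bar>)"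
  define Wb where "Wb = (\<Sum>l<n. \<Sum>l'<n. \<bar>Vi l l'\<bar>)"
  have Yb: "\<bar>yi l\<bar> \<le> Yb" if "l < n" for l unfolding Yb_def using that by (intro member_le_sum) auto
  have Yb0: "0 \<le> Yb" by (simp add: Yb_def sum_nonneg)
  have Wb: "\<bar>Vi l l'\<bar> \<le> Wb" if "l < n" "l' < n" for l l'
  proof -
    have "\<bar>Vi l l'\<bar> \<le> (\<Sum>l'<n. \<bar>Vi l l'\<bar>)" using that by (intro member_le_sum) auto
    also have "\<dots> \<le> Wb" unfolding Wb_def
      using that by (intro member_le_sum[of l "{..<n}" "\<lambda>l. \<Sum>l'<n. \<bar>Vi l l'\<bar>"]) (auto intro: sum_nonneg)
    finally show ?thesis .
  qed
  have yi_sol: "(\<Sum>l<n. yi l * Gram_lim l l') = (if l' = 0 then 1 else 0)" if "l' < n" for l'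
  proof -
    have "(\<Sum>l<n. yi l * Gram_lim l l') = (\<Sum>l<n. Sinv 0 l * mu G (l + l'))"
      using fx by (simp add: yi_def Gram_lim_def)
    then show ?thesis using mu_Sinv(2)[OF n_pos that] by (cases "l' = 0") auto
  qed
  \<comment> \<open>Each of the two limiting solutions carries 1 / f(x) and the limit of
    \<open>Vmat\<close> carries one f(x), which leaves \<open>\<sigma>2 x / f x\<close>.\<close>
  have Q: "(\<Sum>l<n. \<Sum>l'<n. yi l * yi l' * Vi l l') = \<sigma>2 x / f x * var_const G p"
    unfolding var_const_eq sum_distrib_left yi_def Vi_def using fx
    by (intro sum.cong refl) (simp add: field_simps)
  show ?thesis
  proof (rule whp_le[OF whp_Ev rate_h_nonneg], goal_cases)
    case (1 C)
    define D where "D = \<bar>C\<bar> + C1 + C2"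
    define Dy where "Dy = K * (real n * (Yb * D))"
    define C' where "C' = real n * (real n * (K * K * D + (K * Dy + Dy * Yb) * Wb))"
    have D0: "0 \<le> D" using C1(1) C2(1) by (simp add: D_def)
    have Dy0: "0 \<le> Dy" using D0 K(1) Yb0 by (simp add: Dy_def)
    have "\<forall>\<^sub>F J in sequentially. \<forall>\<omega>\<in>space M. Ev C J \<omega> \<longrightarrow>
       \<bar>Vstat J \<omega> * (real (c * J) * h J) - \<sigma>2 x / f x * var_const G p\<bar> \<le> C' * (rate J + h J)"
      using K(2)[of C] C1(2) C2(2) eventually_ge_at_top[of 1]
    proof (eventually_elim, intro ballI impI)
      fix J \<omega>
      assume row: "\<forall>\<omega>. Ev C J \<omega> \<longrightarrow>
         (\<forall>z w k. (\<forall>j<n. \<bar>\<Sum>i<n. z i * Gram J \<omega> i j\<bar> \<le> w) \<longrightarrow> k < n \<longrightarrow> \<bar>z k\<bar> \<le> K * w) \<and>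
         (\<exists>y. row_solution J \<omega> y \<and> (\<forall>l<n. \<bar>y l\<bar> \<le> K))"
        and c1': "\<forall>l<n. \<forall>l'<n. \<bar>Gram0 J l l' - Gram_lim l l'\<bar> \<le> C1 * h J"
        and c2': "\<forall>l<n. \<forall>l'<n. \<bar>Vmat0 J l l' - \<sigma>2 x * f x * nu G (l + l')\<bar> \<le> C2 * h J"
        and J: "1 \<le> J" and ev: "Ev C J \<omega>"
      define e where "e = rate J + h J"
      have e0: "0 \<le> e" using rate_h_nonneg by (simp add: e_def)
      have De: "C * rate J + C1 * h J \<le> D * e" "C * rate J + C2 * h J \<le> D * e"
      proof -
        have "C * rate J \<le> \<bar>C\<bar> * rate J" using rate_nonneg by (intro mult_right_mono) auto
        moreover have "0 \<le> C1 * rate J" "0 \<le> C2 * rate J" "0 \<le> \<bar>C\<bar> * h J" "0 \<le> C1 * h J" "0 \<le> C2 * h J"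
          using C1(1) C2(1) rate_nonneg[of J] h_pos[of J] by auto
        ultimately show "C * rate J + C1 * h J \<le> D * e" "C * rate J + C2 * h J \<le> D * e"
          unfolding D_def e_def distrib_left distrib_right by linarith+
      qed
      have bound: "\<And>z w k. (\<forall>j<n. \<bar>\<Sum>i<n. z i * Gram J \<omega> i j\<bar> \<le> w) \<Longrightarrow> k < n \<Longrightarrow> \<bar>z k\<bar> \<le> K * w"
        using row ev by blast
      obtain y where y: "row_solution J \<omega> y" "\<And>l. l < n \<Longrightarrow> \<bar>y l\<bar> \<le> K" using row ev by blast
      have G: "\<bar>Gram J \<omega> i j - Gram_lim i j\<bar> \<le> D * e" if "i < n" "j < n" for i j
      proof -
        have "\<bar>Gram0 J i j - Gram_lim i j\<bar> \<le> C1 * h J" using c1' that by blast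
        then show ?thesis using EvD(1)[OF ev that] De(1) by linarith
      qed
      have V: "\<bar>Vmat J \<omega> i j - Vi i j\<bar> \<le> D * e" if "i < n" "j < n" for i j
      proof -
        have "\<bar>Vmat0 J i j - Vi i j\<bar> \<le> C2 * h J" unfolding Vi_def using c2' that by blast
        then show ?thesis using EvD(2)[OF ev that] De(2) by linarith
      qed
      have diff: "\<bar>y l - yi l\<bar> \<le> Dy * e" if "l < n" for l
      proof -
        have "\<bar>y l - yi l\<bar> \<le> K * (real n * (Yb * (D * e)))"
        proof (rule bound[OF _ that], intro allI impI)
          fix j assume j: "j < n"
          have "(\<Sum>i<n. (y i - yi i) * Gram J \<omega> i j)
              = (\<Sum>i<n. y i * Gram J \<omega> i j) - (\<Sum>i<n. yi i * Gram_lim i j) - (\<Sum>i<n. yi i * (Gram J \<omega> i j - Gram_lim i j))"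
            by (simp add: sum_subtractf[symmetric] algebra_simps)
          also have "\<dots> = - (\<Sum>i<n. yi i * (Gram J \<omega> i j - Gram_lim i j))"
            using y(1) yi_sol[OF j] j by (simp add: row_solution_def)
          also have "\<bar>\<dots>\<bar> \<le> real n * (Yb * (D * e))"
            unfolding abs_minus_cancel using Yb G j by (intro sum_abs_bound) auto
          finally show "\<bar>\<Sum>i<n. (y i - yi i) * Gram J \<omega> i j\<bar> \<le> real n * (Yb * (D * e))" .
        qed
        then show ?thesis by (simp add: Dy_def mult_ac)
      qed
      have entry: "\<bar>y l * y l' * Vmat J \<omega> l l' - yi l * yi l' * Vi l l'\<bar> \<le> (K * K * D + (K * Dy + Dy * Yb) * Wb) * e"
        if l: "l < n" "l' < n" for l l'
      proof -
        have "y l * y l' * Vmat J \<omega> l l' - yi l * yi l' * Vi l l'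
            = y l * y l' * (Vmat J \<omega> l l' - Vi l l') + (y l * (y l' - yi l') + (y l - yi l) * yi l') * Vi l l'"
          by (simp add: algebra_simps)
        also have "\<bar>\<dots>\<bar> \<le> \<bar>y l * y l' * (Vmat J \<omega> l l' - Vi l l')\<bar> + \<bar>(y l * (y l' - yi l') + (y l - yi l) * yi l') * Vi l l'\<bar>"
          by (rule abs_triangle_ineq)
        also have "\<dots> \<le> K * K * (D * e) + (K * (Dy * e) + (Dy * e) * Yb) * Wb"
        proof (rule add_mono)
          show "\<bar>y l * y l' * (Vmat J \<omega> l l' - Vi l l')\<bar> \<le> K * K * (D * e)"
            unfolding abs_mult using y(2) l V[OF l] K(1) by (intro mult_mono) auto
          have "\<bar>y l * (y l' - yi l') + (y l - yi l) * yi l'\<bar> \<le> \<bar>y l * (y l' - yi l')\<bar> + \<bar>(y l - yi l) * yi l'\<bar>"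
            by (rule abs_triangle_ineq)
          also have "\<dots> \<le> K * (Dy * e) + (Dy * e) * Yb"
            unfolding abs_mult using y(2) l diff Yb K(1) Dy0 e0 by (intro add_mono mult_mono) auto
          finally show "\<bar>(y l * (y l' - yi l') + (y l - yi l) * yi l') * Vi l l'\<bar> \<le> (K * (Dy * e) + (Dy * e) * Yb) * Wb"
            unfolding abs_mult[of _ "Vi l l'"] using Wb[OF l] K(1) Dy0 e0 Yb0 by (intro mult_mono) auto
        qed
        finally show ?thesis by (simp add: algebra_simps)
      qed
      have "\<bar>(\<Sum>l<n. \<Sum>l'<n. y l * y l' * Vmat J \<omega> l l') - (\<Sum>l<n. \<Sum>l'<n. yi l * yi l' * Vi l l')\<bar>
          \<le> (\<Sum>l<n. \<Sum>l'<n. (K * K * D + (K * Dy + Dy * Yb) * Wb) * e)"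
        unfolding sum_subtractf[symmetric] using entry
        by (intro order_trans[OF sum_abs] sum_mono) (auto intro!: order_trans[OF sum_abs] sum_mono)
      also have "\<dots> = C' * e" by (simp add: C'_def)
      finally have "\<bar>(\<Sum>l<n. \<Sum>l'<n. y l * y l' * Vmat J \<omega> l l') - \<sigma>2 x / f x * var_const G p\<bar> \<le> C' * e"
        unfolding Q .
      moreover have "Vstat J \<omega> * (real (c * J) * h J) = (\<Sum>l<n. \<Sum>l'<n. y l * y l' * Vmat J \<omega> l l')"
        unfolding Vstat_quadratic[OF y(1)] rate_sq using J c1 h_pos[of J] by simp
      ultimately show "\<bar>Vstat J \<omega> * (real (c * J) * h J) - \<sigma>2 x / f x * var_const G p\<bar> \<le> C' * (rate J + h J)"
        by (simp add: e_def)
    qed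
    then show ?case by blast
  qed
qed

lemma Tstat_cond_var_asymp: "has_cond_var_asymp M X Tstat G p c \<sigma>2 f x h"
proof -
  \<comment> \<open>R is a times the variance normalized by N h, minus b, with a and b such that the
    limit is mapped to 0. If \<open>\<sigma>2 x\<close> is 0, R measures the variance in units of 1
    / (N h f(x)); otherwise the division relies on \<open>var_const_nonzero\<close>.\<close>
  define a where "a = (if \<sigma>2 x = 0 then f x else f x / (\<sigma>2 x * var_const G p))"
  define b :: real where "b = (if \<sigma>2 x = 0 then 0 else 1)"
  define R where "R J \<omega> = (if J = 0 then 0 else a * (Vstat J \<omega> * (real (c * J) * h J)) - b)" for J \<omega>
  have ab: "a * (\<sigma>2 x / f x * var_const G p) = b"
    using fx var_const_nonzero by (simp add: a_def b_def)
  have "small_o_P M R (\<lambda>_. 1)"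
  proof (rule small_o_P_whp)
    show "R J \<in> borel_measurable M" for J by (cases "J = 0") (simp_all add: R_def[abs_def])
    have "(\<lambda>J. rate J + h J) \<longlonglongrightarrow> 0 + 0" by (intro tendsto_intros rate_lim h_lim)
    then show "(\<lambda>J. rate J + h J) \<longlonglongrightarrow> 0" by simp
    show "whp M (\<lambda>C J \<omega>. \<bar>R J \<omega>\<bar> \<le> C * (rate J + h J))"
    proof (rule whp_le[OF whp_variance rate_h_nonneg], goal_cases)
      case (1 C)
      have "\<bar>R J \<omega>\<bar> \<le> (\<bar>a\<bar> * C) * (rate J + h J)" if J: "1 \<le> J"
        and *: "\<bar>Vstat J \<omega> * (real (c * J) * h J) - \<sigma>2 x / f x * var_const G p\<bar> \<le> C * (rate J + h J)" for J \<omega>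
      proof -
        have "R J \<omega> = a * (Vstat J \<omega> * (real (c * J) * h J) - \<sigma>2 x / f x * var_const G p)"
          using J unfolding R_def right_diff_distrib ab by simp
        then show ?thesis using mult_left_mono[OF *, of "\<bar>a\<bar>"] by (simp add: abs_mult)
      qed
      then show ?case
        by (intro exI[of _ "\<bar>a\<bar> * C"] eventually_mono[OF eventually_ge_at_top[of 1]]) auto
    qed
  qed
  moreover have "has_cond_var M (cov_sigma M X (c * J)) (Tstat J) (\<lambda>\<omega>.
           if \<sigma>2 x = 0 then 1 / (real (c * J) * h J * f x) * R J \<omega>
           else \<sigma>2 x / (real (c * J) * h J * f x) * var_const G p * (1 + R J \<omega>))" if J: "1 \<le> J" for J
  proof -
    have pos: "0 < real (c * J) * h J" using J c1 h_pos[of J] by simp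
    have "(\<lambda>\<omega>. if \<sigma>2 x = 0 then 1 / (real (c * J) * h J * f x) * R J \<omega>
           else \<sigma>2 x / (real (c * J) * h J * f x) * var_const G p * (1 + R J \<omega>)) = Vstat J"
    proof
      fix \<omega>
      define N where "N = real (c * J) * h J"
      have "N \<noteq> 0" using pos unfolding N_def by linarith
      then show "(if \<sigma>2 x = 0 then 1 / (real (c * J) * h J * f x) * R J \<omega>
           else \<sigma>2 x / (real (c * J) * h J * f x) * var_const G p * (1 + R J \<omega>)) = Vstat J \<omega>"
        unfolding N_def[symmetric] using J fx var_const_nonzero
        by (simp add: R_def a_def b_def N_def[symmetric] del: of_nat_mult)
    qed
    then show ?thesis using Tstat_cond_var[OF J] by simp
  qed
  ultimately show ?thesis unfolding has_cond_var_asymp_def by blast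
qed

end


section \<open>The two estimators\<close>

lemma bounded_derivative_Lipschitz:
  fixes K :: "real \<Rightarrow> real"
  assumes diff: "\<And>t. K differentiable (at t)" and bd: "bounded (range (deriv K))"
    and van: "\<And>t. 1 < \<bar>t\<bar> \<Longrightarrow> K t = 0"
  obtains L where "\<And>t. \<bar>t\<bar> \<le> 2 \<Longrightarrow> \<bar>K t\<bar> \<le> L" "\<And>s t. \<bar>s\<bar> \<le> 2 \<Longrightarrow> \<bar>t\<bar> \<le> 2 \<Longrightarrow> \<bar>K s - K t\<bar> \<le> L * \<bar>s - t\<bar>"
proof -
  obtain B where B: "\<And>t. \<bar>deriv K t\<bar> \<le> B" using bd unfolding bounded_iff by auto
  have B0: "0 \<le> B" using B[of 0] by (rule order_trans[OF abs_ge_zero])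
  have lip: "\<bar>K s - K t\<bar> \<le> B * \<bar>s - t\<bar>" for s t
    using field_differentiable_bound[of UNIV K "deriv K" B s t] B diff
    by (simp add: DERIV_deriv_iff_real_differentiable)
  show thesis
  \<comment> \<open>Every point of the window is within 5 of the point 3, where K vanishes, so the
    Lipschitz constant B also bounds the values by \<open>5 * B\<close>.\<close>
  proof (rule that[of "5 * B"])
    fix t :: real assume "\<bar>t\<bar> \<le> 2"
    then have "B * \<bar>t - 3\<bar> \<le> B * 5" using B0 by (intro mult_left_mono) auto
    then show "\<bar>K t\<bar> \<le> 5 * B" using lip[of t 3] van[of 3] by simp
  next
    fix s t :: real
    have "B * \<bar>s - t\<bar> \<le> 5 * B * \<bar>s - t\<bar>" using B0 by (intro mult_right_mono) auto
    then show "\<bar>K s - K t\<bar> \<le> 5 * B * \<bar>s - t\<bar>" using lip[of s t] by linarith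
  qed
qed

text \<open>Separates the bandwidth factor, which becomes \<theta>, from a function of standardized
  covariates, as \<open>pooled_kernel\<close> expects.\<close>

lemma avg_weight_std: "avg_weight K H x xs c J j = 1 / H * ((\<Sum>k<c. K (pool_std xs c J x H j k)) / real c)"
  by (simp add: avg_weight_def Kh_def pool_std_def sum_divide_distrib[symmetric] mult.commute)

lemma prod_weight_std: "prod_weight K H x xs c J j = 1 / H ^ c * (\<Prod>k<c. K (pool_std xs c J x H j k))"
  by (simp add: prod_weight_def Kh_def pool_std_def prod_dividef)

theorem theorem4p2:
  fixes M :: "'a measure" and X Y :: "nat \<Rightarrow> 'a \<Rightarrow> real"
    and m \<sigma>2 f K :: "real \<Rightarrow> real" and h :: "nat \<Rightarrow> real"
    and p c :: nat and x a b :: real and \<J> :: "real set"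
  assumes "prob_space M" and "c \<ge> 1"
    and iid: "prob_space.indep_vars M (\<lambda>_. borel) (\<lambda>i \<omega>. (Y i \<omega>, X i \<omega>)) UNIV"
      "\<And>i. distr M borel (\<lambda>\<omega>. (Y i \<omega>, X i \<omega>)) = distr M borel (\<lambda>\<omega>. (Y 0 \<omega>, X 0 \<omega>))"
    and f_density: "distributed M lborel (X 0) (\<lambda>s. ennreal (f s))" "\<And>s. 0 \<le> f s"
    and m_regression: "integrable M (Y 0)"
      "AE \<omega> in M. real_cond_exp M (vimage_algebra (space M) (X 0) borel) (Y 0) \<omega> = m (X 0 \<omega>)"
    and \<sigma>2_variance: "has_cond_var M (vimage_algebra (space M) (X 0) borel) (Y 0) (\<lambda>\<omega>. \<sigma>2 (X 0 \<omega>))"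
    and smooth: "continuously_differentiable_order (p + 3) m"
      "continuously_differentiable_order 2 \<sigma>2" "continuously_differentiable_order 2 f"
    and "f x > 0"
    and kernel: "(\<integral>t. K t \<partial>lborel) = 1" "\<And>t. K (- t) = K t"
    and moments: "\<And>l. l \<le> 2 * p \<Longrightarrow> integrable lborel (\<lambda>t. t ^ l * K t)"
      "\<And>l. l \<le> 2 * p \<Longrightarrow> integrable lborel (\<lambda>t. t ^ l * (K t)\<^sup>2)"
    and "invertible_mat (mu_mat K p 0)"
    and interior: "a < x" "x < b"
    and bounded_away: "is_interval \<J>" "{a..b} \<subseteq> \<J>" "\<exists>\<epsilon>>0. \<forall>s\<in>\<J>. \<epsilon> \<le> f s"
    and support: "\<And>t. 1 < \<bar>t\<bar> \<Longrightarrow> K \<bar>t\<bar> = 0"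
    and K_deriv: "\<And>t. K differentiable (at t)" "bounded (range (deriv K))"
    and bandwidth: "\<And>J. 0 < h J" "h \<longlonglongrightarrow> 0"
      "filterlim (\<lambda>J. real J * h J ^ 4) at_top sequentially"
  defines "mhat1 \<equiv> \<lambda>J \<omega>. mhat_avg K p x (h J) (\<lambda>i. X i \<omega>) (\<lambda>i. Y i \<omega>) c J"
    and "mhat2 \<equiv> \<lambda>J \<omega>. mhat_prod K p x (h J) (\<lambda>i. X i \<omega>) (\<lambda>i. Y i \<omega>) c J"
  shows "has_expansion M mhat1 K p c m f x h
       \<and> has_cond_var_asymp M X mhat1 K p c \<sigma>2 f x h
       \<and> ((\<forall>l\<le>2 * p. integrable lborel (\<lambda>t. t ^ l * dagger c K t)
                    \<and> integrable lborel (\<lambda>t. t ^ l * (dagger c K t)\<^sup>2))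
            \<and> invertible_mat (mu_mat (dagger c K) p 0)
          \<longrightarrow> has_expansion M mhat2 (dagger c K) p c m f x h
              \<and> has_cond_var_asymp M X mhat2 (dagger c K) p c \<sigma>2 f x h)"
proof -
  interpret prob_space M by fact
  \<comment> \<open>The support condition is stated at |t|; evenness transfers it to negative
    t.\<close>
  have K_van: "K t = 0" if "1 < \<bar>t\<bar>" for t
    using support[OF that] kernel(2)[of t] by (cases "0 \<le> t") (simp_all add: abs_if)
  have K_cont: "continuous_on UNIV K"
    using K_deriv(1) by (intro differentiable_imp_continuous_on) (simp add: differentiable_on_def differentiable_at_withinI)
  then have K_meas [measurable]: "K \<in> borel_measurable borel" by (rule borel_measurable_continuous_onI)
  obtain L where L: "\<And>t. \<bar>t\<bar> \<le> 2 \<Longrightarrow> \<bar>K t\<bar> \<le> L" "\<And>s t. \<bar>s\<bar> \<le> 2 \<Longrightarrow> \<bar>t\<bar> \<le> 2 \<Longrightarrow> \<bar>K s - K t\<bar> \<le> L * \<bar>s - t\<bar>"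
    using bounded_derivative_Lipschitz[OF K_deriv K_van] by blast
  interpret pooled_asymptotics M X Y m \<sigma>2 f x c h
  proof unfold_locales
    show "continuous_on UNIV m" using smooth(1) by (rule cont_diff_order_continuous) simp
    show "continuous_on UNIV \<sigma>2" using smooth(2) by (rule cont_diff_order_continuous) simp
  qed (use assms in auto)

  have avg: "has_expansion M mhat1 K p c m f x h \<and> has_cond_var_asymp M X mhat1 K p c \<sigma>2 f x h"
  proof -
    \<comment> \<open>The average of c equal values is K itself, so G is K; the factor of
      \<open>Kh\<close> serves as \<theta>.\<close>
    interpret A: pooled_kernel M X Y m \<sigma>2 f x c h "\<lambda>u. (\<Sum>k<c. K (u k)) / real c" K p "\<lambda>J. 1 / h J"
    proof unfold_locales
      show "\<exists>L. near_diag L c (\<lambda>u. (\<Sum>k<c. K (u k)) / real c) K"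
        using near_diag_avg[OF \<open>c \<ge> 1\<close> L] by blast
      fix N :: "(nat \<Rightarrow> real) measure" and g :: "nat \<Rightarrow> (nat \<Rightarrow> real) \<Rightarrow> real"
      assume g: "\<And>k. k < c \<Longrightarrow> g k \<in> borel_measurable N"
      then show "(\<lambda>\<omega>. (\<Sum>k<c. K (g k \<omega>)) / real c) \<in> borel_measurable N"
        by (intro borel_measurable_divide borel_measurable_sum measurable_compose[OF g K_meas]) auto
    qed (use assms K_van in auto)
    have "mhat1 = A.Tstat"
      unfolding mhat1_def A.Tstat_def mhat_avg_def avg_weight_std[abs_def] std_def by (intro ext) (rule refl)
    then show ?thesis using A.Tstat_expansion A.Tstat_cond_var_asymp by simp
  qed
  have prod: "has_expansion M mhat2 (dagger c K) p c m f x h \<and> has_cond_var_asymp M X mhat2 (dagger c K) p c \<sigma>2 f x h"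
    if inv: "invertible_mat (mu_mat (dagger c K) p 0)"
  proof -
    \<comment> \<open>On the diagonal the product is the power K^c, and \<open>Kh\<close>
      contributes one factor 1/h per member of the pool.\<close>
    interpret A: pooled_kernel M X Y m \<sigma>2 f x c h "\<lambda>u. \<Prod>k<c. K (u k)" "dagger c K" p "\<lambda>J. 1 / h J ^ c"
    proof unfold_locales
      show "\<exists>L. near_diag L c (\<lambda>u. \<Prod>k<c. K (u k)) (dagger c K)"
        using near_diag_prod[OF \<open>c \<ge> 1\<close> L order_refl] by (simp add: dagger_def[abs_def])
      show "(\<Prod>k<c. K (u k)) = 0" if "\<And>k. k < c \<Longrightarrow> 1 < \<bar>u k\<bar>" for u
        using K_van[OF that[of 0]] \<open>c \<ge> 1\<close> by (auto intro!: prod_zero bexI[of _ 0])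
      show "dagger c K t = 0" if "1 < \<bar>t\<bar>" for t
        using K_van[OF that] \<open>c \<ge> 1\<close> by (simp add: dagger_def)
      show "dagger c K \<in> borel_measurable borel" unfolding dagger_def[abs_def] by measurable
      fix N :: "(nat \<Rightarrow> real) measure" and g :: "nat \<Rightarrow> (nat \<Rightarrow> real) \<Rightarrow> real"
      assume g: "\<And>k. k < c \<Longrightarrow> g k \<in> borel_measurable N"
      then show "(\<lambda>\<omega>. \<Prod>k<c. K (g k \<omega>)) \<in> borel_measurable N"
        by (intro borel_measurable_prod measurable_compose[OF g K_meas]) auto
    qed (use assms inv in auto)
    have "mhat2 = A.Tstat"
      unfolding mhat2_def A.Tstat_def mhat_prod_def prod_weight_std[abs_def] std_def by (intro ext) (rule refl)
    then show ?thesis using A.Tstat_expansion A.Tstat_cond_var_asymp by simp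
  qed
  from avg prod show ?thesis by blast
qed

end
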